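(* (PBW theorem.) Let $K$ be a field, let $\Gamma=(G,V)$ be a finite reflection group over $K$ all of whose reflections are diagonalizable, let $R$ be a commutative $K$-algebra, let $t\in R$ and let $c:\mathcal C_\Gamma\to R$ be a map. Let $(y_i)_{i=1}^n$ be a basis of $V$ with dual basis $(x_i)_{i=1}^n$ of $V^*$. Then the elements $$x_1^{\alpha_1}\cdots x_n^{\alpha_n}\,y_1^{\beta_1}\cdots y_n^{\beta_n}\,g,\qquad \alpha,\beta\in\mathbb N^n,\ g\in G,$$ form an $R$-basis of the rational Cherednik algebra $H_{t,c}$. Equivalently, the $R$-linear PBW morphism $R[V\oplus V^*]\rtimes RG\to H_{t,c}$ mapping $x^\alpha y^\beta g$ to the product $x^\alpha y^\beta g$ in $H_{t,c}$ is an isomorphism of $R$-modules.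
   Context: A finite reflection group $\Gamma=(G,V)$ over $K$ consists of a non-trivial finite group $G$ and a faithful finite-dimensional $KG$-module $V$ such that $G$ is generated by the set $\mathrm{Ref}_\Gamma$ of $s\in G$ for which $\mathrm{Ker}(\mathrm{id}_V-s)$ has codimension one. $\mathcal C_\Gamma$ is the set of $G$-conjugacy classes of reflections; $c(s)$ denotes the value of $c$ on the class of $s$. For $s\in\mathrm{Ref}_\Gamma$, $\alpha_s^\vee$ is a non-zero element of $\mathrm{Im}(\mathrm{id}_V-s)$ and $\alpha_s\in V^*$ has kernel $\mathrm{Ker}(\mathrm{id}_V-s)$; $s$ diagonalizable means $\langle\alpha_s^\vee,\alpha_s\rangle\ne0$, with $\langle\cdot,\cdot\rangle$ the canonical pairing of $V$ and $V^*$. Put $(y,x)_s=\langle y,\alpha_s\rangle\langle\alpha_s^\vee,x\rangle/\langle\alpha_s^\vee,\alpha_s\rangle\in K$. $R\langle V\oplus V^*\rangle\rtimes RG$ is the semidirect product of the tensor algebra over $R$ generated by $V$ and $V^*$ with the group algebra (so $g v=({}^gv)g$ for $v\in V\oplus V^*$). $H_{t,c}$ is its quotient by the ideal generated by the relations $[x,x']=0$ ($x,x'\in V^*$), $[y,y']=0$ ($y,y'\in V$), and $[y,x]=t\langle y,x\rangle+\sum_{s\in\mathrm{Ref}_\Gamma}(y,x)_s\,c(s)\,s$ ($x\in V^*,y\in V$). $R[V\oplus V^*]$ is the symmetric algebra over $R$ generated by $V^*$ and $V$. *)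

theory Defs
  imports "HOL.Vector_Spaces" "HOL-Algebra.QuotRing" "HOL-Algebra.Module" "HOL-Algebra.Generated_Groups"
begin

section \<open>Finite reflection groups\<close>

context vector_space
begin

definition dual_space :: "('b \<Rightarrow> 'a) set"
  where "dual_space = {x. Vector_Spaces.linear scale (*) x}"

definition basis_family :: "nat \<Rightarrow> (nat \<Rightarrow> 'b) \<Rightarrow> bool"
  where "basis_family n y \<longleftrightarrow>
    inj_on y {1..n} \<and> independent (y ` {1..n}) \<and> span (y ` {1..n}) = UNIV"

definition dual_family :: "nat \<Rightarrow> (nat \<Rightarrow> 'b) \<Rightarrow> (nat \<Rightarrow> 'b \<Rightarrow> 'a) \<Rightarrow> bool"
  where "dual_family n y x \<longleftrightarrow>
    (\<forall>i\<in>{1..n}. x i \<in> dual_space) \<and> (\<forall>i\<in>{1..n}. \<forall>j\<in>{1..n}. x i (y j) = (if i = j then 1 else 0))"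

end

definition conj_class :: "('g, 'm) monoid_scheme \<Rightarrow> 'g \<Rightarrow> 'g set"
  where "conj_class G s = {g \<otimes>\<^bsub>G\<^esub> s \<otimes>\<^bsub>G\<^esub> inv\<^bsub>G\<^esub> g | g. g \<in> carrier G}"

locale group_representation = vector_space scale + group G
  for scale :: "'k::field \<Rightarrow> 'v::ab_group_add \<Rightarrow> 'v"
    and G :: "('g, 'm) monoid_scheme" (structure) +
  fixes \<rho> :: "'g \<Rightarrow> 'v \<Rightarrow> 'v"
  assumes rep_linear: "g \<in> carrier G \<Longrightarrow> Vector_Spaces.linear scale scale (\<rho> g)"
    and rep_one: "\<rho> \<one> v = v"
    and rep_mult: "g \<in> carrier G \<Longrightarrow> h \<in> carrier G \<Longrightarrow> \<rho> (g \<otimes> h) v = \<rho> g (\<rho> h v)"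
begin

definition fixed_space :: "'g \<Rightarrow> 'v set"
  where "fixed_space s = {v. v - \<rho> s v = 0}"

definition reflections :: "'g set"
  where "reflections = {s \<in> carrier G. dim (UNIV :: 'v set) = dim (fixed_space s) + 1}"

end

locale finite_reflection_group = group_representation +
  assumes finite_group: "finite (carrier G)"
    and nontrivial_group: "carrier G \<noteq> {\<one>}"
    and finite_dim: "\<exists>B. finite B \<and> span B = UNIV"
    and faithful: "inj_on \<rho> (carrier G)"
    and generated_by_reflections: "generate G reflections = carrier G"


section \<open>Algebras over a commutative \<open>K\<close>-algebra \<open>R\<close>\<close>

text \<open>
  The unit of \<open>R\<close> is \<open>\<phi> 1\<close>, where \<open>\<phi> : K \<rightarrow> R\<close> is the structure map. The class \<^class>\<open>comm_ring\<close>
  is used for \<open>R\<close> because \<^class>\<open>comm_ring_1\<close> would exclude \<open>R = 0\<close>.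
\<close>

locale commutative_algebra =
  fixes \<phi> :: "'k::field \<Rightarrow> 'r::comm_ring"
  assumes algebra_add: "\<phi> (a + b) = \<phi> a + \<phi> b"
    and algebra_mult: "\<phi> (a * b) = \<phi> a * \<phi> b"
    and algebra_unit: "\<phi> 1 * r = r"

text \<open>
  An \<open>R\<close>-algebra is a record of type \<^typ>\<open>('r, 'a) module\<close>: a ring together with a scalar
  multiplication by the elements of the type \<^typ>\<open>'r\<close>. The quotient by an ideal \<open>I\<close> is the
  library's quotient ring \<open>A Quot I\<close> with the induced scalar multiplication.
\<close>

definition quot_algebra :: "('r, 'a) module \<Rightarrow> 'a set \<Rightarrow> ('r, 'a set) module"
  where "quot_algebra A I =
    \<lparr>carrier = carrier (A Quot I), mult = mult (A Quot I), one = one (A Quot I),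
     zero = zero (A Quot I), add = add (A Quot I),
     smult = (\<lambda>r X. \<Union>a\<in>X. I +>\<^bsub>A\<^esub> (r \<odot>\<^bsub>A\<^esub> a))\<rparr>"

definition is_basis :: "('r::comm_ring, 'a) module \<Rightarrow> 'i set \<Rightarrow> ('i \<Rightarrow> 'a) \<Rightarrow> bool"
  where "is_basis M J b \<longleftrightarrow>
    (\<forall>i\<in>J. b i \<in> carrier M) \<and>
    (\<forall>m\<in>carrier M. \<exists>F a. finite F \<and> F \<subseteq> J \<and> m = (\<Oplus>\<^bsub>M\<^esub>i\<in>F. a i \<odot>\<^bsub>M\<^esub> b i)) \<and>
    (\<forall>F a. finite F \<and> F \<subseteq> J \<and> (\<Oplus>\<^bsub>M\<^esub>i\<in>F. a i \<odot>\<^bsub>M\<^esub> b i) = \<zero>\<^bsub>M\<^esub> \<longrightarrow> (\<forall>i\<in>F. a i = 0))"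

definition linear_map :: "('r, 'a) module \<Rightarrow> ('r, 'b) module \<Rightarrow> ('a \<Rightarrow> 'b) \<Rightarrow> bool"
  where "linear_map M N f \<longleftrightarrow>
    f \<in> carrier M \<rightarrow>\<^sub>E carrier N \<and>
    (\<forall>m\<in>carrier M. \<forall>m'\<in>carrier M. f (m \<oplus>\<^bsub>M\<^esub> m') = f m \<oplus>\<^bsub>N\<^esub> f m') \<and>
    (\<forall>r. \<forall>m\<in>carrier M. f (r \<odot>\<^bsub>M\<^esub> m) = r \<odot>\<^bsub>N\<^esub> f m)"


subsection \<open>Tensor and symmetric algebras\<close>

text \<open>
  The free \<open>R\<close>-algebra on the set \<open>W\<close>: finitely supported functions on the words over \<open>W\<close>, with
  the convolution product for concatenation.
\<close>

definition free_algebra :: "('k::field \<Rightarrow> 'r::comm_ring) \<Rightarrow> 'w set \<Rightarrow> ('r, 'w list \<Rightarrow> 'r) module"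
  where "free_algebra \<phi> W =
    \<lparr>carrier = {f. finite {u. f u \<noteq> 0} \<and> {u. f u \<noteq> 0} \<subseteq> lists W},
     mult = (\<lambda>f f' u. \<Sum>i\<le>length u. f (take i u) * f' (drop i u)),
     one = (\<lambda>u. if u = [] then \<phi> 1 else 0),
     zero = (\<lambda>u. 0),
     add = (\<lambda>f f' u. f u + f' u),
     smult = (\<lambda>r f u. r * f u)\<rparr>"

definition free_gen :: "('k::field \<Rightarrow> 'r::comm_ring) \<Rightarrow> 'w \<Rightarrow> 'w list \<Rightarrow> 'r"
  where "free_gen \<phi> w = (\<lambda>u. if u = [w] then \<phi> 1 else 0)"

text \<open>
  For a \<open>K\<close>-vector space \<open>W\<close> the tensor algebra over \<open>R\<close> generated by \<open>W\<close>, i.e. the tensor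
  algebra of the \<open>R\<close>-module \<open>R \<otimes> W\<close>, is the quotient of the free algebra on the set \<open>W\<close> by the
  ideal expressing that \<open>W\<close> embeds \<open>K\<close>-linearly. The \<open>mult\<close> and \<open>one\<close> fields of \<open>W\<close> are not used.
\<close>

definition tensor_ideal ::
    "('k::field \<Rightarrow> 'r::comm_ring) \<Rightarrow> ('k, 'w) module \<Rightarrow> ('w list \<Rightarrow> 'r) set"
  where "tensor_ideal \<phi> W =
    (let F = free_algebra \<phi> (carrier W) in
      Idl\<^bsub>F\<^esub>
       ({free_gen \<phi> (w \<oplus>\<^bsub>W\<^esub> w') \<ominus>\<^bsub>F\<^esub> (free_gen \<phi> w \<oplus>\<^bsub>F\<^esub> free_gen \<phi> w') | w w'.
          w \<in> carrier W \<and> w' \<in> carrier W} \<union>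
        {free_gen \<phi> (a \<odot>\<^bsub>W\<^esub> w) \<ominus>\<^bsub>F\<^esub> (\<phi> a \<odot>\<^bsub>F\<^esub> free_gen \<phi> w) | a w. w \<in> carrier W}))"

definition tensor_algebra ::
    "('k::field \<Rightarrow> 'r::comm_ring) \<Rightarrow> ('k, 'w) module \<Rightarrow> ('r, ('w list \<Rightarrow> 'r) set) module"
  where "tensor_algebra \<phi> W = quot_algebra (free_algebra \<phi> (carrier W)) (tensor_ideal \<phi> W)"

definition tensor_gen ::
    "('k::field \<Rightarrow> 'r::comm_ring) \<Rightarrow> ('k, 'w) module \<Rightarrow> 'w \<Rightarrow> ('w list \<Rightarrow> 'r) set"
  where "tensor_gen \<phi> W w = tensor_ideal \<phi> W +>\<^bsub>free_algebra \<phi> (carrier W)\<^esub> free_gen \<phi> w"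

definition commutator :: "('a, 'm) ring_scheme \<Rightarrow> 'a \<Rightarrow> 'a \<Rightarrow> 'a"
  where "commutator A a b = a \<otimes>\<^bsub>A\<^esub> b \<ominus>\<^bsub>A\<^esub> b \<otimes>\<^bsub>A\<^esub> a"

definition symmetric_ideal ::
    "('k::field \<Rightarrow> 'r::comm_ring) \<Rightarrow> ('k, 'w) module \<Rightarrow> ('w list \<Rightarrow> 'r) set set"
  where "symmetric_ideal \<phi> W =
    Idl\<^bsub>tensor_algebra \<phi> W\<^esub>
      {commutator (tensor_algebra \<phi> W) (tensor_gen \<phi> W w) (tensor_gen \<phi> W w') | w w'.
        w \<in> carrier W \<and> w' \<in> carrier W}"

definition symmetric_algebra ::
    "('k::field \<Rightarrow> 'r::comm_ring) \<Rightarrow> ('k, 'w) module \<Rightarrow> ('r, ('w list \<Rightarrow> 'r) set set) module"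
  where "symmetric_algebra \<phi> W = quot_algebra (tensor_algebra \<phi> W) (symmetric_ideal \<phi> W)"

definition symmetric_gen ::
    "('k::field \<Rightarrow> 'r::comm_ring) \<Rightarrow> ('k, 'w) module \<Rightarrow> 'w \<Rightarrow> ('w list \<Rightarrow> 'r) set set"
  where "symmetric_gen \<phi> W w = symmetric_ideal \<phi> W +>\<^bsub>tensor_algebra \<phi> W\<^esub> tensor_gen \<phi> W w"


subsection \<open>Semidirect product with the group algebra of a finite group\<close>

text \<open>
  For a finite group \<open>G\<close> acting on the \<open>R\<close>-algebra \<open>A\<close> by automorphisms, \<open>F : G \<rightarrow> A\<close> stands for
  the sum of the \<open>F(g) g\<close>, and \<open>(a g) (b h) = a (g b) g h\<close>.
\<close>

definition semidirect ::
    "('r, 'a) module \<Rightarrow> ('g, 'm) monoid_scheme \<Rightarrow> ('g \<Rightarrow> 'a \<Rightarrow> 'a) \<Rightarrow> ('r, 'g \<Rightarrow> 'a) module"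
  where "semidirect A G act =
    \<lparr>carrier = carrier G \<rightarrow>\<^sub>E carrier A,
     mult = (\<lambda>F F'. \<lambda>g\<in>carrier G.
       \<Oplus>\<^bsub>A\<^esub>h\<in>carrier G. F h \<otimes>\<^bsub>A\<^esub> act h (F' (inv\<^bsub>G\<^esub> h \<otimes>\<^bsub>G\<^esub> g))),
     one = (\<lambda>g\<in>carrier G. if g = \<one>\<^bsub>G\<^esub> then \<one>\<^bsub>A\<^esub> else \<zero>\<^bsub>A\<^esub>),
     zero = (\<lambda>g\<in>carrier G. \<zero>\<^bsub>A\<^esub>),
     add = (\<lambda>F F'. \<lambda>g\<in>carrier G. F g \<oplus>\<^bsub>A\<^esub> F' g),
     smult = (\<lambda>r F. \<lambda>g\<in>carrier G. r \<odot>\<^bsub>A\<^esub> F g)\<rparr>"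

text \<open>The element \<open>a g\<close> of the semidirect product.\<close>

definition semidirect_elem ::
    "('r, 'a) module \<Rightarrow> ('g, 'm) monoid_scheme \<Rightarrow> 'a \<Rightarrow> 'g \<Rightarrow> 'g \<Rightarrow> 'a"
  where "semidirect_elem A G a g = (\<lambda>h\<in>carrier G. if h = g then a else \<zero>\<^bsub>A\<^esub>)"


section \<open>Rational Cherednik algebras\<close>

text \<open>
  \<open>\<alpha> s\<close> is a linear form with kernel \<open>Ker (id - s)\<close>, and \<open>\<alpha>v s\<close> is a non-zero element of
  \<open>Im (id - s)\<close>. The parameter \<open>c\<close> is only ever evaluated at the conjugacy classes of reflections.
\<close>

locale cherednik_datum = finite_reflection_group scale G \<rho> + commutative_algebra \<phi>
  for scale :: "'k::field \<Rightarrow> 'v::ab_group_add \<Rightarrow> 'v"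
    and G :: "('g, 'm) monoid_scheme" (structure)
    and \<rho> :: "'g \<Rightarrow> 'v \<Rightarrow> 'v"
    and \<phi> :: "'k \<Rightarrow> 'r::comm_ring" +
  fixes \<alpha> :: "'g \<Rightarrow> 'v \<Rightarrow> 'k"
    and \<alpha>v :: "'g \<Rightarrow> 'v"
    and t :: 'r
    and c :: "'g set \<Rightarrow> 'r"
  assumes root_dual: "s \<in> reflections \<Longrightarrow> \<alpha> s \<in> dual_space"
    and root_kernel: "s \<in> reflections \<Longrightarrow> {v. \<alpha> s v = 0} = fixed_space s"
    and coroot_nonzero: "s \<in> reflections \<Longrightarrow> \<alpha>v s \<noteq> 0"
    and coroot_image: "s \<in> reflections \<Longrightarrow> \<alpha>v s \<in> range (\<lambda>v. v - \<rho> s v)"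
begin

definition diagonalizable :: "'g \<Rightarrow> bool"
  where "diagonalizable s \<longleftrightarrow> \<alpha> s (\<alpha>v s) \<noteq> 0"

text \<open>\<open>pairing s y x\<close> is \<open>(y, x)\<^sub>s\<close>.\<close>

definition pairing :: "'g \<Rightarrow> 'v \<Rightarrow> ('v \<Rightarrow> 'k) \<Rightarrow> 'k"
  where "pairing s y x = \<alpha> s y * x (\<alpha>v s) / \<alpha> s (\<alpha>v s)"

text \<open>The \<open>K\<close>-vector space \<open>V \<oplus> V*\<close> and the action of \<open>G\<close> on it.\<close>

definition VV :: "('k, 'v \<times> ('v \<Rightarrow> 'k)) module"
  where "VV =
    \<lparr>carrier = UNIV \<times> dual_space, mult = undefined, one = undefined,
     zero = (0, \<lambda>v. 0),
     add = (\<lambda>(y, x) (y', x'). (y + y', \<lambda>v. x v + x' v)),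
     smult = (\<lambda>a (y, x). (scale a y, \<lambda>v. a * x v))\<rparr>"

definition VV_act :: "'g \<Rightarrow> 'v \<times> ('v \<Rightarrow> 'k) \<Rightarrow> 'v \<times> ('v \<Rightarrow> 'k)"
  where "VV_act g = (\<lambda>(y, x). (\<rho> g y, \<lambda>v. x (\<rho> (inv g) v)))"

text \<open>
  The induced actions by algebra automorphisms: \<open>g\<close> sends the word \<open>w\<^sub>1 \<dots> w\<^sub>m\<close> to
  \<open>(g w\<^sub>1) \<dots> (g w\<^sub>m)\<close>, and it sends a coset of an invariant ideal to its image.
\<close>

definition free_act :: "'g \<Rightarrow> (('v \<times> ('v \<Rightarrow> 'k)) list \<Rightarrow> 'r) \<Rightarrow> ('v \<times> ('v \<Rightarrow> 'k)) list \<Rightarrow> 'r"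
  where "free_act g f = (\<lambda>u. f (map (VV_act (inv g)) u))"

definition tensor_act ::
    "'g \<Rightarrow> (('v \<times> ('v \<Rightarrow> 'k)) list \<Rightarrow> 'r) set \<Rightarrow> (('v \<times> ('v \<Rightarrow> 'k)) list \<Rightarrow> 'r) set"
  where "tensor_act g X = free_act g ` X"

definition symmetric_act ::
    "'g \<Rightarrow> (('v \<times> ('v \<Rightarrow> 'k)) list \<Rightarrow> 'r) set set \<Rightarrow> (('v \<times> ('v \<Rightarrow> 'k)) list \<Rightarrow> 'r) set set"
  where "symmetric_act g X = tensor_act g ` X"

abbreviation "T \<equiv> tensor_algebra \<phi> VV"

definition tensor_semidirect ::
    "('r, 'g \<Rightarrow> (('v \<times> ('v \<Rightarrow> 'k)) list \<Rightarrow> 'r) set) module"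
  where "tensor_semidirect = semidirect T G tensor_act"

definition tensor_V :: "'v \<Rightarrow> 'g \<Rightarrow> (('v \<times> ('v \<Rightarrow> 'k)) list \<Rightarrow> 'r) set"
  where "tensor_V y = semidirect_elem T G (tensor_gen \<phi> VV (y, \<lambda>v. 0)) \<one>"

definition tensor_dual :: "('v \<Rightarrow> 'k) \<Rightarrow> 'g \<Rightarrow> (('v \<times> ('v \<Rightarrow> 'k)) list \<Rightarrow> 'r) set"
  where "tensor_dual x = semidirect_elem T G (tensor_gen \<phi> VV (0, x)) \<one>"

definition tensor_G :: "'g \<Rightarrow> 'g \<Rightarrow> (('v \<times> ('v \<Rightarrow> 'k)) list \<Rightarrow> 'r) set"
  where "tensor_G g = semidirect_elem T G \<one>\<^bsub>T\<^esub> g"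

definition cherednik_rhs ::
    "'v \<Rightarrow> ('v \<Rightarrow> 'k) \<Rightarrow> 'g \<Rightarrow> (('v \<times> ('v \<Rightarrow> 'k)) list \<Rightarrow> 'r) set"
  where "cherednik_rhs y x =
    (let A = tensor_semidirect in
      ((t * \<phi> (x y)) \<odot>\<^bsub>A\<^esub> \<one>\<^bsub>A\<^esub>) \<oplus>\<^bsub>A\<^esub>
      (\<Oplus>\<^bsub>A\<^esub>s\<in>reflections. (\<phi> (pairing s y x) * c (conj_class G s)) \<odot>\<^bsub>A\<^esub> tensor_G s))"

definition cherednik_ideal :: "('g \<Rightarrow> (('v \<times> ('v \<Rightarrow> 'k)) list \<Rightarrow> 'r) set) set"
  where "cherednik_ideal =
    (let A = tensor_semidirect in
      Idl\<^bsub>A\<^esub>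
       ({commutator A (tensor_dual x) (tensor_dual x') | x x'. x \<in> dual_space \<and> x' \<in> dual_space} \<union>
        {commutator A (tensor_V y) (tensor_V y') | y y'. True} \<union>
        {commutator A (tensor_V y) (tensor_dual x) \<ominus>\<^bsub>A\<^esub> cherednik_rhs y x | y x. x \<in> dual_space}))"

definition cherednik_algebra ::
    "('r, ('g \<Rightarrow> (('v \<times> ('v \<Rightarrow> 'k)) list \<Rightarrow> 'r) set) set) module"
  where "cherednik_algebra = quot_algebra tensor_semidirect cherednik_ideal"

definition cherednik_V :: "'v \<Rightarrow> ('g \<Rightarrow> (('v \<times> ('v \<Rightarrow> 'k)) list \<Rightarrow> 'r) set) set"
  where "cherednik_V y = cherednik_ideal +>\<^bsub>tensor_semidirect\<^esub> tensor_V y"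

definition cherednik_dual :: "('v \<Rightarrow> 'k) \<Rightarrow> ('g \<Rightarrow> (('v \<times> ('v \<Rightarrow> 'k)) list \<Rightarrow> 'r) set) set"
  where "cherednik_dual x = cherednik_ideal +>\<^bsub>tensor_semidirect\<^esub> tensor_dual x"

definition cherednik_G :: "'g \<Rightarrow> ('g \<Rightarrow> (('v \<times> ('v \<Rightarrow> 'k)) list \<Rightarrow> 'r) set) set"
  where "cherednik_G g = cherednik_ideal +>\<^bsub>tensor_semidirect\<^esub> tensor_G g"


subsection \<open>The PBW morphism\<close>

abbreviation "S \<equiv> symmetric_algebra \<phi> VV"

text \<open>\<open>R[V \<oplus> V*] \<rtimes> RG\<close>\<close>

definition symmetric_semidirect ::
    "('r, 'g \<Rightarrow> (('v \<times> ('v \<Rightarrow> 'k)) list \<Rightarrow> 'r) set set) module"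
  where "symmetric_semidirect = semidirect S G symmetric_act"

definition symmetric_V :: "'v \<Rightarrow> 'g \<Rightarrow> (('v \<times> ('v \<Rightarrow> 'k)) list \<Rightarrow> 'r) set set"
  where "symmetric_V y = semidirect_elem S G (symmetric_gen \<phi> VV (y, \<lambda>v. 0)) \<one>"

definition symmetric_dual :: "('v \<Rightarrow> 'k) \<Rightarrow> 'g \<Rightarrow> (('v \<times> ('v \<Rightarrow> 'k)) list \<Rightarrow> 'r) set set"
  where "symmetric_dual x = semidirect_elem S G (symmetric_gen \<phi> VV (0, x)) \<one>"

definition symmetric_G :: "'g \<Rightarrow> 'g \<Rightarrow> (('v \<times> ('v \<Rightarrow> 'k)) list \<Rightarrow> 'r) set set"
  where "symmetric_G g = semidirect_elem S G \<one>\<^bsub>S\<^esub> g"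

end

text \<open>The product \<open>(z 1) ^ (a 1) \<cdots> (z n) ^ (a n)\<close> in this order.\<close>

definition ordered_monomial :: "('a, 'm) monoid_scheme \<Rightarrow> nat \<Rightarrow> (nat \<Rightarrow> 'a) \<Rightarrow> (nat \<Rightarrow> nat) \<Rightarrow> 'a"
  where "ordered_monomial A n z a =
    foldr (\<lambda>i p. (z i [^]\<^bsub>A\<^esub> a i) \<otimes>\<^bsub>A\<^esub> p) [1..<Suc n] \<one>\<^bsub>A\<^esub>"

definition pbw_index :: "nat \<Rightarrow> ('g, 'm) monoid_scheme \<Rightarrow> ((nat \<Rightarrow> nat) \<times> (nat \<Rightarrow> nat) \<times> 'g) set"
  where "pbw_index n G = ({1..n} \<rightarrow>\<^sub>E UNIV) \<times> ({1..n} \<rightarrow>\<^sub>E UNIV) \<times> carrier G"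

context cherednik_datum
begin

definition cherednik_pbw where
  "cherednik_pbw n x y = (\<lambda>(a, b, g).
    ordered_monomial cherednik_algebra n (\<lambda>i. cherednik_dual (x i)) a \<otimes>\<^bsub>cherednik_algebra\<^esub>
    ordered_monomial cherednik_algebra n (\<lambda>i. cherednik_V (y i)) b \<otimes>\<^bsub>cherednik_algebra\<^esub>
    cherednik_G g)"

definition symmetric_pbw where
  "symmetric_pbw n x y = (\<lambda>(a, b, g).
    ordered_monomial symmetric_semidirect n (\<lambda>i. symmetric_dual (x i)) a \<otimes>\<^bsub>symmetric_semidirect\<^esub>
    ordered_monomial symmetric_semidirect n (\<lambda>i. symmetric_V (y i)) b \<otimes>\<^bsub>symmetric_semidirect\<^esub>
    symmetric_G g)"

text \<open>
  The PBW morphism is characterized by its values on the monomials \<open>x\<^sup>a y\<^sup>b g\<close>; that there is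
  exactly one such map is part of what is to be proved.
\<close>

definition is_pbw_morphism where
  "is_pbw_morphism n x y f \<longleftrightarrow>
    linear_map symmetric_semidirect cherednik_algebra f \<and>
    (\<forall>j\<in>pbw_index n G. f (symmetric_pbw n x y j) = cherednik_pbw n x y j)"

end

end

(*
  The induced module of the Cherednik algebra from the subalgebra generated by V and G can be
  written down without knowing the algebra: it is R[V] tensored with the left regular module of
  R[V*] x| G, on which x in V* acts by multiplication, and y in V by multiplication plus t times the
  derivative along y plus a sum of divided-difference operators, one for each reflection. These
  Dunkl operators commute because their commutators commute with all x (a computation with the
  defining relations) and vanish on the generating copy of R[V*]. Applying a linear combination of
  the monomials x^a y^b g to basis vectors of this module recovers its coefficients, so the
  monomials are independent; they span because every y can be moved to the right past every x. The
  case t = 0, c = 0 gives the same for R[V + V*] x| G, and the PBW morphism matches two bases.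
*)
theory Submission
  imports Defs "HOL-Library.Poly_Mapping" "HOL-Library.Product_Plus" "HOL-Library.Function_Algebras"
begin

section \<open>Algebras over a commutative ring\<close>

text \<open>Divided differences are obtained without dividing polynomials. If
  \<open>x - x \<circ> s = x w * a\<close> for all linear forms \<open>x\<close>, with a fixed form
  \<open>a\<close> proportional to \<open>\<alpha> s\<close>, then
  \<open>(p - p \<circ> s) / a\<close> obeys a twisted Leibniz rule in which \<open>a\<close> no
  longer occurs, and such a rule defines an operator over any \<open>R\<close> as soon as certain
  triangular matrices commute. Diagonalizability permits
  \<open>w = \<alpha>v s / \<alpha> s (\<alpha>v s)\<close>, for which the correction term of the
  rule, times \<open>\<alpha> s y\<close>, is exactly \<open>(y, x)_s\<close>. A vector of the
  module is stored with the group element in front, as a sum of terms \<open>h p\<close>. Then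
  \<open>G\<close> acts by translation and never on polynomials; in exchange \<open>x\<close> and
  \<open>y\<close> act on the component of \<open>h\<close> as \<open>h^-1 x\<close> and
  \<open>h^-1 y\<close>. In the component of the identity they act untwisted, so the coefficient of
  \<open>x^a y^b g\<close> is read off there after applying the element to \<open>g^-1\<close>.
  Vectors are functions on a whole type, of which the group may be a proper subset; the unit
  therefore acts as the projection onto the functions living on the group. The unit of
  \<open>R\<close> is carried along as an explicit element.\<close>

locale unital_algebra = ring A for A :: "('r::comm_ring, 'a) module" (structure) +
  fixes u :: 'r
  assumes smult_closed [simp, intro]: "a \<in> carrier A \<Longrightarrow> r \<odot> a \<in> carrier A"
    and smult_add_left: "a \<in> carrier A \<Longrightarrow> (r + s) \<odot> a = r \<odot> a \<oplus> s \<odot> a"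
    and smult_add_right:
      "\<lbrakk>a \<in> carrier A; b \<in> carrier A\<rbrakk> \<Longrightarrow> r \<odot> (a \<oplus> b) = r \<odot> a \<oplus> r \<odot> b"
    and smult_smult: "a \<in> carrier A \<Longrightarrow> (r * s) \<odot> a = r \<odot> (s \<odot> a)"
    and smult_unit: "a \<in> carrier A \<Longrightarrow> u \<odot> a = a"
    and smult_mult_left:
      "\<lbrakk>a \<in> carrier A; b \<in> carrier A\<rbrakk> \<Longrightarrow> (r \<odot> a) \<otimes> b = r \<odot> (a \<otimes> b)"
    and smult_mult_right:
      "\<lbrakk>a \<in> carrier A; b \<in> carrier A\<rbrakk> \<Longrightarrow> a \<otimes> (r \<odot> b) = r \<odot> (a \<otimes> b)"
begin

lemma zero_smult [simp]: "a \<in> carrier A \<Longrightarrow> 0 \<odot> a = \<zero>"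
  using smult_add_left[of a 0 0] smult_closed[of a 0]
  by (metis add.l_cancel_one add.right_neutral)

lemma smult_zero [simp]: "r \<odot> \<zero> = \<zero>"
  using smult_add_right[of \<zero> \<zero> r] smult_closed[of \<zero> r]
  by (metis add.l_cancel_one l_zero zero_closed)

lemma smult_finsum:
  "finite F \<Longrightarrow> (\<And>i. i \<in> F \<Longrightarrow> f i \<in> carrier A) \<Longrightarrow>
    r \<odot> (\<Oplus>i\<in>F. f i) = (\<Oplus>i\<in>F. r \<odot> f i)"
  by (induction F rule: finite_induct) (auto simp: Pi_def smult_add_right)

lemma finsum_swap:
  assumes "finite F" "finite F'" "\<And>i j. i \<in> F \<Longrightarrow> j \<in> F' \<Longrightarrow> f i j \<in> carrier A"
  shows "(\<Oplus>i\<in>F. \<Oplus>j\<in>F'. f i j) = (\<Oplus>j\<in>F'. \<Oplus>i\<in>F. f i j)"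
  using assms(1,3)
proof (induction F rule: finite_induct)
  case (insert i F)
  have "(\<Oplus>j\<in>F'. \<Oplus>i\<in>insert i F. f i j) = (\<Oplus>j\<in>F'. f i j \<oplus> (\<Oplus>i\<in>F. f i j))"
    using insert by (intro finsum_cong') (auto simp: Pi_def)
  also have "\<dots> = (\<Oplus>j\<in>F'. f i j) \<oplus> (\<Oplus>j\<in>F'. \<Oplus>i\<in>F. f i j)"
    using insert by (intro finsum_addf) (auto simp: Pi_def)
  finally show ?case using insert by (simp add: Pi_def)
qed simp

end

text \<open>Closure is asked under multiplication by \<open>S\<close> from the left only. The
  resulting induction prefixes one generator at a time, which fits both the composition of operators
  and the reordering of products.\<close>

definition generates :: "('r, 'a) module \<Rightarrow> 'a set \<Rightarrow> bool"
  where "generates A S \<longleftrightarrow> S \<subseteq> carrier A \<and>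
    (\<forall>B \<subseteq> carrier A. \<one>\<^bsub>A\<^esub> \<in> B \<and> (\<forall>a\<in>B. \<forall>b\<in>B. a \<oplus>\<^bsub>A\<^esub> b \<in> B) \<and>
      (\<forall>r. \<forall>a\<in>B. r \<odot>\<^bsub>A\<^esub> a \<in> B) \<and> (\<forall>s\<in>S. \<forall>a\<in>B. s \<otimes>\<^bsub>A\<^esub> a \<in> B) \<longrightarrow> carrier A \<subseteq> B)"

lemma generates_induct [consumes 2, case_names one add smult mult]:
  assumes "generates A S" "a \<in> carrier A"
    and "P \<one>\<^bsub>A\<^esub>"
    and "\<And>a b. a \<in> carrier A \<Longrightarrow> b \<in> carrier A \<Longrightarrow> P a \<Longrightarrow> P b \<Longrightarrow> P (a \<oplus>\<^bsub>A\<^esub> b)"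
    and "\<And>r a. a \<in> carrier A \<Longrightarrow> P a \<Longrightarrow> P (r \<odot>\<^bsub>A\<^esub> a)"
    and "\<And>s a. s \<in> S \<Longrightarrow> a \<in> carrier A \<Longrightarrow> P a \<Longrightarrow> P (s \<otimes>\<^bsub>A\<^esub> a)"
    and "unital_algebra A u"
  shows "P a"
proof -
  interpret unital_algebra A u by fact
  let ?B = "{a \<in> carrier A. P a}"
  have "S \<subseteq> carrier A" using assms(1) by (auto simp: generates_def)
  then have "?B \<subseteq> carrier A \<and> \<one>\<^bsub>A\<^esub> \<in> ?B \<and> (\<forall>a\<in>?B. \<forall>b\<in>?B. a \<oplus>\<^bsub>A\<^esub> b \<in> ?B) \<and>
      (\<forall>r. \<forall>a\<in>?B. r \<odot>\<^bsub>A\<^esub> a \<in> ?B) \<and> (\<forall>s\<in>S. \<forall>a\<in>?B. s \<otimes>\<^bsub>A\<^esub> a \<in> ?B)"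
    using assms(3-6) by auto
  then have "carrier A \<subseteq> ?B" using assms(1) unfolding generates_def by blast
  then show ?thesis using assms(2) by auto
qed

subsection \<open>Quotients\<close>

text \<open>Scalars act through the ring elements \<open>r \<odot> \<one>\<close>, so a ring ideal
  is automatically a submodule.\<close>

lemma (in unital_algebra) ideal_smult_closed:
  assumes "ideal I A" "a \<in> I"
  shows "r \<odot> a \<in> I"
proof -
  interpret ideal I A by fact
  have a: "a \<in> carrier A" using assms(2) by simp
  have "r \<odot> a = (r \<odot> \<one>) \<otimes> a" using a by (simp add: smult_mult_left)
  then show ?thesis using assms(2) I_l_closed by simp
qed

text \<open>\<open>quot_algebra A I\<close> and \<open>A Quot I\<close> agree in every ring field
  but are records of different types; the ring axioms are transported along these equal
  fields.\<close>

lemma ring_cong: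
  assumes "ring A" "carrier B = carrier A" "mult B = mult A" "one B = one A"
    "zero B = zero A" "add B = add A"
  shows "ring B"
proof -
  interpret A: ring A by fact
  note [simp] = assms(2-6)
  show ?thesis
  proof (intro ringI abelian_groupI monoidI)
    fix x assume "x \<in> carrier B"
    then show "\<exists>y\<in>carrier B. y \<oplus>\<^bsub>B\<^esub> x = \<zero>\<^bsub>B\<^esub>"
      using A.l_neg by (intro bexI[of _ "\<ominus>\<^bsub>A\<^esub> x"]) simp_all
  qed (simp_all add: A.a_ac A.m_assoc A.l_distr A.r_distr)
qed

lemma quot_algebra_sel [simp]:
  "carrier (quot_algebra A I) = a_rcosets\<^bsub>A\<^esub> I"
  "X \<otimes>\<^bsub>quot_algebra A I\<^esub> Y = rcoset_mult A I X Y"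
  "\<one>\<^bsub>quot_algebra A I\<^esub> = I +>\<^bsub>A\<^esub> \<one>\<^bsub>A\<^esub>"
  "\<zero>\<^bsub>quot_algebra A I\<^esub> = I"
  "X \<oplus>\<^bsub>quot_algebra A I\<^esub> Y = X <+>\<^bsub>A\<^esub> Y"
  by (simp_all add: quot_algebra_def FactRing_def)

context unital_algebra
begin

context
  fixes I
  assumes I: "ideal I A"
begin

interpretation I: ideal I A by (rule I)

lemma quot_closed [simp]: "a \<in> carrier A \<Longrightarrow> I +> a \<in> carrier (quot_algebra A I)"
  by (auto simp: A_RCOSETS_def')

lemma quot_surj:
  "X \<in> carrier (quot_algebra A I) \<Longrightarrow> \<exists>a\<in>carrier A. X = I +> a"
  by (auto simp: A_RCOSETS_def')

lemma quot_add:
  "a \<in> carrier A \<Longrightarrow> b \<in> carrier A \<Longrightarrow>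
    (I +> a) \<oplus>\<^bsub>quot_algebra A I\<^esub> (I +> b) = I +> (a \<oplus> b)"
  by (simp add: I.a_rcos_sum)

lemma quot_mult:
  "a \<in> carrier A \<Longrightarrow> b \<in> carrier A \<Longrightarrow>
    (I +> a) \<otimes>\<^bsub>quot_algebra A I\<^esub> (I +> b) = I +> (a \<otimes> b)"
  by (simp add: I.rcoset_mult_add)

lemma quot_eq_iff:
  "a \<in> carrier A \<Longrightarrow> b \<in> carrier A \<Longrightarrow> I +> a = I +> b \<longleftrightarrow> a \<ominus> b \<in> I"
  using quotient_eq_iff_same_a_r_cos[OF I] by blast

lemma quot_smult:
  assumes a: "a \<in> carrier A"
  shows "r \<odot>\<^bsub>quot_algebra A I\<^esub> (I +> a) = I +> (r \<odot> a)"
proof -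
  \<comment> \<open>The scalar multiple of a coset is defined as a union over its elements, so all
    of them have to yield the same coset.\<close>
  have "I +> (r \<odot> b) = I +> (r \<odot> a)" if b: "b \<in> I +> a" for b
  proof -
    obtain i where i: "i \<in> I" "b = i \<oplus> a"
      using b by (auto simp: a_r_coset_def')
    then have ic: "i \<in> carrier A" by simp
    have "r \<odot> b \<ominus> r \<odot> a = r \<odot> i"
      using a ic i by (simp add: smult_add_right minus_eq a_assoc r_neg)
    then show ?thesis using ideal_smult_closed[OF I i(1)] a ic i
      by (subst quot_eq_iff) auto
  qed
  moreover have "a \<in> I +> a" using a I.a_rcos_self by blast
  ultimately have "(\<Union>b\<in>I +> a. I +> (r \<odot> b)) = I +> (r \<odot> a)" by blast
  then show ?thesis by (simp add: quot_algebra_def)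
qed

lemma quot_unital_algebra: "unital_algebra (quot_algebra A I) u"
proof -
  interpret Q: ring "quot_algebra A I"
    by (rule ring_cong[OF I.quotient_is_ring]) (simp_all only: quot_algebra_def partial_object.simps monoid.simps ring.simps)
  show ?thesis
  proof
    fix X r assume X: "X \<in> carrier (quot_algebra A I)"
    then obtain a where a: "a \<in> carrier A" "X = I +> a" using quot_surj[OF X] by blast
    show "r \<odot>\<^bsub>quot_algebra A I\<^esub> X \<in> carrier (quot_algebra A I)"
      unfolding a(2) by (simp only: a(1) quot_smult quot_closed smult_closed)
    show "u \<odot>\<^bsub>quot_algebra A I\<^esub> X = X" unfolding a(2) by (simp only: a(1) quot_smult smult_unit)
    fix s
    show "(r + s) \<odot>\<^bsub>quot_algebra A I\<^esub> X =
        r \<odot>\<^bsub>quot_algebra A I\<^esub> X \<oplus>\<^bsub>quot_algebra A I\<^esub> s \<odot>\<^bsub>quot_algebra A I\<^esub> X"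
      unfolding a(2) by (simp only: a(1) quot_smult quot_add smult_closed smult_add_left)
    show "(r * s) \<odot>\<^bsub>quot_algebra A I\<^esub> X = r \<odot>\<^bsub>quot_algebra A I\<^esub> (s \<odot>\<^bsub>quot_algebra A I\<^esub> X)"
      unfolding a(2) by (simp only: a(1) quot_smult smult_closed smult_smult)
  next
    fix X Y r assume X: "X \<in> carrier (quot_algebra A I)" and Y: "Y \<in> carrier (quot_algebra A I)"
    then obtain a b where a: "a \<in> carrier A" "X = I +> a" and b: "b \<in> carrier A" "Y = I +> b"
      using quot_surj[OF X] quot_surj[OF Y] by blast
    show "r \<odot>\<^bsub>quot_algebra A I\<^esub> (X \<oplus>\<^bsub>quot_algebra A I\<^esub> Y) =
        r \<odot>\<^bsub>quot_algebra A I\<^esub> X \<oplus>\<^bsub>quot_algebra A I\<^esub> r \<odot>\<^bsub>quot_algebra A I\<^esub> Y"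
      unfolding a(2) b(2) by (simp only: a(1) b(1) quot_smult quot_add smult_closed smult_add_right a_closed)
    show "(r \<odot>\<^bsub>quot_algebra A I\<^esub> X) \<otimes>\<^bsub>quot_algebra A I\<^esub> Y =
        r \<odot>\<^bsub>quot_algebra A I\<^esub> (X \<otimes>\<^bsub>quot_algebra A I\<^esub> Y)"
      unfolding a(2) b(2) by (simp only: a(1) b(1) quot_smult quot_mult smult_closed smult_mult_left m_closed)
    show "X \<otimes>\<^bsub>quot_algebra A I\<^esub> (r \<odot>\<^bsub>quot_algebra A I\<^esub> Y) =
        r \<odot>\<^bsub>quot_algebra A I\<^esub> (X \<otimes>\<^bsub>quot_algebra A I\<^esub> Y)"
      unfolding a(2) b(2) by (simp only: a(1) b(1) quot_smult quot_mult smult_closed smult_mult_right m_closed)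
  qed
qed

lemma quot_finsum:
  assumes "finite F" "\<And>i. i \<in> F \<Longrightarrow> f i \<in> carrier A"
  shows "(\<Oplus>\<^bsub>quot_algebra A I\<^esub>i\<in>F. I +> f i) = I +> (\<Oplus>i\<in>F. f i)"
proof -
  interpret Q: unital_algebra "quot_algebra A I" u by (rule quot_unital_algebra)
  show ?thesis using assms
  proof (induction F rule: finite_induct)
    case empty
    show ?case by (simp add: I.a_rcos_const)
  next
    case (insert i F)
    then show ?case
      by (simp add: Pi_def quot_add del: quot_algebra_sel(1,5))
  qed
qed

lemma quot_generates:
  assumes "generates A S"
  shows "generates (quot_algebra A I) ((\<lambda>s. I +> s) ` S)"
proof -
  have S: "S \<subseteq> carrier A" using assms by (simp add: generates_def)
  show ?thesis
    unfolding generates_def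
  proof (intro conjI allI impI)
    show "(\<lambda>s. I +> s) ` S \<subseteq> carrier (quot_algebra A I)"
      using S quot_closed by blast
  next
    fix B
    assume B: "B \<subseteq> carrier (quot_algebra A I)"
      and cl: "\<one>\<^bsub>quot_algebra A I\<^esub> \<in> B \<and> (\<forall>a\<in>B. \<forall>b\<in>B. a \<oplus>\<^bsub>quot_algebra A I\<^esub> b \<in> B) \<and>
      (\<forall>r. \<forall>a\<in>B. r \<odot>\<^bsub>quot_algebra A I\<^esub> a \<in> B) \<and>
      (\<forall>s\<in>(\<lambda>s. I +> s) ` S. \<forall>a\<in>B. s \<otimes>\<^bsub>quot_algebra A I\<^esub> a \<in> B)"
    have "I +> a \<in> B" if "a \<in> carrier A" for a
      using assms that
    proof (induction a rule: generates_induct)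
      case one
      show ?case using cl by simp
    next
      case (add a b)
      then have "(I +> a) \<oplus>\<^bsub>quot_algebra A I\<^esub> (I +> b) \<in> B" using cl by blast
      then show ?case using quot_add[of a b] add by auto
    next
      case (smult r a)
      then have "r \<odot>\<^bsub>quot_algebra A I\<^esub> (I +> a) \<in> B" using cl by blast
      then show ?case using quot_smult[of a r] smult by auto
    next
      case (mult s a)
      then have "(I +> s) \<otimes>\<^bsub>quot_algebra A I\<^esub> (I +> a) \<in> B" using cl by blast
      then show ?case using quot_mult[of s a] mult S by auto
    qed (rule unital_algebra_axioms)
    then show "carrier (quot_algebra A I) \<subseteq> B" using quot_surj by blast
  qed
qed

end
end

subsection \<open>Semidirect products\<close>

definition algebra_hom :: "('r, 'a) module \<Rightarrow> ('r, 'b) module \<Rightarrow> ('a \<Rightarrow> 'b) \<Rightarrow> bool"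
  where "algebra_hom A B f \<longleftrightarrow> f \<in> ring_hom A B \<and>
    (\<forall>r. \<forall>a\<in>carrier A. f (r \<odot>\<^bsub>A\<^esub> a) = r \<odot>\<^bsub>B\<^esub> f a)"

locale algebra_action = unital_algebra A u + G: group G
  for A :: "('r::comm_ring, 'a) module" (structure) and u
    and G :: "('g, 'm) monoid_scheme" +
  fixes act :: "'g \<Rightarrow> 'a \<Rightarrow> 'a"
  assumes act_hom: "g \<in> carrier G \<Longrightarrow> algebra_hom A A (act g)"
    and act_one: "a \<in> carrier A \<Longrightarrow> act \<one>\<^bsub>G\<^esub> a = a"
    and act_mult: "\<lbrakk>g \<in> carrier G; h \<in> carrier G; a \<in> carrier A\<rbrakk> \<Longrightarrow>
      act (g \<otimes>\<^bsub>G\<^esub> h) a = act g (act h a)"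
begin

lemma act_closed [simp]: "g \<in> carrier G \<Longrightarrow> a \<in> carrier A \<Longrightarrow> act g a \<in> carrier A"
  using act_hom by (auto simp: algebra_hom_def intro: ring_hom_closed)

lemma act_add: "\<lbrakk>g \<in> carrier G; a \<in> carrier A; b \<in> carrier A\<rbrakk> \<Longrightarrow> act g (a \<oplus> b) = act g a \<oplus> act g b"
  using act_hom by (auto simp: algebra_hom_def ring_hom_add)

lemma act_prod: "\<lbrakk>g \<in> carrier G; a \<in> carrier A; b \<in> carrier A\<rbrakk> \<Longrightarrow> act g (a \<otimes> b) = act g a \<otimes> act g b"
  using act_hom by (auto simp: algebra_hom_def ring_hom_mult)

lemma act_one_right [simp]: "g \<in> carrier G \<Longrightarrow> act g \<one> = \<one>"
  using act_hom by (auto simp: algebra_hom_def ring_hom_one)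

lemma act_smult: "\<lbrakk>g \<in> carrier G; a \<in> carrier A\<rbrakk> \<Longrightarrow> act g (r \<odot> a) = r \<odot> act g a"
  using act_hom by (auto simp: algebra_hom_def)

lemma act_zero [simp]: "g \<in> carrier G \<Longrightarrow> act g \<zero> = \<zero>"
  using act_smult[of g \<zero> 0] act_closed[of g \<zero>] by simp

lemma act_finsum:
  assumes "g \<in> carrier G" "finite F" "\<And>i. i \<in> F \<Longrightarrow> f i \<in> carrier A"
  shows "act g (\<Oplus>i\<in>F. f i) = (\<Oplus>i\<in>F. act g (f i))"
  using assms(2,3)
  by (induction F rule: finite_induct) (use assms(1) in \<open>auto simp: Pi_def act_add\<close>)

abbreviation "AG \<equiv> semidirect A G act"

lemma semidirect_sel [simp]:
  "carrier AG = carrier G \<rightarrow>\<^sub>E carrier A"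
  "g \<in> carrier G \<Longrightarrow> (F \<otimes>\<^bsub>AG\<^esub> F') g =
    (\<Oplus>h\<in>carrier G. F h \<otimes> act h (F' (inv\<^bsub>G\<^esub> h \<otimes>\<^bsub>G\<^esub> g)))"
  "g \<in> carrier G \<Longrightarrow> \<one>\<^bsub>AG\<^esub> g = (if g = \<one>\<^bsub>G\<^esub> then \<one> else \<zero>)"
  "g \<in> carrier G \<Longrightarrow> \<zero>\<^bsub>AG\<^esub> g = \<zero>"
  "g \<in> carrier G \<Longrightarrow> (F \<oplus>\<^bsub>AG\<^esub> F') g = F g \<oplus> F' g"
  "g \<in> carrier G \<Longrightarrow> (r \<odot>\<^bsub>AG\<^esub> F) g = r \<odot> F g"
  by (simp_all add: semidirect_def)

lemma semidirect_in_carrier: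
  "F \<in> carrier AG \<Longrightarrow> g \<in> carrier G \<Longrightarrow> F g \<in> carrier A"
  by auto

lemma semidirect_closed [intro]:
  "\<one>\<^bsub>AG\<^esub> \<in> carrier AG" "\<zero>\<^bsub>AG\<^esub> \<in> carrier AG"
  "\<lbrakk>F \<in> carrier AG; F' \<in> carrier AG\<rbrakk> \<Longrightarrow> F \<otimes>\<^bsub>AG\<^esub> F' \<in> carrier AG"
  "\<lbrakk>F \<in> carrier AG; F' \<in> carrier AG\<rbrakk> \<Longrightarrow> F \<oplus>\<^bsub>AG\<^esub> F' \<in> carrier AG"
  "F \<in> carrier AG \<Longrightarrow> r \<odot>\<^bsub>AG\<^esub> F \<in> carrier AG"
  by (auto simp: semidirect_def PiE_def Pi_def intro!: finsum_closed)

lemma semidirect_eqI: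
  "\<lbrakk>F \<in> carrier AG; F' \<in> carrier AG; \<And>g. g \<in> carrier G \<Longrightarrow> F g = F' g\<rbrakk> \<Longrightarrow> F = F'"
  by (simp add: PiE_ext)

end

locale finite_algebra_action = algebra_action +
  assumes finite_group: "finite (carrier G)"
begin

text \<open>Both sides are sums over the factorizations \<open>g = k l m\<close>; after exchanging
  the two sums, the substitution \<open>h = k l\<close> identifies them.\<close>

lemma semidirect_mult_assoc:
  assumes F: "F \<in> carrier AG" "F' \<in> carrier AG" "F'' \<in> carrier AG"
  shows "F \<otimes>\<^bsub>AG\<^esub> F' \<otimes>\<^bsub>AG\<^esub> F'' = F \<otimes>\<^bsub>AG\<^esub> (F' \<otimes>\<^bsub>AG\<^esub> F'')"
proof (rule semidirect_eqI)
  fix g assume g: "g \<in> carrier G"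
  note [simp] = semidirect_in_carrier[OF F(1)] semidirect_in_carrier[OF F(2)]
    semidirect_in_carrier[OF F(3)]
  let ?t = "\<lambda>k h. F k \<otimes> act k (F' (inv\<^bsub>G\<^esub> k \<otimes>\<^bsub>G\<^esub> h)) \<otimes> act h (F'' (inv\<^bsub>G\<^esub> h \<otimes>\<^bsub>G\<^esub> g))"
  have t: "?t k h \<in> carrier A" if "k \<in> carrier G" "h \<in> carrier G" for k h
    using that g by simp
  have "(F \<otimes>\<^bsub>AG\<^esub> F' \<otimes>\<^bsub>AG\<^esub> F'') g = (\<Oplus>h\<in>carrier G. \<Oplus>k\<in>carrier G. ?t k h)"
    using g finite_group by (auto simp: finsum_ldistr intro!: finsum_cong')
  also have "\<dots> = (\<Oplus>k\<in>carrier G. \<Oplus>h\<in>carrier G. ?t k h)"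
    using t by (intro finsum_swap finite_group) auto
  also have "\<dots> = (\<Oplus>k\<in>carrier G. F k \<otimes> act k ((F' \<otimes>\<^bsub>AG\<^esub> F'') (inv\<^bsub>G\<^esub> k \<otimes>\<^bsub>G\<^esub> g)))"
  proof (intro finsum_cong' refl)
    fix k assume k: "k \<in> carrier G"
    have "(\<Oplus>h\<in>carrier G. ?t k h) = (\<Oplus>h\<in>(\<lambda>l. k \<otimes>\<^bsub>G\<^esub> l) ` carrier G. ?t k h)"
      using k G.surj_const_mult by simp
    also have "\<dots> = (\<Oplus>l\<in>carrier G. ?t k (k \<otimes>\<^bsub>G\<^esub> l))"
      using k t by (intro finsum_reindex G.inj_on_multc) (auto simp: G.inj_on_cmult)
    also have "\<dots> = (\<Oplus>l\<in>carrier G. F k \<otimes> act k (F' l \<otimes> act l (F'' (inv\<^bsub>G\<^esub> l \<otimes>\<^bsub>G\<^esub> (inv\<^bsub>G\<^esub> k \<otimes>\<^bsub>G\<^esub> g)))))"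
    proof (intro finsum_cong' refl)
      fix l assume l: "l \<in> carrier G"
      have "inv\<^bsub>G\<^esub> k \<otimes>\<^bsub>G\<^esub> (k \<otimes>\<^bsub>G\<^esub> l) = l"
        using k l by (simp add: G.m_assoc[symmetric])
      then show "?t k (k \<otimes>\<^bsub>G\<^esub> l) =
          F k \<otimes> act k (F' l \<otimes> act l (F'' (inv\<^bsub>G\<^esub> l \<otimes>\<^bsub>G\<^esub> (inv\<^bsub>G\<^esub> k \<otimes>\<^bsub>G\<^esub> g))))"
        using k l g by (simp add: act_prod act_mult G.inv_mult_group m_assoc G.m_assoc)
    qed (use k g in simp)
    also have "\<dots> = F k \<otimes> act k ((F' \<otimes>\<^bsub>AG\<^esub> F'') (inv\<^bsub>G\<^esub> k \<otimes>\<^bsub>G\<^esub> g))"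
      using k g finite_group by (simp add: act_finsum finsum_rdistr Pi_def)
    finally show "(\<Oplus>h\<in>carrier G. ?t k h) =
      F k \<otimes> act k ((F' \<otimes>\<^bsub>AG\<^esub> F'') (inv\<^bsub>G\<^esub> k \<otimes>\<^bsub>G\<^esub> g))" .
  next
    show "(\<lambda>k. F k \<otimes> act k ((F' \<otimes>\<^bsub>AG\<^esub> F'') (inv\<^bsub>G\<^esub> k \<otimes>\<^bsub>G\<^esub> g))) \<in> carrier G \<rightarrow> carrier A"
      using g semidirect_in_carrier[OF semidirect_closed(3)[OF F(2,3)]] by (auto simp del: semidirect_sel)
  qed
  also have "\<dots> = (F \<otimes>\<^bsub>AG\<^esub> (F' \<otimes>\<^bsub>AG\<^esub> F'')) g"
    using g by simp
  finally show "(F \<otimes>\<^bsub>AG\<^esub> F' \<otimes>\<^bsub>AG\<^esub> F'') g = (F \<otimes>\<^bsub>AG\<^esub> (F' \<otimes>\<^bsub>AG\<^esub> F'')) g" .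
next
  show "F \<otimes>\<^bsub>AG\<^esub> F' \<otimes>\<^bsub>AG\<^esub> F'' \<in> carrier AG"
    by (rule semidirect_closed(3)[OF semidirect_closed(3)[OF F(1,2)] F(3)])
  show "F \<otimes>\<^bsub>AG\<^esub> (F' \<otimes>\<^bsub>AG\<^esub> F'') \<in> carrier AG"
    by (rule semidirect_closed(3)[OF F(1) semidirect_closed(3)[OF F(2,3)]])
qed

end

section \<open>Algebra structure and generators of the semidirect product\<close>

context finite_algebra_action
begin

lemma semidirect_ring: "ring AG"
proof (intro ringI abelian_groupI monoidI)
  note [simp del] = semidirect_sel(1)
  show "\<zero>\<^bsub>AG\<^esub> \<in> carrier AG" "\<one>\<^bsub>AG\<^esub> \<in> carrier AG" by (rule semidirect_closed)+
  fix F F' F'' assume F: "F \<in> carrier AG"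
  note [simp] = semidirect_in_carrier[OF F]
  show "\<exists>F'\<in>carrier AG. F' \<oplus>\<^bsub>AG\<^esub> F = \<zero>\<^bsub>AG\<^esub>"
  proof
    show c: "(\<lambda>g\<in>carrier G. \<ominus> F g) \<in> carrier AG"
      by (simp add: semidirect_sel(1))
    show "(\<lambda>g\<in>carrier G. \<ominus> F g) \<oplus>\<^bsub>AG\<^esub> F = \<zero>\<^bsub>AG\<^esub>"
      by (rule semidirect_eqI[OF semidirect_closed(4)[OF c F] semidirect_closed(2)]) (simp add: l_neg)
  qed
  show "\<zero>\<^bsub>AG\<^esub> \<oplus>\<^bsub>AG\<^esub> F = F"
    by (rule semidirect_eqI[OF semidirect_closed(4)[OF semidirect_closed(2) F] F]) simp
  show "\<one>\<^bsub>AG\<^esub> \<otimes>\<^bsub>AG\<^esub> F = F"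
  proof (rule semidirect_eqI[OF semidirect_closed(3)[OF semidirect_closed(1) F] F])
    fix g assume g: "g \<in> carrier G"
    have "(\<one>\<^bsub>AG\<^esub> \<otimes>\<^bsub>AG\<^esub> F) g = (\<Oplus>h\<in>carrier G. if \<one>\<^bsub>G\<^esub> = h then F g else \<zero>)"
      unfolding semidirect_sel(2)[OF g]
      by (rule finsum_cong') (use g in \<open>auto simp: act_one\<close>)
    also have "\<dots> = F g"
      using g by (intro finsum_singleton) (auto simp: finite_group)
    finally show "(\<one>\<^bsub>AG\<^esub> \<otimes>\<^bsub>AG\<^esub> F) g = F g" .
  qed
  show "F \<otimes>\<^bsub>AG\<^esub> \<one>\<^bsub>AG\<^esub> = F"
  proof (rule semidirect_eqI[OF semidirect_closed(3)[OF F semidirect_closed(1)] F])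
    fix g assume g: "g \<in> carrier G"
    have "inv\<^bsub>G\<^esub> h \<otimes>\<^bsub>G\<^esub> g = \<one>\<^bsub>G\<^esub> \<longleftrightarrow> g = h" if "h \<in> carrier G" for h
      using G.inv_solve_left'[of "\<one>\<^bsub>G\<^esub>" h g] g that by simp
    then have "(F \<otimes>\<^bsub>AG\<^esub> \<one>\<^bsub>AG\<^esub>) g = (\<Oplus>h\<in>carrier G. if g = h then F h else \<zero>)"
      unfolding semidirect_sel(2)[OF g]
      by (intro finsum_cong') (use g in \<open>auto simp: act_one\<close>)
    also have "\<dots> = F g"
      using g by (intro finsum_singleton) (auto simp: finite_group)
    finally show "(F \<otimes>\<^bsub>AG\<^esub> \<one>\<^bsub>AG\<^esub>) g = F g" .
  qed
  assume F': "F' \<in> carrier AG"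
  note [simp] = semidirect_in_carrier[OF F']
  show "F \<oplus>\<^bsub>AG\<^esub> F' \<in> carrier AG" "F \<otimes>\<^bsub>AG\<^esub> F' \<in> carrier AG"
    by (rule semidirect_closed(3,4)[OF F F'])+
  show "F \<oplus>\<^bsub>AG\<^esub> F' = F' \<oplus>\<^bsub>AG\<^esub> F"
    by (rule semidirect_eqI[OF semidirect_closed(4)[OF F F'] semidirect_closed(4)[OF F' F]])
      (simp add: a_comm)
  assume F'': "F'' \<in> carrier AG"
  note [simp] = semidirect_in_carrier[OF F'']
  show "F \<oplus>\<^bsub>AG\<^esub> F' \<oplus>\<^bsub>AG\<^esub> F'' = F \<oplus>\<^bsub>AG\<^esub> (F' \<oplus>\<^bsub>AG\<^esub> F'')"
    by (rule semidirect_eqI[OF semidirect_closed(4)[OF semidirect_closed(4)[OF F F'] F'']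
      semidirect_closed(4)[OF F semidirect_closed(4)[OF F' F'']]]) (simp add: a_assoc)
  show "F \<otimes>\<^bsub>AG\<^esub> F' \<otimes>\<^bsub>AG\<^esub> F'' = F \<otimes>\<^bsub>AG\<^esub> (F' \<otimes>\<^bsub>AG\<^esub> F'')"
    by (rule semidirect_mult_assoc[OF F F' F''])
  show "(F \<oplus>\<^bsub>AG\<^esub> F') \<otimes>\<^bsub>AG\<^esub> F'' = F \<otimes>\<^bsub>AG\<^esub> F'' \<oplus>\<^bsub>AG\<^esub> F' \<otimes>\<^bsub>AG\<^esub> F''"
    by (rule semidirect_eqI[OF semidirect_closed(3)[OF semidirect_closed(4)[OF F F'] F'']
      semidirect_closed(4)[OF semidirect_closed(3)[OF F F''] semidirect_closed(3)[OF F' F'']]])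
      (simp add: l_distr finsum_addf cong: finsum_cong)
  show "F'' \<otimes>\<^bsub>AG\<^esub> (F \<oplus>\<^bsub>AG\<^esub> F') = F'' \<otimes>\<^bsub>AG\<^esub> F \<oplus>\<^bsub>AG\<^esub> F'' \<otimes>\<^bsub>AG\<^esub> F'"
    by (rule semidirect_eqI[OF semidirect_closed(3)[OF F'' semidirect_closed(4)[OF F F']]
      semidirect_closed(4)[OF semidirect_closed(3)[OF F'' F] semidirect_closed(3)[OF F'' F']]])
      (simp add: r_distr act_add finsum_addf cong: finsum_cong)
qed

lemma semidirect_unital_algebra: "unital_algebra AG u"
proof (intro unital_algebra.intro unital_algebra_axioms.intro semidirect_ring)
  note [simp del] = semidirect_sel(1)
  fix F F' r s assume F: "F \<in> carrier AG"
  note [simp] = semidirect_in_carrier[OF F]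
  note c = semidirect_closed(3-5)
  show "r \<odot>\<^bsub>AG\<^esub> F \<in> carrier AG" by (rule c(3)[OF F])
  show "(r + s) \<odot>\<^bsub>AG\<^esub> F = r \<odot>\<^bsub>AG\<^esub> F \<oplus>\<^bsub>AG\<^esub> s \<odot>\<^bsub>AG\<^esub> F"
    by (rule semidirect_eqI[OF c(3)[OF F] c(2)[OF c(3)[OF F] c(3)[OF F]]]) (simp add: smult_add_left)
  show "(r * s) \<odot>\<^bsub>AG\<^esub> F = r \<odot>\<^bsub>AG\<^esub> (s \<odot>\<^bsub>AG\<^esub> F)"
    by (rule semidirect_eqI[OF c(3)[OF F] c(3)[OF c(3)[OF F]]]) (simp add: smult_smult)
  show "u \<odot>\<^bsub>AG\<^esub> F = F"
    by (rule semidirect_eqI[OF c(3)[OF F] F]) (simp add: smult_unit)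
  assume F': "F' \<in> carrier AG"
  note [simp] = semidirect_in_carrier[OF F']
  show "r \<odot>\<^bsub>AG\<^esub> (F \<oplus>\<^bsub>AG\<^esub> F') = r \<odot>\<^bsub>AG\<^esub> F \<oplus>\<^bsub>AG\<^esub> r \<odot>\<^bsub>AG\<^esub> F'"
    by (rule semidirect_eqI[OF c(3)[OF c(2)[OF F F']] c(2)[OF c(3)[OF F] c(3)[OF F']]])
      (simp add: smult_add_right)
  show "r \<odot>\<^bsub>AG\<^esub> F \<otimes>\<^bsub>AG\<^esub> F' = r \<odot>\<^bsub>AG\<^esub> (F \<otimes>\<^bsub>AG\<^esub> F')"
    by (rule semidirect_eqI[OF c(1)[OF c(3)[OF F] F'] c(3)[OF c(1)[OF F F']]])
      (simp add: smult_mult_left smult_finsum finite_group cong: finsum_cong)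
  show "F \<otimes>\<^bsub>AG\<^esub> (r \<odot>\<^bsub>AG\<^esub> F') = r \<odot>\<^bsub>AG\<^esub> (F \<otimes>\<^bsub>AG\<^esub> F')"
    by (rule semidirect_eqI[OF c(1)[OF F c(3)[OF F']] c(3)[OF c(1)[OF F F']]])
      (simp add: smult_mult_right act_smult smult_finsum finite_group cong: finsum_cong)
qed

sublocale AG: unital_algebra AG u by (rule semidirect_unital_algebra)

abbreviation "el \<equiv> semidirect_elem A G"

lemma el_apply [simp]: "h \<in> carrier G \<Longrightarrow> el a g h = (if h = g then a else \<zero>)"
  by (simp add: semidirect_elem_def)

lemma el_closed: "a \<in> carrier A \<Longrightarrow> el a g \<in> carrier AG"
  by (auto simp: semidirect_elem_def)

lemma el_add:
  assumes "a \<in> carrier A" "b \<in> carrier A"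
  shows "el a g \<oplus>\<^bsub>AG\<^esub> el b g = el (a \<oplus> b) g"
  by (rule semidirect_eqI[OF semidirect_closed(4)[OF el_closed el_closed] el_closed])
    (use assms in auto)

lemma el_smult:
  assumes "a \<in> carrier A"
  shows "r \<odot>\<^bsub>AG\<^esub> el a g = el (r \<odot> a) g"
  by (rule semidirect_eqI[OF semidirect_closed(5)[OF el_closed] el_closed])
    (use assms in auto)

lemma one_eq_el: "\<one>\<^bsub>AG\<^esub> = el \<one> \<one>\<^bsub>G\<^esub>"
  by (rule semidirect_eqI[OF semidirect_closed(1) el_closed]) auto

lemma el_mult:
  assumes a: "a \<in> carrier A" and b: "b \<in> carrier A" and g: "g \<in> carrier G" "h \<in> carrier G"
  shows "el a g \<otimes>\<^bsub>AG\<^esub> el b h = el (a \<otimes> act g b) (g \<otimes>\<^bsub>G\<^esub> h)"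
proof (rule semidirect_eqI[OF semidirect_closed(3)[OF el_closed[OF a] el_closed[OF b]] el_closed])
  show "a \<otimes> act g b \<in> carrier A" using a b g by simp
  fix k assume k: "k \<in> carrier G"
  have "(el a g \<otimes>\<^bsub>AG\<^esub> el b h) k = (\<Oplus>l\<in>carrier G. if g = l then a \<otimes> act g (el b h (inv\<^bsub>G\<^esub> g \<otimes>\<^bsub>G\<^esub> k)) else \<zero>)"
    unfolding semidirect_sel(2)[OF k]
    by (rule finsum_cong') (use a b g k in auto)
  also have "\<dots> = a \<otimes> act g (el b h (inv\<^bsub>G\<^esub> g \<otimes>\<^bsub>G\<^esub> k))"
    by (rule finsum_singleton[OF g(1) finite_group]) (use a b g k in auto)
  also have "inv\<^bsub>G\<^esub> g \<otimes>\<^bsub>G\<^esub> k = h \<longleftrightarrow> k = g \<otimes>\<^bsub>G\<^esub> h"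
    using G.inv_solve_left'[of h g k] g k by simp
  then have "a \<otimes> act g (el b h (inv\<^bsub>G\<^esub> g \<otimes>\<^bsub>G\<^esub> k)) = el (a \<otimes> act g b) (g \<otimes>\<^bsub>G\<^esub> h) k"
    using a b g k by simp
  finally show "(el a g \<otimes>\<^bsub>AG\<^esub> el b h) k = el (a \<otimes> act g b) (g \<otimes>\<^bsub>G\<^esub> h) k" .
qed

lemma finsum_apply:
  assumes "finite J" "\<And>j. j \<in> J \<Longrightarrow> F j \<in> carrier AG" "g \<in> carrier G"
  shows "(\<Oplus>\<^bsub>AG\<^esub>j\<in>J. F j) g = (\<Oplus>j\<in>J. F j g)"
  using assms(1,2)
proof (induction J rule: finite_induct)
  case (insert j J)
  have "(\<lambda>j. F j g) \<in> insert j J \<rightarrow> carrier A"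
    using insert.prems semidirect_in_carrier assms(3) by blast
  then show ?case using insert assms(3) by (simp add: Pi_def del: semidirect_sel(1))
qed (use assms(3) in simp)

lemma el_decomp:
  assumes F: "F \<in> carrier AG"
  shows "F = (\<Oplus>\<^bsub>AG\<^esub>g\<in>carrier G. el (F g) g)"
proof (rule semidirect_eqI[OF F])
  have e: "el (F g) g \<in> carrier AG" if "g \<in> carrier G" for g
    by (rule el_closed[OF semidirect_in_carrier[OF F that]])
  then show "(\<Oplus>\<^bsub>AG\<^esub>g\<in>carrier G. el (F g) g) \<in> carrier AG"
    by (intro AG.finsum_closed) blast
  fix h assume h: "h \<in> carrier G"
  have "(\<Oplus>\<^bsub>AG\<^esub>g\<in>carrier G. el (F g) g) h = (\<Oplus>g\<in>carrier G. el (F g) g h)"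
    by (rule finsum_apply[OF finite_group e h])
  also have "\<dots> = (\<Oplus>g\<in>carrier G. if h = g then F g else \<zero>)"
    by (rule finsum_cong') (use h semidirect_in_carrier[OF F] in auto)
  also have "\<dots> = F h"
    by (rule finsum_singleton[OF h finite_group]) (use semidirect_in_carrier[OF F] in auto)
  finally show "F h = (\<Oplus>\<^bsub>AG\<^esub>g\<in>carrier G. el (F g) g) h" by simp
qed

text \<open>The element \<open>a g\<close> arises from \<open>\<one> g\<close> by multiplying with
  generators of \<open>A\<close> on the left, and \<open>el_decomp\<close> writes everything as a
  finite sum of such elements.\<close>

lemma semidirect_generates:
  assumes S: "generates A S"
  shows "generates AG ((\<lambda>s. el s \<one>\<^bsub>G\<^esub>) ` S \<union> el \<one> ` carrier G)"
  unfolding generates_def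
proof (intro conjI allI impI)
  have Sc: "S \<subseteq> carrier A" using S by (simp add: generates_def)
  then show "(\<lambda>s. el s \<one>\<^bsub>G\<^esub>) ` S \<union> el \<one> ` carrier G \<subseteq> carrier AG"
    using el_closed by blast
  fix B
  assume "B \<subseteq> carrier AG"
  assume cl: "\<one>\<^bsub>AG\<^esub> \<in> B \<and> (\<forall>a\<in>B. \<forall>b\<in>B. a \<oplus>\<^bsub>AG\<^esub> b \<in> B) \<and>
     (\<forall>r. \<forall>a\<in>B. r \<odot>\<^bsub>AG\<^esub> a \<in> B) \<and>
     (\<forall>s\<in>(\<lambda>s. el s \<one>\<^bsub>G\<^esub>) ` S \<union> el \<one> ` carrier G. \<forall>a\<in>B. s \<otimes>\<^bsub>AG\<^esub> a \<in> B)"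
  have el: "el a g \<in> B" if "a \<in> carrier A" "g \<in> carrier G" for a g
    using S that(1)
  proof (induction a rule: generates_induct)
    case one
    have "el \<one> g \<otimes>\<^bsub>AG\<^esub> el \<one> \<one>\<^bsub>G\<^esub> \<in> B" using cl that(2) one_eq_el by auto
    then show ?case using el_mult[of \<one> \<one> g "\<one>\<^bsub>G\<^esub>"] that(2) by simp
  next
    case (add a b)
    then have "el a g \<oplus>\<^bsub>AG\<^esub> el b g \<in> B" using cl by blast
    then show ?case using el_add add by simp
  next
    case (smult r a)
    then have "r \<odot>\<^bsub>AG\<^esub> el a g \<in> B" using cl by blast
    then show ?case using el_smult smult by simp
  next
    case (mult s a)
    then have "el s \<one>\<^bsub>G\<^esub> \<otimes>\<^bsub>AG\<^esub> el a g \<in> B" using cl by blast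
    moreover have "s \<in> carrier A" using mult Sc by blast
    ultimately show ?case using el_mult[of s a "\<one>\<^bsub>G\<^esub>" g] mult that(2) by (simp add: act_one)
  qed (rule unital_algebra_axioms)
  have z: "\<zero>\<^bsub>AG\<^esub> \<in> B" unfolding AG.zero_smult[OF AG.one_closed, symmetric] using cl by blast
  have "(\<Oplus>\<^bsub>AG\<^esub>g\<in>J. el (F g) g) \<in> B" if "F \<in> carrier AG" "finite J" "J \<subseteq> carrier G" for F J
    using that(2,3)
  proof (induction J rule: finite_induct)
    case (insert g J)
    have *: "el (F h) h \<in> B" "el (F h) h \<in> carrier AG" if "h \<in> insert g J" for h
      using el[of "F h" h] el_closed[of "F h" h] semidirect_in_carrier[OF \<open>F \<in> carrier AG\<close>, of h]
        insert.prems that by blast+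
    show ?case using insert * cl by (simp add: Pi_def del: semidirect_sel)
  qed (use z in simp)
  from this[OF _ finite_group subset_refl] show "carrier AG \<subseteq> B"
    using el_decomp by fastforce
qed

end

subsection \<open>Representations\<close>

text \<open>A representation is not required to preserve the unit.\<close>

locale scalar_action =
  fixes sc :: "'r::comm_ring \<Rightarrow> 'm::ab_group_add \<Rightarrow> 'm" and u :: 'r
  assumes sc_add_right: "sc r (m + m') = sc r m + sc r m'"
    and sc_add_left: "sc (r + s) m = sc r m + sc s m"
    and sc_sc: "sc (r * s) m = sc r (sc s m)"
    and sc_unit: "sc u m = m"
begin

lemma sc_zero_left [simp]: "sc 0 m = 0"
  using sc_add_left[of 0 0 m] by simp

lemma sc_zero_right [simp]: "sc r 0 = 0"
  using sc_add_right[of r 0 0] by simp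

lemma sc_sum: "sc r (sum f F) = (\<Sum>i\<in>F. sc r (f i))"
  by (induction F rule: infinite_finite_induct) (auto simp: sc_add_right)

definition linear_op :: "('m \<Rightarrow> 'm) \<Rightarrow> bool"
  where "linear_op f \<longleftrightarrow> (\<forall>m m'. f (m + m') = f m + f m') \<and> (\<forall>r m. f (sc r m) = sc r (f m))"

lemma linear_op_zero: "linear_op f \<Longrightarrow> f 0 = 0"
  unfolding linear_op_def by (metis sc_zero_left)

lemma linear_op_sum: "linear_op f \<Longrightarrow> f (sum h F) = (\<Sum>i\<in>F. f (h i))"
  by (induction F rule: infinite_finite_induct) (auto simp: linear_op_zero linear_op_def)

lemma linear_op_comp: "linear_op f \<Longrightarrow> linear_op f' \<Longrightarrow> linear_op (f \<circ> f')"
  by (simp add: linear_op_def)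

definition is_representation :: "('r, 'a) module \<Rightarrow> ('a \<Rightarrow> 'm \<Rightarrow> 'm) \<Rightarrow> bool"
  where "is_representation A \<psi> \<longleftrightarrow>
    (\<forall>a\<in>carrier A. linear_op (\<psi> a)) \<and>
    (\<forall>a\<in>carrier A. \<forall>b\<in>carrier A. \<forall>m. \<psi> (a \<oplus>\<^bsub>A\<^esub> b) m = \<psi> a m + \<psi> b m) \<and>
    (\<forall>a\<in>carrier A. \<forall>r m. \<psi> (r \<odot>\<^bsub>A\<^esub> a) m = sc r (\<psi> a m)) \<and>
    (\<forall>a\<in>carrier A. \<forall>b\<in>carrier A. \<forall>m. \<psi> (a \<otimes>\<^bsub>A\<^esub> b) m = \<psi> a (\<psi> b m))"

end

locale algebra_representation = scalar_action sc u + unital_algebra A u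
  for sc :: "'r::comm_ring \<Rightarrow> 'm::ab_group_add \<Rightarrow> 'm" and u
    and A :: "('r, 'a) module" (structure) +
  fixes \<psi> :: "'a \<Rightarrow> 'm \<Rightarrow> 'm"
  assumes is_representation: "is_representation A \<psi>"
begin

lemma rep_linear: "a \<in> carrier A \<Longrightarrow> linear_op (\<psi> a)"
  and rep_add: "\<lbrakk>a \<in> carrier A; b \<in> carrier A\<rbrakk> \<Longrightarrow> \<psi> (a \<oplus> b) m = \<psi> a m + \<psi> b m"
  and rep_smult: "a \<in> carrier A \<Longrightarrow> \<psi> (r \<odot> a) m = sc r (\<psi> a m)"
  and rep_mult: "\<lbrakk>a \<in> carrier A; b \<in> carrier A\<rbrakk> \<Longrightarrow> \<psi> (a \<otimes> b) m = \<psi> a (\<psi> b m)"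
  using is_representation by (auto simp: is_representation_def)

lemma rep_zero: "\<psi> \<zero> m = 0"
  using rep_add[of \<zero> \<zero> m] by simp

lemma rep_arg_zero: "a \<in> carrier A \<Longrightarrow> \<psi> a 0 = 0"
  using linear_op_zero rep_linear by blast

lemma rep_uminus: "a \<in> carrier A \<Longrightarrow> \<psi> (\<ominus> a) m = - \<psi> a m"
  using rep_add[of "\<ominus> a" a m] by (simp add: l_neg rep_zero eq_neg_iff_add_eq_0)

lemma rep_minus: "\<lbrakk>a \<in> carrier A; b \<in> carrier A\<rbrakk> \<Longrightarrow> \<psi> (a \<ominus> b) m = \<psi> a m - \<psi> b m"
  by (simp add: minus_eq rep_add rep_uminus)

lemma rep_finsum:
  "finite F \<Longrightarrow> (\<And>i. i \<in> F \<Longrightarrow> f i \<in> carrier A) \<Longrightarrow> \<psi> (\<Oplus>i\<in>F. f i) m = (\<Sum>i\<in>F. \<psi> (f i) m)"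
  by (induction F rule: finite_induct) (auto simp: rep_zero rep_add Pi_def)

lemma kernel_ideal: "ideal {a \<in> carrier A. \<forall>m. \<psi> a m = 0} A"
proof (rule idealI)
  show "ring A" by (rule ring_axioms)
  show "subgroup {a \<in> carrier A. \<forall>m. \<psi> a m = 0} (add_monoid A)"
    by unfold_locales (auto simp: rep_add rep_zero rep_uminus simp flip: a_inv_def)
qed (auto simp: rep_mult rep_arg_zero)

text \<open>The kernel of a representation is an ideal, so it suffices to check that the defining
  relations act by zero.\<close>

lemma genideal_kernel:
  assumes "X \<subseteq> carrier A" "\<And>a m. a \<in> X \<Longrightarrow> \<psi> a m = 0" "a \<in> Idl X"
  shows "\<psi> a m = 0"
  using genideal_minimal[OF kernel_ideal, of X] assms by blast

text \<open>A coset acts as a chosen representative does; two representatives differ by an element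
  that acts as zero.\<close>

lemma quot_representation:
  assumes I: "ideal I A" and ker: "\<And>a m. a \<in> I \<Longrightarrow> \<psi> a m = 0"
  obtains \<psi>' where "is_representation (quot_algebra A I) \<psi>'"
    and "\<And>a. a \<in> carrier A \<Longrightarrow> \<psi>' (I +> a) = \<psi> a"
proof -
  define \<psi>' where "\<psi>' X = \<psi> (SOME a. a \<in> carrier A \<and> X = I +> a)" for X
  have *: "\<psi>' (I +> a) = \<psi> a" if a: "a \<in> carrier A" for a
  proof -
    let ?b = "SOME b. b \<in> carrier A \<and> I +> a = I +> b"
    have b: "?b \<in> carrier A \<and> I +> a = I +> ?b" by (rule someI_ex) (use a in blast)
    then have "a \<ominus> ?b \<in> I" using quot_eq_iff[OF I, of a ?b] a by simp
    then have "\<psi> a m = \<psi> ?b m" for m using ker rep_minus[of a ?b m] a b by simp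
    then show ?thesis by (auto simp: \<psi>'_def)
  qed
  have "is_representation (quot_algebra A I) \<psi>'"
    unfolding is_representation_def
  proof (intro conjI ballI allI)
    fix X r m assume X: "X \<in> carrier (quot_algebra A I)"
    obtain a where a: "a \<in> carrier A" "X = I +> a" using quot_surj[OF I X] by blast
    show "linear_op (\<psi>' X)" unfolding a(2) *[OF a(1)] by (rule rep_linear[OF a(1)])
    show "\<psi>' (r \<odot>\<^bsub>quot_algebra A I\<^esub> X) m = sc r (\<psi>' X m)"
      unfolding a(2) quot_smult[OF I a(1)] by (simp only: * a(1) smult_closed rep_smult)
    fix Y assume Y: "Y \<in> carrier (quot_algebra A I)"
    obtain b where b: "b \<in> carrier A" "Y = I +> b" using quot_surj[OF I Y] by blast
    show "\<psi>' (X \<oplus>\<^bsub>quot_algebra A I\<^esub> Y) m = \<psi>' X m + \<psi>' Y m"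
      unfolding a(2) b(2) quot_add[OF I a(1) b(1)] by (simp only: * a(1) b(1) a_closed rep_add)
    show "\<psi>' (X \<otimes>\<^bsub>quot_algebra A I\<^esub> Y) m = \<psi>' X (\<psi>' Y m)"
      unfolding a(2) b(2) quot_mult[OF I a(1) b(1)] by (simp only: * a(1) b(1) m_closed rep_mult)
  qed
  then show ?thesis using that * by blast
qed

end

text \<open>A covariant pair: \<open>gamma_rep\<close> is the rule \<open>g a = (act g a) g\<close>
  read on operators. The operator \<open>\<gamma> \<one>\<close> is an idempotent, not necessarily
  the identity.\<close>

locale semidirect_representation =
  algebra_representation sc u A \<psi> + finite_algebra_action A u G act
  for sc :: "'r::comm_ring \<Rightarrow> 'm::ab_group_add \<Rightarrow> 'm" and u
    and A :: "('r, 'a) module" (structure) and \<psi>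
    and G :: "('g, 'l) monoid_scheme" and act +
  fixes \<gamma> :: "'g \<Rightarrow> 'm \<Rightarrow> 'm"
  assumes gamma_linear: "g \<in> carrier G \<Longrightarrow> linear_op (\<gamma> g)"
    and gamma_mult: "\<lbrakk>g \<in> carrier G; h \<in> carrier G\<rbrakk> \<Longrightarrow> \<gamma> (g \<otimes>\<^bsub>G\<^esub> h) m = \<gamma> g (\<gamma> h m)"
    and gamma_rep: "\<lbrakk>g \<in> carrier G; a \<in> carrier A\<rbrakk> \<Longrightarrow> \<gamma> g (\<psi> a m) = \<psi> (act g a) (\<gamma> g m)"
begin

definition semidirect_rep :: "('g \<Rightarrow> 'a) \<Rightarrow> 'm \<Rightarrow> 'm"
  where "semidirect_rep F m = (\<Sum>g\<in>carrier G. \<psi> (F g) (\<gamma> g m))"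

lemma semidirect_rep_el:
  assumes "a \<in> carrier A" "g \<in> carrier G"
  shows "semidirect_rep (el a g) m = \<psi> a (\<gamma> g m)"
proof -
  have "semidirect_rep (el a g) m = (\<Sum>h\<in>carrier G. if h = g then \<psi> a (\<gamma> g m) else 0)"
    unfolding semidirect_rep_def by (rule sum.cong) (auto simp: rep_zero)
  then show ?thesis using assms finite_group by simp
qed

text \<open>The point is multiplicativity: substitute \<open>g = h k\<close> in the double sum and
  pull \<open>\<gamma> h\<close> out to the left by \<open>gamma_rep\<close>.\<close>

lemma semidirect_rep_representation: "is_representation AG semidirect_rep"
  unfolding is_representation_def
proof (intro conjI ballI allI)
  note [simp del] = semidirect_sel(1)
  fix F r m assume F: "F \<in> carrier AG"
  note [simp] = semidirect_in_carrier[OF F]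
  have lin: "linear_op (\<psi> (F g) \<circ> \<gamma> g)" if "g \<in> carrier G" for g
    using that by (intro linear_op_comp rep_linear gamma_linear) auto
  then show "linear_op (semidirect_rep F)"
    unfolding linear_op_def semidirect_rep_def by (auto simp: sum.distrib sc_sum)
  show "semidirect_rep (r \<odot>\<^bsub>AG\<^esub> F) m = sc r (semidirect_rep F m)"
    by (simp add: semidirect_rep_def rep_smult sc_sum)
  fix F' assume F': "F' \<in> carrier AG"
  note [simp] = semidirect_in_carrier[OF F']
  show "semidirect_rep (F \<oplus>\<^bsub>AG\<^esub> F') m = semidirect_rep F m + semidirect_rep F' m"
    by (simp add: semidirect_rep_def rep_add sum.distrib)
  let ?t = "\<lambda>h g. \<psi> (F h) (\<psi> (act h (F' (inv\<^bsub>G\<^esub> h \<otimes>\<^bsub>G\<^esub> g))) (\<gamma> g m))"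
  have "semidirect_rep (F \<otimes>\<^bsub>AG\<^esub> F') m = (\<Sum>g\<in>carrier G. \<Sum>h\<in>carrier G. ?t h g)"
    by (simp add: semidirect_rep_def rep_finsum finite_group rep_mult)
  also have "\<dots> = (\<Sum>h\<in>carrier G. \<Sum>g\<in>carrier G. ?t h g)"
    by (rule sum.swap)
  also have "\<dots> = (\<Sum>h\<in>carrier G. \<psi> (F h) (\<gamma> h (semidirect_rep F' m)))"
  proof (rule sum.cong[OF refl])
    fix h assume h: "h \<in> carrier G"
    have bij: "bij_betw (\<lambda>k. h \<otimes>\<^bsub>G\<^esub> k) (carrier G) (carrier G)"
      using h G.surj_const_mult G.inj_on_cmult by (simp add: bij_betw_def)
    have "(\<Sum>g\<in>carrier G. ?t h g) = (\<Sum>k\<in>carrier G. ?t h (h \<otimes>\<^bsub>G\<^esub> k))"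
      by (rule sum.reindex_bij_betw[OF bij, symmetric])
    also have "\<dots> = (\<Sum>k\<in>carrier G. (\<psi> (F h) \<circ> \<gamma> h) (\<psi> (F' k) (\<gamma> k m)))"
    proof (rule sum.cong[OF refl])
      fix k assume k: "k \<in> carrier G"
      have "inv\<^bsub>G\<^esub> h \<otimes>\<^bsub>G\<^esub> (h \<otimes>\<^bsub>G\<^esub> k) = k"
        using h k by (simp add: G.m_assoc[symmetric])
      then show "?t h (h \<otimes>\<^bsub>G\<^esub> k) = (\<psi> (F h) \<circ> \<gamma> h) (\<psi> (F' k) (\<gamma> k m))"
        using h k by (simp add: gamma_mult gamma_rep)
    qed
    also have "\<dots> = (\<psi> (F h) \<circ> \<gamma> h) (semidirect_rep F' m)"
      unfolding semidirect_rep_def by (rule linear_op_sum[OF lin[OF h], symmetric])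
    finally show "(\<Sum>g\<in>carrier G. ?t h g) = \<psi> (F h) (\<gamma> h (semidirect_rep F' m))" by simp
  qed
  also have "\<dots> = semidirect_rep F (semidirect_rep F' m)"
    by (simp add: semidirect_rep_def)
  finally show "semidirect_rep (F \<otimes>\<^bsub>AG\<^esub> F') m = semidirect_rep F (semidirect_rep F' m)" .
qed

end

subsection \<open>Free algebras\<close>

lemma free_algebra_sel [simp]:
  "f \<in> carrier (free_algebra \<phi> W) \<longleftrightarrow> finite {u. f u \<noteq> 0} \<and> {u. f u \<noteq> 0} \<subseteq> lists W"
  "\<one>\<^bsub>free_algebra \<phi> W\<^esub> u = (if u = [] then \<phi> 1 else 0)"
  "\<zero>\<^bsub>free_algebra \<phi> W\<^esub> u = 0"
  "(f \<oplus>\<^bsub>free_algebra \<phi> W\<^esub> f') u = f u + f' u"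
  "(r \<odot>\<^bsub>free_algebra \<phi> W\<^esub> f) u = r * f u"
  by (simp_all add: free_algebra_def)

lemma free_mult_apply:
  "(f \<otimes>\<^bsub>free_algebra \<phi> W\<^esub> f') u = (\<Sum>i\<le>length u. f (take i u) * f' (drop i u))"
  by (simp add: free_algebra_def)

lemma free_mult_Nil: "(f \<otimes>\<^bsub>free_algebra \<phi> W\<^esub> f') [] = f [] * f' []"
  by (simp add: free_mult_apply)

text \<open>Splitting off the first letter: either the left factor takes the empty word, or it takes
  \<open>w\<close> and is replaced by its left quotient by \<open>w\<close>. This recursion stands
  in for computations with split points of words.\<close>

lemma free_mult_Cons:
  "(f \<otimes>\<^bsub>free_algebra \<phi> W\<^esub> f') (w # u) =
    f [] * f' (w # u) + ((\<lambda>v. f (w # v)) \<otimes>\<^bsub>free_algebra \<phi> W\<^esub> f') u"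
  by (simp add: free_mult_apply sum.atMost_Suc_shift del: sum.atMost_Suc)

lemma free_mult_zero_left: "((\<lambda>v. 0) \<otimes>\<^bsub>free_algebra \<phi> W\<^esub> f) u = 0"
  by (simp add: free_mult_apply)

lemma free_mult_add_left:
  "((\<lambda>v. f v + f' v) \<otimes>\<^bsub>free_algebra \<phi> W\<^esub> f'') u =
    (f \<otimes>\<^bsub>free_algebra \<phi> W\<^esub> f'') u + (f' \<otimes>\<^bsub>free_algebra \<phi> W\<^esub> f'') u"
  by (simp add: free_mult_apply sum.distrib distrib_right)

lemma free_mult_smult_left:
  "((\<lambda>v. r * f v) \<otimes>\<^bsub>free_algebra \<phi> W\<^esub> f') u = r * (f \<otimes>\<^bsub>free_algebra \<phi> W\<^esub> f') u"
  by (simp add: free_mult_apply sum_distrib_left mult.assoc)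

lemma free_mult_distrib:
  "((f \<oplus>\<^bsub>free_algebra \<phi> W\<^esub> f') \<otimes>\<^bsub>free_algebra \<phi> W\<^esub> f'') u =
    (f \<otimes>\<^bsub>free_algebra \<phi> W\<^esub> f'') u + (f' \<otimes>\<^bsub>free_algebra \<phi> W\<^esub> f'') u"
  "(f \<otimes>\<^bsub>free_algebra \<phi> W\<^esub> (f' \<oplus>\<^bsub>free_algebra \<phi> W\<^esub> f'')) u =
    (f \<otimes>\<^bsub>free_algebra \<phi> W\<^esub> f') u + (f \<otimes>\<^bsub>free_algebra \<phi> W\<^esub> f'') u"
  "((r \<odot>\<^bsub>free_algebra \<phi> W\<^esub> f) \<otimes>\<^bsub>free_algebra \<phi> W\<^esub> f') u = r * (f \<otimes>\<^bsub>free_algebra \<phi> W\<^esub> f') u"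
  "(f \<otimes>\<^bsub>free_algebra \<phi> W\<^esub> (r \<odot>\<^bsub>free_algebra \<phi> W\<^esub> f')) u = r * (f \<otimes>\<^bsub>free_algebra \<phi> W\<^esub> f') u"
  by (simp_all add: free_mult_apply distrib_left distrib_right sum.distrib sum_distrib_left ac_simps)

text \<open>\<open>f\<close> is generalized because the tail of the word sees the left quotient
  \<open>\<lambda>v. f (w # v)\<close> in place of \<open>f\<close>.\<close>

lemma free_mult_assoc:
  "(f \<otimes>\<^bsub>free_algebra \<phi> W\<^esub> f' \<otimes>\<^bsub>free_algebra \<phi> W\<^esub> f'') u =
    (f \<otimes>\<^bsub>free_algebra \<phi> W\<^esub> (f' \<otimes>\<^bsub>free_algebra \<phi> W\<^esub> f'')) u"
proof (induction u arbitrary: f)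
  case Nil
  show ?case by (simp add: free_mult_Nil mult.assoc)
next
  case (Cons w u)
  have "(f \<otimes>\<^bsub>free_algebra \<phi> W\<^esub> f' \<otimes>\<^bsub>free_algebra \<phi> W\<^esub> f'') (w # u) =
    f [] * f' [] * f'' (w # u) + ((\<lambda>v. f [] * f' (w # v)
      + ((\<lambda>v. f (w # v)) \<otimes>\<^bsub>free_algebra \<phi> W\<^esub> f') v) \<otimes>\<^bsub>free_algebra \<phi> W\<^esub> f'') u"
    by (simp only: free_mult_Cons free_mult_Nil)
  also have "\<dots> = f [] * (f' \<otimes>\<^bsub>free_algebra \<phi> W\<^esub> f'') (w # u)
      + ((\<lambda>v. f (w # v)) \<otimes>\<^bsub>free_algebra \<phi> W\<^esub> f' \<otimes>\<^bsub>free_algebra \<phi> W\<^esub> f'') u"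
    by (simp only: free_mult_add_left free_mult_smult_left free_mult_Cons)
      (simp only: distrib_left mult.assoc add.assoc)
  also have "\<dots> = (f \<otimes>\<^bsub>free_algebra \<phi> W\<^esub> (f' \<otimes>\<^bsub>free_algebra \<phi> W\<^esub> f'')) (w # u)"
    by (simp only: Cons.IH free_mult_Cons)
  finally show ?case .
qed

text \<open>A word with non-zero coefficient in the product is a concatenation of words from the two
  supports, which leaves finitely many.\<close>

lemma free_mult_closed:
  assumes "f \<in> carrier (free_algebra \<phi> W)" "f' \<in> carrier (free_algebra \<phi> W)"
  shows "f \<otimes>\<^bsub>free_algebra \<phi> W\<^esub> f' \<in> carrier (free_algebra \<phi> W)"
proof -
  let ?S = "(\<lambda>(v, v'). v @ v') ` ({v. f v \<noteq> 0} \<times> {v. f' v \<noteq> 0})"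
  have "u \<in> ?S" if u: "(f \<otimes>\<^bsub>free_algebra \<phi> W\<^esub> f') u \<noteq> 0" for u
  proof -
    have "\<exists>i. f (take i u) * f' (drop i u) \<noteq> 0"
      by (rule ccontr) (use u in \<open>simp add: free_mult_apply\<close>)
    then obtain i where "f (take i u) * f' (drop i u) \<noteq> 0" ..
    then have "f (take i u) \<noteq> 0" "f' (drop i u) \<noteq> 0" by auto
    then show ?thesis by (intro image_eqI[of _ _ "(take i u, drop i u)"]) auto
  qed
  then have sub: "{u. (f \<otimes>\<^bsub>free_algebra \<phi> W\<^esub> f') u \<noteq> 0} \<subseteq> ?S" by blast
  have fin: "finite ?S" using assms by simp
  have *: "v @ v' \<in> lists W" if "f v \<noteq> 0" "f' v' \<noteq> 0" for v v'
    using assms that unfolding free_algebra_sel(1) append_in_lists_conv by blast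
  have lst: "?S \<subseteq> lists W"
  proof (rule image_subsetI)
    fix p assume "p \<in> {v. f v \<noteq> 0} \<times> {v. f' v \<noteq> 0}"
    then have "f (fst p) \<noteq> 0" "f' (snd p) \<noteq> 0" by auto
    from *[OF this] show "(case p of (v, v') \<Rightarrow> v @ v') \<in> lists W" by (simp only: split_beta)
  qed
  show ?thesis
    unfolding free_algebra_sel(1) using finite_subset[OF sub fin] order_trans[OF sub lst] ..
qed

section \<open>The free algebra as a unital algebra generated by its letters\<close>

context commutative_algebra
begin

lemma unit_mult [simp]: "\<phi> 1 * r = r" "r * \<phi> 1 = r"
  using algebra_unit[of r] by (simp_all add: mult.commute)

lemma algebra_zero [simp]: "\<phi> 0 = 0"
  using algebra_add[of 0 0] by simp

lemma algebra_sum: "\<phi> (sum f F) = (\<Sum>i\<in>F. \<phi> (f i))"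
  by (induction F rule: infinite_finite_induct) (auto simp: algebra_add)

abbreviation "FA \<equiv> free_algebra \<phi>"

lemma free_mult_one_left: "(\<one>\<^bsub>FA W\<^esub> \<otimes>\<^bsub>FA W\<^esub> f) u = f u"
proof (cases u)
  case (Cons w v)
  then show ?thesis by (simp add: free_mult_Cons free_mult_zero_left)
qed (simp add: free_mult_Nil)

lemma free_mult_one_right: "(f \<otimes>\<^bsub>FA W\<^esub> \<one>\<^bsub>FA W\<^esub>) u = f u"
  by (induction u arbitrary: f)
    (simp_all add: free_mult_Cons free_mult_Nil)

lemma free_algebra_closed:
  "\<one>\<^bsub>FA W\<^esub> \<in> carrier (FA W)" "\<zero>\<^bsub>FA W\<^esub> \<in> carrier (FA W)"
  "\<lbrakk>f \<in> carrier (FA W); f' \<in> carrier (FA W)\<rbrakk> \<Longrightarrow> f \<oplus>\<^bsub>FA W\<^esub> f' \<in> carrier (FA W)"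
  "f \<in> carrier (FA W) \<Longrightarrow> r \<odot>\<^bsub>FA W\<^esub> f \<in> carrier (FA W)"
proof -
  show "\<one>\<^bsub>FA W\<^esub> \<in> carrier (FA W)" "\<zero>\<^bsub>FA W\<^esub> \<in> carrier (FA W)"
    by (auto split: if_splits intro: finite_subset[of _ "{[]}"])
  show "f \<oplus>\<^bsub>FA W\<^esub> f' \<in> carrier (FA W)" if "f \<in> carrier (FA W)" "f' \<in> carrier (FA W)"
  proof -
    have "{u. f u + f' u \<noteq> 0} \<subseteq> {u. f u \<noteq> 0} \<union> {u. f' u \<noteq> 0}" by auto
    from finite_subset[OF this] order_trans[OF this] show ?thesis
      using that unfolding free_algebra_sel by simp
  qed
  show "r \<odot>\<^bsub>FA W\<^esub> f \<in> carrier (FA W)" if "f \<in> carrier (FA W)"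
  proof -
    have "{u. r * f u \<noteq> 0} \<subseteq> {u. f u \<noteq> 0}" by auto
    from finite_subset[OF this] order_trans[OF this] show ?thesis
      using that unfolding free_algebra_sel by simp
  qed
qed

lemma free_unital_algebra: "unital_algebra (FA W) (\<phi> 1)"
proof (intro unital_algebra.intro unital_algebra_axioms.intro ringI abelian_groupI monoidI)
  fix f assume f: "f \<in> carrier (FA W)"
  have "(\<lambda>u. - f u) \<in> carrier (FA W)" using f by simp
  moreover have "(\<lambda>u. - f u) \<oplus>\<^bsub>FA W\<^esub> f = \<zero>\<^bsub>FA W\<^esub>" by (rule ext) simp
  ultimately show "\<exists>f'\<in>carrier (FA W). f' \<oplus>\<^bsub>FA W\<^esub> f = \<zero>\<^bsub>FA W\<^esub>" by blast
qed (simp_all del: free_algebra_sel(1) add: fun_eq_iff free_algebra_closed free_mult_closed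
    free_mult_assoc free_mult_one_left free_mult_one_right free_mult_distrib algebra_simps)

sublocale free: unital_algebra "FA W" "\<phi> 1" for W by (rule free_unital_algebra)

lemma free_gen_closed: "w \<in> W \<Longrightarrow> free_gen \<phi> w \<in> carrier (FA W)"
  by (auto simp: free_gen_def split: if_splits intro: finite_subset[of _ "{[w]}"])

lemma free_gen_mult:
  "(free_gen \<phi> w \<otimes>\<^bsub>FA W\<^esub> f) u = (case u of [] \<Rightarrow> 0 | v # u' \<Rightarrow> if v = w then f u' else 0)"
proof (cases u)
  case (Cons v u')
  have "(free_gen \<phi> w \<otimes>\<^bsub>FA W\<^esub> f) (v # u') =
      ((\<lambda>u. if v = w then \<one>\<^bsub>FA W\<^esub> u else 0) \<otimes>\<^bsub>FA W\<^esub> f) u'"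
  proof -
    have "(\<lambda>v'. free_gen \<phi> w (v # v')) = (\<lambda>u. if v = w then \<one>\<^bsub>FA W\<^esub> u else 0)"
      by (auto simp: free_gen_def)
    moreover have "free_gen \<phi> w [] = 0" by (simp add: free_gen_def)
    ultimately show ?thesis by (simp only: free_mult_Cons mult_zero_left add_0_left)
  qed
  also have "\<dots> = (if v = w then f u' else 0)"
  proof (cases "v = w")
    case True
    have "(\<lambda>u. if v = w then \<one>\<^bsub>FA W\<^esub> u else 0) = \<one>\<^bsub>FA W\<^esub>" using True by auto
    then show ?thesis using free_mult_one_left[of W f u'] True by simp
  qed (simp add: free_mult_apply)
  finally show ?thesis using Cons by simp
qed (simp add: free_gen_def free_mult_Nil)

text \<open>Multiples of a single word arise from multiples of the unit by prefixing letters, and a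
  finitely supported function is dismantled one word at a time.\<close>

lemma free_generates: "generates (FA W) (free_gen \<phi> ` W)"
  unfolding generates_def
proof (intro conjI allI impI)
  show "free_gen \<phi> ` W \<subseteq> carrier (FA W)" by (rule image_subsetI) (rule free_gen_closed)
  fix B
  assume cl: "\<one>\<^bsub>FA W\<^esub> \<in> B \<and> (\<forall>a\<in>B. \<forall>b\<in>B. a \<oplus>\<^bsub>FA W\<^esub> b \<in> B) \<and>
     (\<forall>r. \<forall>a\<in>B. r \<odot>\<^bsub>FA W\<^esub> a \<in> B) \<and> (\<forall>s\<in>free_gen \<phi> ` W. \<forall>a\<in>B. s \<otimes>\<^bsub>FA W\<^esub> a \<in> B)"
  have zero: "(\<lambda>u. 0) \<in> B"
  proof -
    have "0 \<odot>\<^bsub>FA W\<^esub> \<one>\<^bsub>FA W\<^esub> = (\<lambda>u. 0)" by (rule ext) simp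
    moreover have "0 \<odot>\<^bsub>FA W\<^esub> \<one>\<^bsub>FA W\<^esub> \<in> B" using cl by blast
    ultimately show ?thesis by (simp only:)
  qed
  have word: "(\<lambda>v. if v = u then r else 0) \<in> B" if "u \<in> lists W" for u r
    using that
  proof (induction u)
    case Nil
    have "r \<odot>\<^bsub>FA W\<^esub> \<one>\<^bsub>FA W\<^esub> = (\<lambda>v. if v = [] then r else 0)" by (rule ext) simp
    moreover have "r \<odot>\<^bsub>FA W\<^esub> \<one>\<^bsub>FA W\<^esub> \<in> B" using cl by blast
    ultimately show ?case by (simp only:)
  next
    case (Cons w u)
    have "free_gen \<phi> w \<otimes>\<^bsub>FA W\<^esub> (\<lambda>v. if v = u then r else 0) = (\<lambda>v. if v = w # u then r else 0)"
      by (rule ext) (auto simp: free_gen_mult split: list.split)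
    moreover have "free_gen \<phi> w \<otimes>\<^bsub>FA W\<^esub> (\<lambda>v. if v = u then r else 0) \<in> B"
      using cl Cons by blast
    ultimately show ?case by (simp only:)
  qed
  have *: "f \<in> B" if "finite S" "S \<subseteq> lists W" "{u. f u \<noteq> 0} \<subseteq> S" for S f
    using that
  proof (induction S arbitrary: f rule: finite_induct)
    case empty
    then have "f = (\<lambda>u. 0)" by auto
    then show ?case using zero by simp
  next
    case (insert u S)
    have "f(u := 0) \<in> B" by (rule insert.IH) (use insert.prems in auto)
    moreover have "(\<lambda>v. if v = u then f u else 0) \<in> B" using word insert.prems by blast
    ultimately have "f(u := 0) \<oplus>\<^bsub>FA W\<^esub> (\<lambda>v. if v = u then f u else 0) \<in> B" using cl by blast
    moreover have "f(u := 0) \<oplus>\<^bsub>FA W\<^esub> (\<lambda>v. if v = u then f u else 0) = f" by (rule ext) simp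
    ultimately show ?case by (simp only:)
  qed
  show "carrier (FA W) \<subseteq> B"
  proof
    fix f assume "f \<in> carrier (FA W)"
    then show "f \<in> B" using *[of "{u. f u \<noteq> 0}" f] by simp
  qed
qed

end

section \<open>Representations of the free algebra\<close>

locale free_representation = scalar_action sc "\<phi> 1" + commutative_algebra \<phi>
  for sc :: "'r::comm_ring \<Rightarrow> 'm::ab_group_add \<Rightarrow> 'm" and \<phi> :: "'k::field \<Rightarrow> 'r" +
  fixes W :: "'w set" and op :: "'w \<Rightarrow> 'm \<Rightarrow> 'm"
  assumes op_linear: "w \<in> W \<Longrightarrow> linear_op (op w)"
begin

definition free_rep :: "('w list \<Rightarrow> 'r) \<Rightarrow> 'm \<Rightarrow> 'm"
  where "free_rep f m = (\<Sum>u | f u \<noteq> 0. sc (f u) (foldr op u m))"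

text \<open>Enlarging the range of summation allows several functions to be summed over a common
  finite set.\<close>

lemma free_rep_eq:
  "finite S \<Longrightarrow> {u. f u \<noteq> 0} \<subseteq> S \<Longrightarrow> free_rep f m = (\<Sum>u\<in>S. sc (f u) (foldr op u m))"
  unfolding free_rep_def by (rule sum.mono_neutral_left) auto

lemma foldr_linear: "u \<in> lists W \<Longrightarrow> linear_op (foldr op u)"
  by (induction u) (auto simp: linear_op_def op_linear[unfolded linear_op_def])

lemma free_rep_add:
  assumes "f \<in> carrier (FA W)" "f' \<in> carrier (FA W)"
  shows "free_rep (f \<oplus>\<^bsub>FA W\<^esub> f') m = free_rep f m + free_rep f' m"
proof -
  let ?S = "{u. f u \<noteq> 0} \<union> {u. f' u \<noteq> 0}"
  have S: "finite ?S" using assms by simp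
  show ?thesis
    by (subst (1 2 3) free_rep_eq[OF S]) (auto simp: sum.distrib sc_add_left)
qed

lemma free_rep_smult:
  assumes "f \<in> carrier (FA W)"
  shows "free_rep (r \<odot>\<^bsub>FA W\<^esub> f) m = sc r (free_rep f m)"
proof -
  have S: "finite {u. f u \<noteq> 0}" using assms by simp
  show ?thesis
    by (subst (1 2) free_rep_eq[OF S]) (auto simp: sc_sum sc_sc)
qed

lemma free_rep_gen_mult:
  assumes "f \<in> carrier (FA W)" "w \<in> W"
  shows "free_rep (free_gen \<phi> w \<otimes>\<^bsub>FA W\<^esub> f) m = op w (free_rep f m)"
proof -
  let ?S = "{u. f u \<noteq> 0}"
  have S: "finite ?S" using assms by simp
  have "free_rep (free_gen \<phi> w \<otimes>\<^bsub>FA W\<^esub> f) m =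
      (\<Sum>u\<in>Cons w ` ?S. sc ((free_gen \<phi> w \<otimes>\<^bsub>FA W\<^esub> f) u) (foldr op u m))"
  proof (rule free_rep_eq)
    show "{u. (free_gen \<phi> w \<otimes>\<^bsub>FA W\<^esub> f) u \<noteq> 0} \<subseteq> Cons w ` ?S"
    proof
      fix u assume "u \<in> {u. (free_gen \<phi> w \<otimes>\<^bsub>FA W\<^esub> f) u \<noteq> 0}"
      then show "u \<in> Cons w ` ?S" by (cases u) (auto simp: free_gen_mult split: if_splits)
    qed
  qed (use S in simp)
  also have "\<dots> = (\<Sum>u\<in>?S. op w (sc (f u) (foldr op u m)))"
    by (subst sum.reindex) (use op_linear[OF assms(2)] in \<open>simp_all add: free_gen_mult linear_op_def\<close>)
  also have "\<dots> = op w (free_rep f m)"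
    unfolding free_rep_def by (rule linear_op_sum[OF op_linear[OF assms(2)], symmetric])
  finally show ?thesis .
qed

lemma free_rep_one: "free_rep \<one>\<^bsub>FA W\<^esub> m = m"
proof -
  have "free_rep \<one>\<^bsub>FA W\<^esub> m = (\<Sum>u\<in>{[]}. sc (\<one>\<^bsub>FA W\<^esub> u) (foldr op u m))"
    by (rule free_rep_eq) auto
  then show ?thesis by (simp add: sc_unit)
qed

lemma free_rep_gen:
  assumes w: "w \<in> W"
  shows "free_rep (free_gen \<phi> w) m = op w m"
  using free_rep_gen_mult[OF free_algebra_closed(1) w, of m] free.r_one[OF free_gen_closed[OF w]]
    free_rep_one[of m] by simp

text \<open>Multiplicativity goes by induction on the left factor along
  \<open>free_generates\<close>, so that only multiplication by one letter has to be
  computed.\<close>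

lemma free_rep_representation: "is_representation (FA W) free_rep"
  unfolding is_representation_def
proof (intro conjI ballI allI)
  fix f f' m assume f: "f \<in> carrier (FA W)"
  have l: "linear_op (foldr op u)" if "f u \<noteq> 0" for u
    using f that by (intro foldr_linear) auto
  have "sc (f u) (sc r (foldr op u m)) = sc r (sc (f u) (foldr op u m))" for u r m
    by (simp flip: sc_sc add: mult.commute)
  then show "linear_op (free_rep f)"
    using l unfolding free_rep_def linear_op_def
    by (auto simp: sum.distrib sc_sum sc_add_right intro!: sum.cong)
  assume f': "f' \<in> carrier (FA W)"
  show "free_rep (f \<otimes>\<^bsub>FA W\<^esub> f') m = free_rep f (free_rep f' m)"
    using free_generates f
  proof (induction f rule: generates_induct)
    case one
    show ?case by (simp only: f' free.l_one free_rep_one)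
  next
    case (add a b)
    then show ?case by (simp only: f' free.l_distr free_rep_add free.m_closed)
  next
    case (smult r a)
    then show ?case by (simp only: f' free.smult_mult_left free_rep_smult free.m_closed)
  next
    case (mult s a)
    then obtain w where w: "w \<in> W" "s = free_gen \<phi> w" by auto
    have "free_rep (s \<otimes>\<^bsub>FA W\<^esub> a \<otimes>\<^bsub>FA W\<^esub> f') m = free_rep (s \<otimes>\<^bsub>FA W\<^esub> (a \<otimes>\<^bsub>FA W\<^esub> f')) m"
      unfolding w(2) using free.m_assoc[OF free_gen_closed[OF w(1)] mult(2) f'] by (simp only:)
    also have "\<dots> = op w (free_rep (a \<otimes>\<^bsub>FA W\<^esub> f') m)"
      unfolding w(2) by (rule free_rep_gen_mult[OF free.m_closed[OF mult(2) f'] w(1)])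
    also have "\<dots> = free_rep (s \<otimes>\<^bsub>FA W\<^esub> a) (free_rep f' m)"
      unfolding w(2) by (simp only: free_rep_gen_mult[OF mult(2) w(1)] mult(3))
    finally show ?case .
  qed (rule free_unital_algebra)
qed (rule free_rep_add free_rep_smult; assumption)+

end

declare free_algebra_sel(1) [simp del] quot_algebra_sel [simp del]

subsection \<open>Induced actions\<close>

context algebra_action
begin

declare semidirect_sel(1) [simp del]

lemma act_uminus: "g \<in> carrier G \<Longrightarrow> a \<in> carrier A \<Longrightarrow> act g (\<ominus> a) = \<ominus> act g a"
  using act_add[of g "\<ominus> a" a] by (simp add: l_neg minus_equality)

lemma act_minus:
  "\<lbrakk>g \<in> carrier G; a \<in> carrier A; b \<in> carrier A\<rbrakk> \<Longrightarrow> act g (a \<ominus> b) = act g a \<ominus> act g b"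
  by (simp add: minus_eq act_add act_uminus)

text \<open>The elements that \<open>g\<close> maps into the ideal form an ideal themselves. Hence
  invariance has to be checked on the generating set only.\<close>

lemma act_genideal:
  assumes X: "X \<subseteq> carrier A" and inv: "\<And>g a. g \<in> carrier G \<Longrightarrow> a \<in> X \<Longrightarrow> act g a \<in> Idl X"
    and g: "g \<in> carrier G" and a: "a \<in> Idl X"
  shows "act g a \<in> Idl X"
proof -
  interpret I: ideal "Idl X" A by (rule genideal_ideal[OF X])
  have "ideal {a \<in> carrier A. act g a \<in> Idl X} A"
  proof (rule idealI)
    show "ring A" by (rule ring_axioms)
    show "subgroup {a \<in> carrier A. act g a \<in> Idl X} (add_monoid A)"
      by unfold_locales (use g in \<open>auto simp: act_add act_uminus simp flip: a_inv_def\<close>)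
  qed (use g in \<open>auto simp: act_prod I.I_l_closed I.I_r_closed\<close>)
  moreover have "X \<subseteq> {a \<in> carrier A. act g a \<in> Idl X}"
    using X inv g by blast
  ultimately have "Idl X \<subseteq> {a \<in> carrier A. act g a \<in> Idl X}"
    by (rule genideal_minimal)
  then show ?thesis using a by blast
qed

text \<open>Invariance under \<open>inv g\<close> as well makes \<open>act g\<close> map the ideal
  onto itself, hence cosets onto whole cosets. The induced actions on the quotients are defined as
  images of cosets.\<close>

lemma act_coset:
  assumes I: "ideal I A" and inv: "\<And>g a. g \<in> carrier G \<Longrightarrow> a \<in> I \<Longrightarrow> act g a \<in> I"
    and g: "g \<in> carrier G" and a: "a \<in> carrier A"
  shows "act g ` (I +> a) = I +> act g a"
proof -
  interpret I: ideal I A by (rule I)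
  have "i \<in> act g ` I" if "i \<in> I" for i
    using that inv[of "inv\<^bsub>G\<^esub> g" i] g act_mult[of g "inv\<^bsub>G\<^esub> g" i]
    by (intro image_eqI[of _ _ "act (inv\<^bsub>G\<^esub> g) i"]) (simp_all add: act_one)
  then have "act g ` I = I" using inv g by blast
  moreover have "act g ` (I +> a) = (\<lambda>i. i \<oplus> act g a) ` act g ` I"
    unfolding a_r_coset_def' using a g by (auto simp: act_add image_iff)
  ultimately show ?thesis by (auto simp: a_r_coset_def')
qed

lemma quot_action:
  assumes I: "ideal I A" and inv: "\<And>g a. g \<in> carrier G \<Longrightarrow> a \<in> I \<Longrightarrow> act g a \<in> I"
  shows "algebra_action (quot_algebra A I) u G (\<lambda>g. (`) (act g))"
proof (intro algebra_action.intro algebra_action_axioms.intro quot_unital_algebra[OF I] G.group_axioms)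
  have *: "act g ` (I +> a) = I +> act g a" if "g \<in> carrier G" "a \<in> carrier A" for g a
    by (rule act_coset[OF I]) (use inv that in auto)
  fix g assume g: "g \<in> carrier G"
  show "algebra_hom (quot_algebra A I) (quot_algebra A I) ((`) (act g))"
    unfolding algebra_hom_def
  proof (intro conjI allI ballI ring_hom_memI)
    fix X r assume X: "X \<in> carrier (quot_algebra A I)"
    obtain a where a: "a \<in> carrier A" "X = I +> a" using quot_surj[OF I X] by blast
    show "act g ` X \<in> carrier (quot_algebra A I)"
      unfolding a(2) *[OF g a(1)] by (rule quot_closed[OF I act_closed[OF g a(1)]])
    show "act g ` (r \<odot>\<^bsub>quot_algebra A I\<^esub> X) = r \<odot>\<^bsub>quot_algebra A I\<^esub> act g ` X"
      unfolding a(2) by (simp only: quot_smult[OF I] * g a(1) smult_closed act_closed act_smult)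
    fix Y assume Y: "Y \<in> carrier (quot_algebra A I)"
    obtain b where b: "b \<in> carrier A" "Y = I +> b" using quot_surj[OF I Y] by blast
    show "act g ` (X \<otimes>\<^bsub>quot_algebra A I\<^esub> Y) = act g ` X \<otimes>\<^bsub>quot_algebra A I\<^esub> act g ` Y"
      unfolding a(2) b(2) by (simp only: quot_mult[OF I] * g a(1) b(1) m_closed act_closed act_prod)
    show "act g ` (X \<oplus>\<^bsub>quot_algebra A I\<^esub> Y) = act g ` X \<oplus>\<^bsub>quot_algebra A I\<^esub> act g ` Y"
      unfolding a(2) b(2) by (simp only: quot_add[OF I] * g a(1) b(1) a_closed act_closed act_add)
  next
    show "act g ` \<one>\<^bsub>quot_algebra A I\<^esub> = \<one>\<^bsub>quot_algebra A I\<^esub>"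
      by (simp only: quot_algebra_sel(3) * g one_closed act_one_right)
  qed
next
  have *: "act g ` (I +> a) = I +> act g a" if "g \<in> carrier G" "a \<in> carrier A" for g a
    by (rule act_coset[OF I]) (use inv that in auto)
  fix X assume X: "X \<in> carrier (quot_algebra A I)"
  obtain a where a: "a \<in> carrier A" "X = I +> a" using quot_surj[OF I X] by blast
  show "act \<one>\<^bsub>G\<^esub> ` X = X"
    unfolding a(2) by (simp only: * a(1) G.one_closed act_one)
  fix g h assume g: "g \<in> carrier G" "h \<in> carrier G"
  show "act (g \<otimes>\<^bsub>G\<^esub> h) ` X = act g ` act h ` X"
    unfolding a(2) by (simp only: * a(1) g G.m_closed act_closed act_mult)
qed

end

lemma (in commutative_algebra) free_action:
  assumes "group G"
    and W: "\<And>g w. g \<in> carrier G \<Longrightarrow> w \<in> W \<Longrightarrow> \<sigma> g w \<in> W"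
    and one: "\<And>w. \<sigma> \<one>\<^bsub>G\<^esub> w = w"
    and mult: "\<And>g h w. g \<in> carrier G \<Longrightarrow> h \<in> carrier G \<Longrightarrow> \<sigma> (g \<otimes>\<^bsub>G\<^esub> h) w = \<sigma> g (\<sigma> h w)"
  shows "algebra_action (FA W) (\<phi> 1) G (\<lambda>g f u. f (map (\<sigma> (inv\<^bsub>G\<^esub> g)) u))"
    and "g \<in> carrier G \<Longrightarrow>
      (\<lambda>u. free_gen \<phi> w (map (\<sigma> (inv\<^bsub>G\<^esub> g)) u)) = free_gen \<phi> (\<sigma> g w)"
proof -
  interpret G: group G by fact
  have \<sigma>: "\<sigma> g (\<sigma> (inv\<^bsub>G\<^esub> g) w) = w" "\<sigma> (inv\<^bsub>G\<^esub> g) (\<sigma> g w) = w" if "g \<in> carrier G" for g w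
    using that mult[of g "inv\<^bsub>G\<^esub> g"] mult[of "inv\<^bsub>G\<^esub> g" g] one by simp_all
  have map_\<sigma>: "map (\<sigma> g) (map (\<sigma> (inv\<^bsub>G\<^esub> g)) v) = v" if "g \<in> carrier G" for g v
    using \<sigma>(1)[OF that] by (simp add: map_idI)
  show gen: "(\<lambda>u. free_gen \<phi> w (map (\<sigma> (inv\<^bsub>G\<^esub> g)) u)) = free_gen \<phi> (\<sigma> g w)"
    if g: "g \<in> carrier G" for g w
  proof
    fix v
    have "map (\<sigma> (inv\<^bsub>G\<^esub> g)) v = [w] \<longleftrightarrow> v = [\<sigma> g w]"
      using \<sigma>[OF g] by (auto simp: map_eq_Cons_conv)
    then show "free_gen \<phi> w (map (\<sigma> (inv\<^bsub>G\<^esub> g)) v) = free_gen \<phi> (\<sigma> g w) v"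
      by (simp add: free_gen_def)
  qed
  show "algebra_action (FA W) (\<phi> 1) G (\<lambda>g f u. f (map (\<sigma> (inv\<^bsub>G\<^esub> g)) u))"
  proof (intro algebra_action.intro algebra_action_axioms.intro free_unital_algebra G.group_axioms)
    fix g assume g: "g \<in> carrier G"
    show "algebra_hom (FA W) (FA W) (\<lambda>f u. f (map (\<sigma> (inv\<^bsub>G\<^esub> g)) u))"
      unfolding algebra_hom_def
    proof (intro conjI allI ballI ring_hom_memI)
      fix f assume f: "f \<in> carrier (FA W)"
      have sub: "{v. f (map (\<sigma> (inv\<^bsub>G\<^esub> g)) v) \<noteq> 0} \<subseteq> map (\<sigma> g) ` {v. f v \<noteq> 0}"
      proof
        fix v assume "v \<in> {v. f (map (\<sigma> (inv\<^bsub>G\<^esub> g)) v) \<noteq> 0}"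
        then show "v \<in> map (\<sigma> g) ` {v. f v \<noteq> 0}"
          using map_\<sigma>[OF g, of v] by (intro image_eqI[of _ _ "map (\<sigma> (inv\<^bsub>G\<^esub> g)) v"]) auto
      qed
      have fin: "finite (map (\<sigma> g) ` {v. f v \<noteq> 0})"
        using f by (simp add: free_algebra_sel)
      have "map (\<sigma> g) v \<in> lists W" if "f v \<noteq> 0" for v
      proof -
        have "{v. f v \<noteq> 0} \<subseteq> lists W" using f by (simp add: free_algebra_sel)
        then have "v \<in> lists W" using that by blast
        then show ?thesis using W[OF g] by auto
      qed
      then have "map (\<sigma> g) ` {v. f v \<noteq> 0} \<subseteq> lists W" by (intro image_subsetI) simp
      from finite_subset[OF sub fin] order_trans[OF sub this]
      show "(\<lambda>v. f (map (\<sigma> (inv\<^bsub>G\<^esub> g)) v)) \<in> carrier (FA W)"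
        unfolding free_algebra_sel ..
    qed (auto simp: fun_eq_iff free_mult_apply take_map drop_map)
  next
    fix f assume "f \<in> carrier (FA W)"
    show "(\<lambda>v. f (map (\<sigma> (inv\<^bsub>G\<^esub> \<one>\<^bsub>G\<^esub>)) v)) = f"
      by (simp add: one map_idI)
    fix g h assume g: "g \<in> carrier G" "h \<in> carrier G"
    have "\<sigma> (inv\<^bsub>G\<^esub> (g \<otimes>\<^bsub>G\<^esub> h)) = (\<lambda>w. \<sigma> (inv\<^bsub>G\<^esub> h) (\<sigma> (inv\<^bsub>G\<^esub> g) w))"
      using g by (simp add: G.inv_mult_group mult fun_eq_iff)
    then show "(\<lambda>v. f (map (\<sigma> (inv\<^bsub>G\<^esub> (g \<otimes>\<^bsub>G\<^esub> h))) v)) =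
        (\<lambda>v. f (map (\<sigma> (inv\<^bsub>G\<^esub> h)) (map (\<sigma> (inv\<^bsub>G\<^esub> g)) v)))"
      by (simp add: comp_def)
  qed
qed

section \<open>The presentation\<close>

context vector_space
begin

lemma dual_space_iff:
  "x \<in> dual_space \<longleftrightarrow> (\<forall>v w. x (v + w) = x v + x w) \<and> (\<forall>a v. x (scale a v) = a * x v)"
proof -
  have "vector_space ((*) :: 'a \<Rightarrow> 'a \<Rightarrow> 'a)" by unfold_locales (auto simp: algebra_simps)
  then show ?thesis
    using vector_space_axioms
    by (auto simp: dual_space_def Vector_Spaces.linear_def module_hom_def module_hom_axioms_def
        module_iff_vector_space)
qed

end

section \<open>The action on \<open>V\<close> and its dual, and the induced actions on tensor and
  symmetric algebra\<close>

context cherednik_datum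
begin

lemma rep_add: "g \<in> carrier G \<Longrightarrow> \<rho> g (v + w) = \<rho> g v + \<rho> g w"
  and rep_scale: "g \<in> carrier G \<Longrightarrow> \<rho> g (scale a v) = scale a (\<rho> g v)"
  using rep_linear[of g] by (auto simp: Vector_Spaces.linear_def module_hom_def module_hom_axioms_def)

lemma rep_inv [simp]:
  assumes "g \<in> carrier G"
  shows "\<rho> g (\<rho> (inv g) v) = v" "\<rho> (inv g) (\<rho> g v) = v"
  using assms rep_mult[of g "inv g" v] rep_mult[of "inv g" g v] by (simp_all add: rep_one)

lemma dual_action: "x \<in> dual_space \<Longrightarrow> g \<in> carrier G \<Longrightarrow> (\<lambda>v. x (\<rho> g v)) \<in> dual_space"
  by (simp add: dual_space_iff rep_add rep_scale)

lemma dual_zero [simp]: "(\<lambda>v. 0) \<in> dual_space"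
  and dual_add: "x \<in> dual_space \<Longrightarrow> x' \<in> dual_space \<Longrightarrow> (\<lambda>v. x v + x' v) \<in> dual_space"
  and dual_scale: "x \<in> dual_space \<Longrightarrow> (\<lambda>v. a * x v) \<in> dual_space"
  by (auto simp: dual_space_iff algebra_simps)

abbreviation "W \<equiv> carrier VV"

lemma in_W: "w \<in> W \<longleftrightarrow> snd w \<in> dual_space"
  by (cases w) (simp add: VV_def)

lemma VV_add: "w \<oplus>\<^bsub>VV\<^esub> w' = (fst w + fst w', \<lambda>v. snd w v + snd w' v)"
  and VV_smult: "a \<odot>\<^bsub>VV\<^esub> w = (scale a (fst w), \<lambda>v. a * snd w v)"
  by (simp_all add: VV_def split_beta)

lemma VV_closed: "w \<in> W \<Longrightarrow> w' \<in> W \<Longrightarrow> w \<oplus>\<^bsub>VV\<^esub> w' \<in> W" "w \<in> W \<Longrightarrow> a \<odot>\<^bsub>VV\<^esub> w \<in> W"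
  by (auto simp: in_W VV_add VV_smult dual_add dual_scale)

lemma VV_act_apply: "VV_act g w = (\<rho> g (fst w), \<lambda>v. snd w (\<rho> (inv g) v))"
  by (simp add: VV_act_def split_beta)

lemma VV_act_closed: "g \<in> carrier G \<Longrightarrow> w \<in> W \<Longrightarrow> VV_act g w \<in> W"
  by (simp add: in_W VV_act_apply dual_action)

lemma VV_act_linear:
  assumes "g \<in> carrier G"
  shows "VV_act g (w \<oplus>\<^bsub>VV\<^esub> w') = VV_act g w \<oplus>\<^bsub>VV\<^esub> VV_act g w'"
    "VV_act g (a \<odot>\<^bsub>VV\<^esub> w) = a \<odot>\<^bsub>VV\<^esub> VV_act g w"
  using assms by (simp_all add: VV_add VV_smult VV_act_apply rep_add rep_scale)

lemma VV_act_one: "VV_act \<one> w = w"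
  by (simp add: VV_act_apply rep_one)

lemma VV_act_mult: "g \<in> carrier G \<Longrightarrow> h \<in> carrier G \<Longrightarrow> VV_act (g \<otimes> h) w = VV_act g (VV_act h w)"
  by (simp add: VV_act_apply rep_mult inv_mult_group)

lemma free_act_eq: "free_act = (\<lambda>g f u. f (map (VV_act (inv g)) u))"
  by (simp add: free_act_def fun_eq_iff)

sublocale FV: finite_algebra_action "FA W" "\<phi> 1" G free_act
  unfolding free_act_eq
  by (intro finite_algebra_action.intro finite_algebra_action_axioms.intro free_action(1)
      group_axioms VV_act_closed VV_act_one VV_act_mult finite_group)

lemma free_act_gen: "g \<in> carrier G \<Longrightarrow> free_act g (free_gen \<phi> w) = free_gen \<phi> (VV_act g w)"
  unfolding free_act_eq
  by (intro free_action(2)[of _ W] group_axioms VV_act_closed VV_act_one VV_act_mult)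

definition tensor_rels :: "(('v \<times> ('v \<Rightarrow> 'k)) list \<Rightarrow> 'r) set"
  where "tensor_rels =
    {free_gen \<phi> (w \<oplus>\<^bsub>VV\<^esub> w') \<ominus>\<^bsub>FA W\<^esub> (free_gen \<phi> w \<oplus>\<^bsub>FA W\<^esub> free_gen \<phi> w') | w w'. w \<in> W \<and> w' \<in> W} \<union>
    {free_gen \<phi> (a \<odot>\<^bsub>VV\<^esub> w) \<ominus>\<^bsub>FA W\<^esub> (\<phi> a \<odot>\<^bsub>FA W\<^esub> free_gen \<phi> w) | a w. w \<in> W}"

lemma tensor_ideal_eq: "tensor_ideal \<phi> VV = Idl\<^bsub>FA W\<^esub> tensor_rels"
  by (simp add: tensor_ideal_def tensor_rels_def Let_def)

lemma tensor_rels_closed: "tensor_rels \<subseteq> carrier (FA W)"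
  unfolding tensor_rels_def
  by (auto intro!: free.minus_closed free.a_closed free.smult_closed free_gen_closed VV_closed)

lemma tensor_ideal: "ideal (tensor_ideal \<phi> VV) (FA W)"
  unfolding tensor_ideal_eq by (rule free.genideal_ideal[OF tensor_rels_closed])

text \<open>Since \<open>VV_act g\<close> is linear, it carries each linearity relation to a
  relation of the same kind.\<close>

lemma tensor_rels_act:
  assumes g: "g \<in> carrier G" and a: "a \<in> tensor_rels"
  shows "free_act g a \<in> tensor_rels"
proof -
  consider w w' where "w \<in> W" "w' \<in> W"
      "a = free_gen \<phi> (w \<oplus>\<^bsub>VV\<^esub> w') \<ominus>\<^bsub>FA W\<^esub> (free_gen \<phi> w \<oplus>\<^bsub>FA W\<^esub> free_gen \<phi> w')"
    | b w where "w \<in> W" "a = free_gen \<phi> (b \<odot>\<^bsub>VV\<^esub> w) \<ominus>\<^bsub>FA W\<^esub> (\<phi> b \<odot>\<^bsub>FA W\<^esub> free_gen \<phi> w)"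
    using a unfolding tensor_rels_def by blast
  then show ?thesis
  proof cases
    case 1
    then have "free_act g a = free_gen \<phi> (VV_act g w \<oplus>\<^bsub>VV\<^esub> VV_act g w') \<ominus>\<^bsub>FA W\<^esub>
        (free_gen \<phi> (VV_act g w) \<oplus>\<^bsub>FA W\<^esub> free_gen \<phi> (VV_act g w'))"
      using g by (simp only: FV.act_minus FV.act_add free_act_gen free_gen_closed VV_closed
          free.a_closed VV_act_linear)
    then show ?thesis
      unfolding tensor_rels_def using VV_act_closed[OF g 1(1)] VV_act_closed[OF g 1(2)] by blast
  next
    case 2
    then have "free_act g a = free_gen \<phi> (b \<odot>\<^bsub>VV\<^esub> VV_act g w) \<ominus>\<^bsub>FA W\<^esub>
        (\<phi> b \<odot>\<^bsub>FA W\<^esub> free_gen \<phi> (VV_act g w))"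
      using g by (simp only: FV.act_minus FV.act_smult free_act_gen free_gen_closed VV_closed
          free.smult_closed VV_act_linear)
    then show ?thesis
      unfolding tensor_rels_def using VV_act_closed[OF g 2(1)] by blast
  qed
qed

lemma tensor_ideal_act: "g \<in> carrier G \<Longrightarrow> a \<in> tensor_ideal \<phi> VV \<Longrightarrow> free_act g a \<in> tensor_ideal \<phi> VV"
  unfolding tensor_ideal_eq
  by (rule FV.act_genideal[OF tensor_rels_closed])
    (use tensor_rels_act free.genideal_self[OF tensor_rels_closed] in blast)+

lemma tensor_act_eq: "tensor_act = (\<lambda>g. (`) (free_act g))"
  by (simp add: tensor_act_def fun_eq_iff)

sublocale TV: finite_algebra_action T "\<phi> 1" G tensor_act
  unfolding tensor_act_eq tensor_algebra_def
  by (intro finite_algebra_action.intro finite_algebra_action_axioms.intro FV.quot_action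
      tensor_ideal tensor_ideal_act finite_group)

lemma tensor_gen_closed: "w \<in> W \<Longrightarrow> tensor_gen \<phi> VV w \<in> carrier T"
  unfolding tensor_gen_def tensor_algebra_def
  by (rule free.quot_closed[OF tensor_ideal free_gen_closed])

lemma tensor_act_gen:
  "g \<in> carrier G \<Longrightarrow> w \<in> W \<Longrightarrow> tensor_act g (tensor_gen \<phi> VV w) = tensor_gen \<phi> VV (VV_act g w)"
  unfolding tensor_act_eq tensor_gen_def
  by (simp only: FV.act_coset[OF tensor_ideal tensor_ideal_act] free_gen_closed free_act_gen)

lemma tensor_generates: "generates T (tensor_gen \<phi> VV ` W)"
  using free.quot_generates[OF tensor_ideal free_generates]
  unfolding tensor_algebra_def image_image tensor_gen_def[abs_def] .

lemma tensor_gen_linear: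
  shows "w \<in> W \<Longrightarrow> w' \<in> W \<Longrightarrow>
      tensor_gen \<phi> VV (w \<oplus>\<^bsub>VV\<^esub> w') = tensor_gen \<phi> VV w \<oplus>\<^bsub>T\<^esub> tensor_gen \<phi> VV w'"
    and "w \<in> W \<Longrightarrow> tensor_gen \<phi> VV (a \<odot>\<^bsub>VV\<^esub> w) = \<phi> a \<odot>\<^bsub>T\<^esub> tensor_gen \<phi> VV w"
proof -
  have *: "a \<in> tensor_rels \<Longrightarrow> a \<in> tensor_ideal \<phi> VV" for a
    unfolding tensor_ideal_eq using free.genideal_self[OF tensor_rels_closed] by blast
  show "tensor_gen \<phi> VV (w \<oplus>\<^bsub>VV\<^esub> w') = tensor_gen \<phi> VV w \<oplus>\<^bsub>T\<^esub> tensor_gen \<phi> VV w'"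
    if w: "w \<in> W" "w' \<in> W"
  proof -
    have "free_gen \<phi> (w \<oplus>\<^bsub>VV\<^esub> w') \<ominus>\<^bsub>FA W\<^esub> (free_gen \<phi> w \<oplus>\<^bsub>FA W\<^esub> free_gen \<phi> w') \<in> tensor_rels"
      unfolding tensor_rels_def using w by blast
    then show ?thesis
      unfolding tensor_algebra_def tensor_gen_def
      using w by (simp only: free.quot_add[OF tensor_ideal] free.quot_eq_iff[OF tensor_ideal]
        free_gen_closed free.a_closed VV_closed *)
  qed
  show "tensor_gen \<phi> VV (a \<odot>\<^bsub>VV\<^esub> w) = \<phi> a \<odot>\<^bsub>T\<^esub> tensor_gen \<phi> VV w" if w: "w \<in> W"
  proof -
    have "free_gen \<phi> (a \<odot>\<^bsub>VV\<^esub> w) \<ominus>\<^bsub>FA W\<^esub> (\<phi> a \<odot>\<^bsub>FA W\<^esub> free_gen \<phi> w) \<in> tensor_rels"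
      unfolding tensor_rels_def using w by blast
    then show ?thesis
      unfolding tensor_algebra_def tensor_gen_def
      using w by (simp only: free.quot_smult[OF tensor_ideal] free.quot_eq_iff[OF tensor_ideal]
        free_gen_closed free.smult_closed VV_closed *)
  qed
qed

definition symmetric_rels :: "(('v \<times> ('v \<Rightarrow> 'k)) list \<Rightarrow> 'r) set set"
  where "symmetric_rels =
    {commutator T (tensor_gen \<phi> VV w) (tensor_gen \<phi> VV w') | w w'. w \<in> W \<and> w' \<in> W}"

lemma symmetric_ideal_eq: "symmetric_ideal \<phi> VV = Idl\<^bsub>T\<^esub> symmetric_rels"
  by (simp add: symmetric_ideal_def symmetric_rels_def)

lemma symmetric_rels_closed: "symmetric_rels \<subseteq> carrier T"
  unfolding symmetric_rels_def commutator_def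
  by (auto intro!: TV.minus_closed TV.m_closed tensor_gen_closed)

lemma symmetric_ideal: "ideal (symmetric_ideal \<phi> VV) T"
  unfolding symmetric_ideal_eq by (rule TV.genideal_ideal[OF symmetric_rels_closed])

lemma symmetric_ideal_act:
  "g \<in> carrier G \<Longrightarrow> a \<in> symmetric_ideal \<phi> VV \<Longrightarrow> tensor_act g a \<in> symmetric_ideal \<phi> VV"
  unfolding symmetric_ideal_eq
proof (rule TV.act_genideal[OF symmetric_rels_closed])
  fix g a assume g: "g \<in> carrier G" and "a \<in> symmetric_rels"
  then obtain w w' where w: "w \<in> W" "w' \<in> W" "a = commutator T (tensor_gen \<phi> VV w) (tensor_gen \<phi> VV w')"
    unfolding symmetric_rels_def by blast
  then have "tensor_act g a =
      commutator T (tensor_gen \<phi> VV (VV_act g w)) (tensor_gen \<phi> VV (VV_act g w'))"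
    using g by (simp only: commutator_def TV.act_minus TV.act_prod TV.m_closed tensor_gen_closed tensor_act_gen)
  then have "tensor_act g a \<in> symmetric_rels"
    unfolding symmetric_rels_def using VV_act_closed[OF g w(1)] VV_act_closed[OF g w(2)] by blast
  then show "tensor_act g a \<in> Idl\<^bsub>T\<^esub> symmetric_rels"
    using TV.genideal_self[OF symmetric_rels_closed] by blast
qed

lemma symmetric_act_eq: "symmetric_act = (\<lambda>g. (`) (tensor_act g))"
  by (simp add: symmetric_act_def fun_eq_iff)

sublocale SV: finite_algebra_action S "\<phi> 1" G symmetric_act
  unfolding symmetric_act_eq symmetric_algebra_def
  by (intro finite_algebra_action.intro finite_algebra_action_axioms.intro TV.quot_action
      symmetric_ideal symmetric_ideal_act finite_group)

lemma symmetric_gen_closed: "w \<in> W \<Longrightarrow> symmetric_gen \<phi> VV w \<in> carrier S"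
  unfolding symmetric_gen_def symmetric_algebra_def
  by (rule TV.quot_closed[OF symmetric_ideal tensor_gen_closed])

lemma symmetric_act_gen:
  "g \<in> carrier G \<Longrightarrow> w \<in> W \<Longrightarrow> symmetric_act g (symmetric_gen \<phi> VV w) = symmetric_gen \<phi> VV (VV_act g w)"
  unfolding symmetric_act_eq symmetric_gen_def
  by (simp only: TV.act_coset[OF symmetric_ideal symmetric_ideal_act] tensor_gen_closed tensor_act_gen)

lemma symmetric_generates: "generates S (symmetric_gen \<phi> VV ` W)"
  using TV.quot_generates[OF symmetric_ideal tensor_generates]
  unfolding symmetric_algebra_def image_image symmetric_gen_def[abs_def] .

lemma symmetric_gen_linear:
  shows "w \<in> W \<Longrightarrow> w' \<in> W \<Longrightarrow>
      symmetric_gen \<phi> VV (w \<oplus>\<^bsub>VV\<^esub> w') = symmetric_gen \<phi> VV w \<oplus>\<^bsub>S\<^esub> symmetric_gen \<phi> VV w'"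
    and "w \<in> W \<Longrightarrow> symmetric_gen \<phi> VV (a \<odot>\<^bsub>VV\<^esub> w) = \<phi> a \<odot>\<^bsub>S\<^esub> symmetric_gen \<phi> VV w"
  unfolding symmetric_algebra_def symmetric_gen_def
  by (simp_all only: TV.quot_add[OF symmetric_ideal] TV.quot_smult[OF symmetric_ideal]
      tensor_gen_closed tensor_gen_linear)

lemma symmetric_gen_commute:
  assumes "w \<in> W" "w' \<in> W"
  shows "symmetric_gen \<phi> VV w \<otimes>\<^bsub>S\<^esub> symmetric_gen \<phi> VV w' =
    symmetric_gen \<phi> VV w' \<otimes>\<^bsub>S\<^esub> symmetric_gen \<phi> VV w"
proof -
  have "commutator T (tensor_gen \<phi> VV w) (tensor_gen \<phi> VV w') \<in> symmetric_ideal \<phi> VV"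
    using assms TV.genideal_self[OF symmetric_rels_closed]
    unfolding symmetric_ideal_eq symmetric_rels_def by blast
  then show ?thesis
    unfolding symmetric_algebra_def symmetric_gen_def
    using assms by (simp only: TV.quot_mult[OF symmetric_ideal] tensor_gen_closed,
      subst TV.quot_eq_iff[OF symmetric_ideal])
      (auto simp: commutator_def intro!: TV.m_closed tensor_gen_closed)
qed

end

text \<open>The common features of the tensor and the symmetric algebra: an algebra with
  \<open>G\<close>-action, generated by the image of an equivariant linear map \<open>gn\<close> on
  \<open>VV\<close>. The commutation rules with \<open>G\<close> follow from this for both at
  once.\<close>

locale semidirect_generators =
  cherednik_datum scale G \<rho> \<phi> \<alpha> \<alpha>v t c + AV: finite_algebra_action B "\<phi> 1" G actB
  for scale :: "'k::field \<Rightarrow> 'v::ab_group_add \<Rightarrow> 'v"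
    and G :: "('g, 'm) monoid_scheme" (structure)
    and \<rho> :: "'g \<Rightarrow> 'v \<Rightarrow> 'v"
    and \<phi> :: "'k \<Rightarrow> 'r::comm_ring"
    and \<alpha> \<alpha>v t c
    and B :: "('r, 'b) module" and actB +
  fixes gn :: "'v \<times> ('v \<Rightarrow> 'k) \<Rightarrow> 'b"
  assumes gn_closed: "w \<in> W \<Longrightarrow> gn w \<in> carrier B"
    and gn_act: "g \<in> carrier G \<Longrightarrow> w \<in> W \<Longrightarrow> actB g (gn w) = gn (VV_act g w)"
    and gn_add: "w \<in> W \<Longrightarrow> w' \<in> W \<Longrightarrow> gn (w \<oplus>\<^bsub>VV\<^esub> w') = gn w \<oplus>\<^bsub>B\<^esub> gn w'"
    and gn_smult: "w \<in> W \<Longrightarrow> gn (a \<odot>\<^bsub>VV\<^esub> w) = \<phi> a \<odot>\<^bsub>B\<^esub> gn w"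
    and gn_generates: "generates B (gn ` W)"
begin

definition V_el :: "'v \<Rightarrow> 'g \<Rightarrow> 'b" where "V_el y = AV.el (gn (y, \<lambda>v. 0)) \<one>"
definition dual_el :: "('v \<Rightarrow> 'k) \<Rightarrow> 'g \<Rightarrow> 'b" where "dual_el x = AV.el (gn (0, x)) \<one>"
definition G_el :: "'g \<Rightarrow> 'g \<Rightarrow> 'b" where "G_el g = AV.el \<one>\<^bsub>B\<^esub> g"

lemma inW: "(y, \<lambda>v. 0) \<in> W" "x \<in> dual_space \<Longrightarrow> (0, x) \<in> W"
  by (simp_all add: in_W)

lemma el_closed: "V_el y \<in> carrier AV.AG" "x \<in> dual_space \<Longrightarrow> dual_el x \<in> carrier AV.AG"
    "G_el g \<in> carrier AV.AG"
  unfolding V_el_def dual_el_def G_el_def by (intro AV.el_closed gn_closed inW AV.one_closed; assumption)+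

lemma V_el_add: "V_el (y + y') = V_el y \<oplus>\<^bsub>AV.AG\<^esub> V_el y'"
  using gn_add[OF inW(1)[of y] inW(1)[of y']]
  by (simp add: V_el_def AV.el_add gn_closed inW VV_add)

lemma V_el_scale: "V_el (scale a y) = \<phi> a \<odot>\<^bsub>AV.AG\<^esub> V_el y"
  using gn_smult[OF inW(1)[of y], of a]
  by (simp add: V_el_def AV.el_smult gn_closed inW VV_smult)

lemma dual_el_add:
  "x \<in> dual_space \<Longrightarrow> x' \<in> dual_space \<Longrightarrow> dual_el (\<lambda>v. x v + x' v) = dual_el x \<oplus>\<^bsub>AV.AG\<^esub> dual_el x'"
  using gn_add[OF inW(2)[of x] inW(2)[of x']]
  by (simp add: dual_el_def AV.el_add gn_closed inW VV_add)

lemma dual_el_scale: "x \<in> dual_space \<Longrightarrow> dual_el (\<lambda>v. a * x v) = \<phi> a \<odot>\<^bsub>AV.AG\<^esub> dual_el x"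
  using gn_smult[OF inW(2)[of x], of a]
  by (simp add: dual_el_def AV.el_smult gn_closed inW VV_smult)

lemma G_el_one: "G_el \<one> = \<one>\<^bsub>AV.AG\<^esub>"
  by (simp add: G_el_def AV.one_eq_el)

lemma G_el_mult: "g \<in> carrier G \<Longrightarrow> h \<in> carrier G \<Longrightarrow> G_el g \<otimes>\<^bsub>AV.AG\<^esub> G_el h = G_el (g \<otimes> h)"
  by (simp add: G_el_def AV.el_mult)

lemma G_el_gn:
  assumes "g \<in> carrier G" "w \<in> W"
  shows "AV.el \<one>\<^bsub>B\<^esub> g \<otimes>\<^bsub>AV.AG\<^esub> AV.el (gn w) \<one> = AV.el (gn (VV_act g w)) \<one> \<otimes>\<^bsub>AV.AG\<^esub> AV.el \<one>\<^bsub>B\<^esub> g"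
  using assms by (simp add: AV.el_mult gn_closed gn_act VV_act_closed AV.act_one)

lemma G_el_V: "g \<in> carrier G \<Longrightarrow> G_el g \<otimes>\<^bsub>AV.AG\<^esub> V_el y = V_el (\<rho> g y) \<otimes>\<^bsub>AV.AG\<^esub> G_el g"
  using G_el_gn[of g "(y, \<lambda>v. 0)"] by (simp add: V_el_def G_el_def inW VV_act_apply)

lemma rep_zero: "g \<in> carrier G \<Longrightarrow> \<rho> g 0 = 0"
  using rep_add[of g 0 0] by simp

lemma G_el_dual: "g \<in> carrier G \<Longrightarrow> x \<in> dual_space \<Longrightarrow>
    G_el g \<otimes>\<^bsub>AV.AG\<^esub> dual_el x = dual_el (\<lambda>v. x (\<rho> (inv g) v)) \<otimes>\<^bsub>AV.AG\<^esub> G_el g"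
  using G_el_gn[of g "(0, x)"] by (simp add: dual_el_def G_el_def inW VV_act_apply rep_zero)

text \<open>The generators come as sums because \<open>gn\<close> takes pairs, and
  \<open>gn (y, x)\<close> splits into a vector and a linear form.\<close>

lemma el_generates:
  "generates AV.AG ({V_el y \<oplus>\<^bsub>AV.AG\<^esub> dual_el x | y x. x \<in> dual_space} \<union> G_el ` carrier G)"
proof -
  have "AV.el (gn w) \<one> = V_el (fst w) \<oplus>\<^bsub>AV.AG\<^esub> dual_el (snd w)" if "w \<in> W" for w
    using gn_add[OF inW(1)[of "fst w"] inW(2)[of "snd w"]] that
    by (simp add: V_el_def dual_el_def AV.el_add gn_closed inW VV_add in_W)
  then have "(\<lambda>w. AV.el (gn w) \<one>) ` W = (\<lambda>w. V_el (fst w) \<oplus>\<^bsub>AV.AG\<^esub> dual_el (snd w)) ` W"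
    by (intro image_cong) auto
  also have "\<dots> = {V_el y \<oplus>\<^bsub>AV.AG\<^esub> dual_el x | y x. x \<in> dual_space}"
    by (auto simp: VV_def image_iff) blast+
  finally show ?thesis
    using AV.semidirect_generates[OF gn_generates] by (simp add: image_image G_el_def[abs_def])
qed

end

text \<open>The presentation of \<open>H_{t,c}\<close>, imposed on elements of an arbitrary algebra.
  That the monomials span follows from these axioms alone. Both algebras in the PBW morphism are
  instances, the semidirect product with the symmetric algebra for \<open>t = 0\<close> and
  \<open>c = 0\<close>.\<close>

locale cherednik_relations =
  cherednik_datum scale G \<rho> \<phi> \<alpha> \<alpha>v t c + A: unital_algebra A "\<phi> 1"
  for scale :: "'k::field \<Rightarrow> 'v::ab_group_add \<Rightarrow> 'v"
    and G :: "('g, 'm) monoid_scheme" (structure)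
    and \<rho> :: "'g \<Rightarrow> 'v \<Rightarrow> 'v"
    and \<phi> :: "'k \<Rightarrow> 'r::comm_ring"
    and \<alpha> \<alpha>v t c
    and A :: "('r, 'a) module" +
  fixes X :: "('v \<Rightarrow> 'k) \<Rightarrow> 'a" and Y :: "'v \<Rightarrow> 'a" and \<Gamma> :: "'g \<Rightarrow> 'a"
  assumes X_closed [simp]: "x \<in> dual_space \<Longrightarrow> X x \<in> carrier A"
    and Y_closed [simp]: "Y y \<in> carrier A"
    and \<Gamma>_closed [simp]: "g \<in> carrier G \<Longrightarrow> \<Gamma> g \<in> carrier A"
    and X_add: "x \<in> dual_space \<Longrightarrow> x' \<in> dual_space \<Longrightarrow> X (\<lambda>v. x v + x' v) = X x \<oplus>\<^bsub>A\<^esub> X x'"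
    and X_scale: "x \<in> dual_space \<Longrightarrow> X (\<lambda>v. a * x v) = \<phi> a \<odot>\<^bsub>A\<^esub> X x"
    and Y_add: "Y (y + y') = Y y \<oplus>\<^bsub>A\<^esub> Y y'"
    and Y_scale: "Y (scale a y) = \<phi> a \<odot>\<^bsub>A\<^esub> Y y"
    and \<Gamma>_one: "\<Gamma> \<one> = \<one>\<^bsub>A\<^esub>"
    and \<Gamma>_mult: "g \<in> carrier G \<Longrightarrow> h \<in> carrier G \<Longrightarrow> \<Gamma> g \<otimes>\<^bsub>A\<^esub> \<Gamma> h = \<Gamma> (g \<otimes> h)"
    and \<Gamma>_X: "g \<in> carrier G \<Longrightarrow> x \<in> dual_space \<Longrightarrow>
      \<Gamma> g \<otimes>\<^bsub>A\<^esub> X x = X (\<lambda>v. x (\<rho> (inv g) v)) \<otimes>\<^bsub>A\<^esub> \<Gamma> g"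
    and \<Gamma>_Y: "g \<in> carrier G \<Longrightarrow> \<Gamma> g \<otimes>\<^bsub>A\<^esub> Y y = Y (\<rho> g y) \<otimes>\<^bsub>A\<^esub> \<Gamma> g"
    and X_commute: "x \<in> dual_space \<Longrightarrow> x' \<in> dual_space \<Longrightarrow> X x \<otimes>\<^bsub>A\<^esub> X x' = X x' \<otimes>\<^bsub>A\<^esub> X x"
    and Y_commute: "Y y \<otimes>\<^bsub>A\<^esub> Y y' = Y y' \<otimes>\<^bsub>A\<^esub> Y y"
    and Y_X: "x \<in> dual_space \<Longrightarrow> Y y \<otimes>\<^bsub>A\<^esub> X x = X x \<otimes>\<^bsub>A\<^esub> Y y \<oplus>\<^bsub>A\<^esub>
      ((t * \<phi> (x y)) \<odot>\<^bsub>A\<^esub> \<one>\<^bsub>A\<^esub> \<oplus>\<^bsub>A\<^esub>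
        (\<Oplus>\<^bsub>A\<^esub>s\<in>reflections. (\<phi> (pairing s y x) * c (conj_class G s)) \<odot>\<^bsub>A\<^esub> \<Gamma> s))"
    and generated: "generates A ({Y y \<oplus>\<^bsub>A\<^esub> X x | y x. x \<in> dual_space} \<union> \<Gamma> ` carrier G)"

section \<open>Both algebras satisfy the relations\<close>

context cherednik_datum
begin

lemma reflections_closed: "s \<in> reflections \<Longrightarrow> s \<in> carrier G"
  and finite_reflections: "finite reflections"
  using finite_group by (auto simp: reflections_def)

lemma T_generators: "semidirect_generators scale G \<rho> \<phi> \<alpha> \<alpha>v T tensor_act (tensor_gen \<phi> VV)"
  by (intro semidirect_generators.intro semidirect_generators_axioms.intro cherednik_datum_axioms
      TV.finite_algebra_action_axioms tensor_gen_closed tensor_act_gen tensor_gen_linear tensor_generates)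

lemma S_generators: "semidirect_generators scale G \<rho> \<phi> \<alpha> \<alpha>v S symmetric_act (symmetric_gen \<phi> VV)"
  by (intro semidirect_generators.intro semidirect_generators_axioms.intro cherednik_datum_axioms
      SV.finite_algebra_action_axioms symmetric_gen_closed symmetric_act_gen symmetric_gen_linear
      symmetric_generates)

sublocale TS: semidirect_generators scale G \<rho> \<phi> \<alpha> \<alpha>v t c T tensor_act "tensor_gen \<phi> VV"
  by (rule T_generators)

sublocale SS: semidirect_generators scale G \<rho> \<phi> \<alpha> \<alpha>v t c S symmetric_act "symmetric_gen \<phi> VV"
  by (rule S_generators)

lemma T_el_eq: "TS.V_el = tensor_V" "TS.dual_el = tensor_dual" "TS.G_el = tensor_G"
  by (simp_all add: fun_eq_iff TS.V_el_def TS.dual_el_def TS.G_el_def tensor_V_def tensor_dual_def tensor_G_def)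

lemma S_el_eq: "SS.V_el = symmetric_V" "SS.dual_el = symmetric_dual" "SS.G_el = symmetric_G"
  by (simp_all add: fun_eq_iff SS.V_el_def SS.dual_el_def SS.G_el_def symmetric_V_def symmetric_dual_def
      symmetric_G_def)

lemma symmetric_relations:
  "cherednik_relations scale G \<rho> \<phi> \<alpha> \<alpha>v 0 (\<lambda>_. 0) symmetric_semidirect symmetric_dual symmetric_V symmetric_G"
proof -
  have comm: "SV.el (symmetric_gen \<phi> VV w) \<one> \<otimes>\<^bsub>SV.AG\<^esub> SV.el (symmetric_gen \<phi> VV w') \<one> =
      SV.el (symmetric_gen \<phi> VV w') \<one> \<otimes>\<^bsub>SV.AG\<^esub> SV.el (symmetric_gen \<phi> VV w) \<one>"
    if "w \<in> W" "w' \<in> W" for w w'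
    using that by (simp add: SV.el_mult symmetric_gen_closed SV.act_one symmetric_gen_commute[of w w'])
  show ?thesis
    unfolding symmetric_semidirect_def S_el_eq[symmetric]
  proof (intro cherednik_relations.intro cherednik_relations_axioms.intro cherednik_datum_axioms
      SV.semidirect_unital_algebra SS.el_closed SS.dual_el_add SS.dual_el_scale SS.V_el_add SS.V_el_scale
      SS.G_el_one SS.G_el_mult SS.G_el_dual SS.G_el_V SS.el_generates)
    fix x :: "'v \<Rightarrow> 'k" and y assume x: "x \<in> dual_space"
    \<comment> \<open>For zero parameters every term of the right-hand side vanishes, and
      \<open>Y_X\<close> reduces to commutativity in the symmetric algebra.\<close>
    have "(\<Oplus>\<^bsub>SV.AG\<^esub>s\<in>reflections. (\<phi> (pairing s y x) * 0) \<odot>\<^bsub>SV.AG\<^esub> SS.G_el s) = \<zero>\<^bsub>SV.AG\<^esub>"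
      by (rule SV.AG.add.finprod_one_eqI) (simp only: mult_zero_right SV.AG.zero_smult SS.el_closed)
    then show "SS.V_el y \<otimes>\<^bsub>SV.AG\<^esub> SS.dual_el x = SS.dual_el x \<otimes>\<^bsub>SV.AG\<^esub> SS.V_el y \<oplus>\<^bsub>SV.AG\<^esub>
      ((0 * \<phi> (x y)) \<odot>\<^bsub>SV.AG\<^esub> \<one>\<^bsub>SV.AG\<^esub> \<oplus>\<^bsub>SV.AG\<^esub>
        (\<Oplus>\<^bsub>SV.AG\<^esub>s\<in>reflections. (\<phi> (pairing s y x) * 0) \<odot>\<^bsub>SV.AG\<^esub> SS.G_el s))"
      using comm[OF SS.inW(1)[of y] SS.inW(2)[OF x]] SS.el_closed(1)[of y] SS.el_closed(2)[OF x]
      unfolding SS.V_el_def[symmetric] SS.dual_el_def[symmetric]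
      by (simp add: SV.AG.zero_smult)
  qed (use comm SS.inW in \<open>simp_all add: SS.V_el_def SS.dual_el_def\<close>)
qed

definition cherednik_rels :: "('g \<Rightarrow> (('v \<times> ('v \<Rightarrow> 'k)) list \<Rightarrow> 'r) set) set"
  where "cherednik_rels =
    {commutator TV.AG (tensor_dual x) (tensor_dual x') | x x'. x \<in> dual_space \<and> x' \<in> dual_space} \<union>
    {commutator TV.AG (tensor_V y) (tensor_V y') | y y'. True} \<union>
    {commutator TV.AG (tensor_V y) (tensor_dual x) \<ominus>\<^bsub>TV.AG\<^esub> cherednik_rhs y x | y x. x \<in> dual_space}"

lemma cherednik_ideal_eq: "cherednik_ideal = Idl\<^bsub>TV.AG\<^esub> cherednik_rels"
  by (simp add: cherednik_ideal_def cherednik_rels_def tensor_semidirect_def Let_def)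

lemma tensor_el_closed:
  "tensor_V y \<in> carrier TV.AG" "x \<in> dual_space \<Longrightarrow> tensor_dual x \<in> carrier TV.AG"
  "tensor_G g \<in> carrier TV.AG"
  using TS.el_closed unfolding T_el_eq by blast+

lemma cherednik_rhs_eq: "cherednik_rhs y x = (t * \<phi> (x y)) \<odot>\<^bsub>TV.AG\<^esub> \<one>\<^bsub>TV.AG\<^esub> \<oplus>\<^bsub>TV.AG\<^esub>
    (\<Oplus>\<^bsub>TV.AG\<^esub>s\<in>reflections. (\<phi> (pairing s y x) * c (conj_class G s)) \<odot>\<^bsub>TV.AG\<^esub> tensor_G s)"
  by (simp add: cherednik_rhs_def tensor_semidirect_def Let_def)

lemma cherednik_rhs_closed: "cherednik_rhs y x \<in> carrier TV.AG"
  unfolding cherednik_rhs_eq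
  by (intro TV.AG.a_closed TV.AG.smult_closed TV.AG.one_closed TV.AG.finsum_closed Pi_I tensor_el_closed)

lemma cherednik_rels_closed: "cherednik_rels \<subseteq> carrier TV.AG"
  unfolding cherednik_rels_def commutator_def
  by (auto intro!: TV.AG.minus_closed TV.AG.m_closed tensor_el_closed cherednik_rhs_closed)

lemma cherednik_ideal: "ideal cherednik_ideal TV.AG"
  unfolding cherednik_ideal_eq by (rule TV.AG.genideal_ideal[OF cherednik_rels_closed])

lemma cherednik_algebra_eq: "cherednik_algebra = quot_algebra TV.AG cherednik_ideal"
  by (simp add: cherednik_algebra_def tensor_semidirect_def)

lemma cherednik_el_eq: "cherednik_V y = cherednik_ideal +>\<^bsub>TV.AG\<^esub> TS.V_el y"
    "cherednik_dual x = cherednik_ideal +>\<^bsub>TV.AG\<^esub> TS.dual_el x"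
    "cherednik_G g = cherednik_ideal +>\<^bsub>TV.AG\<^esub> TS.G_el g"
  by (simp_all add: cherednik_V_def cherednik_dual_def cherednik_G_def tensor_semidirect_def T_el_eq)

lemma cherednik_algebra_relations:
  "cherednik_relations scale G \<rho> \<phi> \<alpha> \<alpha>v t c cherednik_algebra cherednik_dual cherednik_V cherednik_G"
proof -
  note I = cherednik_ideal
  have rels: "a \<in> cherednik_rels \<Longrightarrow> a \<in> cherednik_ideal" for a
    unfolding cherednik_ideal_eq using TV.AG.genideal_self[OF cherednik_rels_closed] by blast
  note simps = TV.AG.quot_add[OF I] TV.AG.quot_smult[OF I] TV.AG.quot_mult[OF I] TS.el_closed
    TV.AG.m_closed TV.AG.a_closed TV.AG.smult_closed dual_action inv_closed
  have "cherednik_V y \<oplus>\<^bsub>quot_algebra TV.AG cherednik_ideal\<^esub> cherednik_dual x =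
      cherednik_ideal +>\<^bsub>TV.AG\<^esub> (TS.V_el y \<oplus>\<^bsub>TV.AG\<^esub> TS.dual_el x)" if "x \<in> dual_space" for x y
    using that by (simp only: cherednik_el_eq simps)
  then have "{cherednik_V y \<oplus>\<^bsub>quot_algebra TV.AG cherednik_ideal\<^esub> cherednik_dual x | y x. x \<in> dual_space} \<union>
      cherednik_G ` carrier G = (\<lambda>a. cherednik_ideal +>\<^bsub>TV.AG\<^esub> a) `
        ({TS.V_el y \<oplus>\<^bsub>TV.AG\<^esub> TS.dual_el x | y x. x \<in> dual_space} \<union> TS.G_el ` carrier G)"
    by (auto simp: image_Un image_image cherednik_el_eq(3)) blast+
  then have gen: "generates (quot_algebra TV.AG cherednik_ideal)
      ({cherednik_V y \<oplus>\<^bsub>quot_algebra TV.AG cherednik_ideal\<^esub> cherednik_dual x | y x. x \<in> dual_space} \<union>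
        cherednik_G ` carrier G)"
    using TV.AG.quot_generates[OF I TS.el_generates] by (simp only:)
  show ?thesis
    unfolding cherednik_algebra_eq
  proof (intro cherednik_relations.intro cherednik_relations_axioms.intro cherednik_datum_axioms
      TV.AG.quot_unital_algebra I gen; (unfold cherednik_el_eq)?)
    fix x x' :: "'v \<Rightarrow> 'k" and a assume x: "x \<in> dual_space"
    show "cherednik_ideal +>\<^bsub>TV.AG\<^esub> TS.dual_el x \<in> carrier (quot_algebra TV.AG cherednik_ideal)"
      using x by (simp only: TV.AG.quot_closed[OF I] TS.el_closed)
    show "cherednik_ideal +>\<^bsub>TV.AG\<^esub> TS.dual_el (\<lambda>v. a * x v) =
        \<phi> a \<odot>\<^bsub>quot_algebra TV.AG cherednik_ideal\<^esub> (cherednik_ideal +>\<^bsub>TV.AG\<^esub> TS.dual_el x)"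
      using x by (simp only: simps TS.dual_el_scale)
    assume x': "x' \<in> dual_space"
    show "cherednik_ideal +>\<^bsub>TV.AG\<^esub> TS.dual_el (\<lambda>v. x v + x' v) =
        (cherednik_ideal +>\<^bsub>TV.AG\<^esub> TS.dual_el x) \<oplus>\<^bsub>quot_algebra TV.AG cherednik_ideal\<^esub>
        (cherednik_ideal +>\<^bsub>TV.AG\<^esub> TS.dual_el x')"
      using x x' by (simp only: simps TS.dual_el_add)
    have "commutator TV.AG (tensor_dual x) (tensor_dual x') \<in> cherednik_ideal"
      using x x' by (intro rels) (unfold cherednik_rels_def, blast)
    then show "(cherednik_ideal +>\<^bsub>TV.AG\<^esub> TS.dual_el x) \<otimes>\<^bsub>quot_algebra TV.AG cherednik_ideal\<^esub>
        (cherednik_ideal +>\<^bsub>TV.AG\<^esub> TS.dual_el x') =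
        (cherednik_ideal +>\<^bsub>TV.AG\<^esub> TS.dual_el x') \<otimes>\<^bsub>quot_algebra TV.AG cherednik_ideal\<^esub>
        (cherednik_ideal +>\<^bsub>TV.AG\<^esub> TS.dual_el x)"
      using x x' by (simp only: simps TV.AG.quot_eq_iff[OF I] commutator_def T_el_eq[symmetric])
  next
    fix y y' :: 'v and a
    show "cherednik_ideal +>\<^bsub>TV.AG\<^esub> TS.V_el y \<in> carrier (quot_algebra TV.AG cherednik_ideal)"
      by (simp only: TV.AG.quot_closed[OF I] TS.el_closed)
    show "cherednik_ideal +>\<^bsub>TV.AG\<^esub> TS.V_el (scale a y) =
        \<phi> a \<odot>\<^bsub>quot_algebra TV.AG cherednik_ideal\<^esub> (cherednik_ideal +>\<^bsub>TV.AG\<^esub> TS.V_el y)"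
      by (simp only: simps TS.V_el_scale)
    show "cherednik_ideal +>\<^bsub>TV.AG\<^esub> TS.V_el (y + y') =
        (cherednik_ideal +>\<^bsub>TV.AG\<^esub> TS.V_el y) \<oplus>\<^bsub>quot_algebra TV.AG cherednik_ideal\<^esub>
        (cherednik_ideal +>\<^bsub>TV.AG\<^esub> TS.V_el y')"
      by (simp only: simps TS.V_el_add)
    have "commutator TV.AG (tensor_V y) (tensor_V y') \<in> cherednik_ideal"
      by (intro rels) (unfold cherednik_rels_def, blast)
    then show "(cherednik_ideal +>\<^bsub>TV.AG\<^esub> TS.V_el y) \<otimes>\<^bsub>quot_algebra TV.AG cherednik_ideal\<^esub>
        (cherednik_ideal +>\<^bsub>TV.AG\<^esub> TS.V_el y') =
        (cherednik_ideal +>\<^bsub>TV.AG\<^esub> TS.V_el y') \<otimes>\<^bsub>quot_algebra TV.AG cherednik_ideal\<^esub>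
        (cherednik_ideal +>\<^bsub>TV.AG\<^esub> TS.V_el y)"
      by (simp only: simps TV.AG.quot_eq_iff[OF I] commutator_def T_el_eq[symmetric])
  next
    fix g h assume g: "g \<in> carrier G"
    show "cherednik_ideal +>\<^bsub>TV.AG\<^esub> TS.G_el g \<in> carrier (quot_algebra TV.AG cherednik_ideal)"
      by (simp only: TV.AG.quot_closed[OF I] TS.el_closed)
    fix y
    show "(cherednik_ideal +>\<^bsub>TV.AG\<^esub> TS.G_el g) \<otimes>\<^bsub>quot_algebra TV.AG cherednik_ideal\<^esub>
        (cherednik_ideal +>\<^bsub>TV.AG\<^esub> TS.V_el y) =
        (cherednik_ideal +>\<^bsub>TV.AG\<^esub> TS.V_el (\<rho> g y)) \<otimes>\<^bsub>quot_algebra TV.AG cherednik_ideal\<^esub>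
        (cherednik_ideal +>\<^bsub>TV.AG\<^esub> TS.G_el g)"
      using g by (simp only: simps TS.G_el_V)
    assume h: "h \<in> carrier G"
    show "(cherednik_ideal +>\<^bsub>TV.AG\<^esub> TS.G_el g) \<otimes>\<^bsub>quot_algebra TV.AG cherednik_ideal\<^esub>
        (cherednik_ideal +>\<^bsub>TV.AG\<^esub> TS.G_el h) = cherednik_ideal +>\<^bsub>TV.AG\<^esub> TS.G_el (g \<otimes> h)"
      using g h by (simp only: simps TS.G_el_mult)
  next
    show "cherednik_ideal +>\<^bsub>TV.AG\<^esub> TS.G_el \<one> = \<one>\<^bsub>quot_algebra TV.AG cherednik_ideal\<^esub>"
      by (simp only: TS.G_el_one quot_algebra_sel(3))
    fix g x assume g: "g \<in> carrier G" and x: "x \<in> dual_space"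
    show "(cherednik_ideal +>\<^bsub>TV.AG\<^esub> TS.G_el g) \<otimes>\<^bsub>quot_algebra TV.AG cherednik_ideal\<^esub>
        (cherednik_ideal +>\<^bsub>TV.AG\<^esub> TS.dual_el x) =
        (cherednik_ideal +>\<^bsub>TV.AG\<^esub> TS.dual_el (\<lambda>v. x (\<rho> (inv g) v))) \<otimes>\<^bsub>quot_algebra TV.AG cherednik_ideal\<^esub>
        (cherednik_ideal +>\<^bsub>TV.AG\<^esub> TS.G_el g)"
      using g x by (simp only: simps TS.G_el_dual inv_closed)
  next
    fix x y assume x: "x \<in> dual_space"
    have "commutator TV.AG (tensor_V y) (tensor_dual x) \<ominus>\<^bsub>TV.AG\<^esub> cherednik_rhs y x \<in> cherednik_ideal"
      using x by (intro rels) (unfold cherednik_rels_def, blast)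
    \<comment> \<open>Regrouping turns membership of \<open>[y, x] - rhs\<close> in the ideal into
      equality of the cosets of \<open>y x\<close> and \<open>x y + rhs\<close>.\<close>
    moreover have "commutator TV.AG (tensor_V y) (tensor_dual x) \<ominus>\<^bsub>TV.AG\<^esub> cherednik_rhs y x =
      tensor_V y \<otimes>\<^bsub>TV.AG\<^esub> tensor_dual x \<ominus>\<^bsub>TV.AG\<^esub> (tensor_dual x \<otimes>\<^bsub>TV.AG\<^esub> tensor_V y \<oplus>\<^bsub>TV.AG\<^esub> cherednik_rhs y x)"
      using tensor_el_closed(1)[of y] tensor_el_closed(2)[OF x] cherednik_rhs_closed[of y x]
      by (simp add: commutator_def TV.AG.minus_eq TV.AG.minus_add TV.AG.a_assoc)
    ultimately have *: "cherednik_ideal +>\<^bsub>TV.AG\<^esub> (TS.V_el y \<otimes>\<^bsub>TV.AG\<^esub> TS.dual_el x) =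
        cherednik_ideal +>\<^bsub>TV.AG\<^esub> (TS.dual_el x \<otimes>\<^bsub>TV.AG\<^esub> TS.V_el y \<oplus>\<^bsub>TV.AG\<^esub> cherednik_rhs y x)"
      using x by (simp only: TV.AG.quot_eq_iff[OF I] T_el_eq tensor_el_closed cherednik_rhs_closed
        TV.AG.m_closed TV.AG.a_closed)
    have fin: "(\<Oplus>\<^bsub>quot_algebra TV.AG cherednik_ideal\<^esub>s\<in>reflections. cherednik_ideal +>\<^bsub>TV.AG\<^esub>
          ((\<phi> (pairing s y x) * c (conj_class G s)) \<odot>\<^bsub>TV.AG\<^esub> TS.G_el s)) =
        cherednik_ideal +>\<^bsub>TV.AG\<^esub> (\<Oplus>\<^bsub>TV.AG\<^esub>s\<in>reflections.
          (\<phi> (pairing s y x) * c (conj_class G s)) \<odot>\<^bsub>TV.AG\<^esub> TS.G_el s)"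
      by (rule TV.AG.quot_finsum[OF I finite_reflections]) (intro TV.AG.smult_closed TS.el_closed)
    show "(cherednik_ideal +>\<^bsub>TV.AG\<^esub> TS.V_el y) \<otimes>\<^bsub>quot_algebra TV.AG cherednik_ideal\<^esub>
        (cherednik_ideal +>\<^bsub>TV.AG\<^esub> TS.dual_el x) =
        (cherednik_ideal +>\<^bsub>TV.AG\<^esub> TS.dual_el x) \<otimes>\<^bsub>quot_algebra TV.AG cherednik_ideal\<^esub>
        (cherednik_ideal +>\<^bsub>TV.AG\<^esub> TS.V_el y) \<oplus>\<^bsub>quot_algebra TV.AG cherednik_ideal\<^esub>
        ((t * \<phi> (x y)) \<odot>\<^bsub>quot_algebra TV.AG cherednik_ideal\<^esub> \<one>\<^bsub>quot_algebra TV.AG cherednik_ideal\<^esub>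
        \<oplus>\<^bsub>quot_algebra TV.AG cherednik_ideal\<^esub> (\<Oplus>\<^bsub>quot_algebra TV.AG cherednik_ideal\<^esub>s\<in>reflections.
          (\<phi> (pairing s y x) * c (conj_class G s)) \<odot>\<^bsub>quot_algebra TV.AG cherednik_ideal\<^esub>
          (cherednik_ideal +>\<^bsub>TV.AG\<^esub> TS.G_el s)))"
      using x by (simp only: simps fin * quot_algebra_sel(3) TV.AG.one_closed cherednik_rhs_eq
          T_el_eq[symmetric] TV.AG.finsum_closed Pi_I)
  qed
qed

end

section \<open>Bases\<close>

context unital_algebra
begin

text \<open>The span is given by closure rules rather than finite sums, so that products can be
  expanded by rule induction; \<open>lspan_eq_lin_comb\<close> returns to coordinates.\<close>

inductive_set lspan :: "'a set \<Rightarrow> 'a set" for E where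
  base: "e \<in> E \<Longrightarrow> e \<in> lspan E"
| zero: "\<zero> \<in> lspan E"
| add: "a \<in> lspan E \<Longrightarrow> b \<in> lspan E \<Longrightarrow> a \<oplus> b \<in> lspan E"
| smult: "a \<in> lspan E \<Longrightarrow> r \<odot> a \<in> lspan E"

lemma lspan_closed: "E \<subseteq> carrier A \<Longrightarrow> a \<in> lspan E \<Longrightarrow> a \<in> carrier A"
  by (erule lspan.induct) auto

lemma lspan_mono:
  assumes "E \<subseteq> E'" "a \<in> lspan E"
  shows "a \<in> lspan E'"
  using assms(2)
proof (induction a)
  case (base e)
  show ?case by (rule lspan.base[OF subsetD[OF assms(1) base]])
next
  case (add a b)
  show ?case by (rule lspan.add[OF add(3,4)])
next
  case (smult a r)
  show ?case by (rule lspan.smult[OF smult(2)])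
qed (rule lspan.zero)

lemma lspan_mult:
  assumes E: "E \<subseteq> carrier A" "E' \<subseteq> carrier A" "E'' \<subseteq> carrier A"
    and base: "\<And>e e'. e \<in> E \<Longrightarrow> e' \<in> E' \<Longrightarrow> e \<otimes> e' \<in> lspan E''"
    and a: "a \<in> lspan E" and b: "b \<in> lspan E'"
  shows "a \<otimes> b \<in> lspan E''"
  using a
proof (induction a)
  case (base e)
  then have e: "e \<in> carrier A" using E by blast
  show ?case using b
  proof (induction b)
    case (base e')
    then show ?case using assms(4)[OF \<open>e \<in> E\<close>] by blast
  next
    case zero
    then show ?case using e by (simp add: lspan.zero)
  next
    case (add a b)
    then show ?case using e lspan_closed[OF E(2)] by (simp add: r_distr lspan.add)
  next
    case (smult a r)
    then show ?case using e lspan_closed[OF E(2)] by (simp add: smult_mult_right lspan.smult)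
  qed
next
  case zero
  then show ?case using lspan_closed[OF E(2) b] by (simp add: lspan.zero)
next
  case (add a a')
  then show ?case using lspan_closed[OF E(1)] lspan_closed[OF E(2) b] by (simp add: l_distr lspan.add)
next
  case (smult a r)
  then show ?case using lspan_closed[OF E(1)] lspan_closed[OF E(2) b]
    by (simp add: smult_mult_left lspan.smult)
qed

definition lin_comb :: "('i \<Rightarrow> 'a) \<Rightarrow> ('i \<Rightarrow> 'r) \<Rightarrow> 'a"
  where "lin_comb b a = (\<Oplus>i\<in>{i. a i \<noteq> 0}. a i \<odot> b i)"

lemma lin_comb_eq:
  assumes "finite F" "{i. a i \<noteq> 0} \<subseteq> F" "\<And>i. i \<in> F \<Longrightarrow> b i \<in> carrier A"
  shows "lin_comb b a = (\<Oplus>i\<in>F. a i \<odot> b i)"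
  unfolding lin_comb_def
  by (rule add.finprod_mono_neutral_cong_left[OF assms(1,2)]) (use assms(2,3) in auto)

end

text \<open>The free module on \<open>J\<close>. With total functions of finite support in place of
  the pairs \<open>F\<close>, \<open>a\<close> of \<open>is_basis\<close>, coordinates become unique
  and add pointwise.\<close>

definition coords :: "'i set \<Rightarrow> ('i \<Rightarrow> 'r::comm_ring) set"
  where "coords J = {a. finite {i. a i \<noteq> 0} \<and> {i. a i \<noteq> 0} \<subseteq> J}"

lemma coords_add: "a \<in> coords J \<Longrightarrow> a' \<in> coords J \<Longrightarrow> (\<lambda>i. a i + a' i) \<in> coords J"
proof -
  assume a: "a \<in> coords J" "a' \<in> coords J"
  have sub: "{i. a i + a' i \<noteq> 0} \<subseteq> {i. a i \<noteq> 0} \<union> {i. a' i \<noteq> 0}" by auto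
  have "finite {i. a i + a' i \<noteq> 0}" by (rule finite_subset[OF sub]) (use a in \<open>auto simp: coords_def\<close>)
  then show ?thesis using sub a by (auto simp: coords_def)
qed

lemma coords_smult: "a \<in> coords J \<Longrightarrow> (\<lambda>i. r * a i) \<in> coords J"
proof -
  assume a: "a \<in> coords J"
  have sub: "{i. r * a i \<noteq> 0} \<subseteq> {i. a i \<noteq> 0}" by auto
  have "finite {i. r * a i \<noteq> 0}" by (rule finite_subset[OF sub]) (use a in \<open>auto simp: coords_def\<close>)
  then show ?thesis using sub a by (auto simp: coords_def)
qed

lemma coords_uminus: "a \<in> coords J \<Longrightarrow> (\<lambda>i. - a i) \<in> coords J"
  by (simp add: coords_def)

context unital_algebra
begin

context
  fixes J :: "'i set" and b
  assumes b: "\<And>j. j \<in> J \<Longrightarrow> b j \<in> carrier A"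
begin

lemma lin_comb_closed: "a \<in> coords J \<Longrightarrow> lin_comb b a \<in> carrier A"
  unfolding lin_comb_def coords_def using b by (intro finsum_closed) auto

lemma lin_comb_add:
  assumes a: "a \<in> coords J" "a' \<in> coords J"
  shows "lin_comb b (\<lambda>i. a i + a' i) = lin_comb b a \<oplus> lin_comb b a'"
proof -
  let ?F = "{i. a i \<noteq> 0} \<union> {i. a' i \<noteq> 0}"
  have F: "finite ?F" "?F \<subseteq> J" using a by (auto simp: coords_def)
  have bF: "b i \<in> carrier A" if "i \<in> ?F" for i using F b that by blast
  have "lin_comb b (\<lambda>i. a i + a' i) = (\<Oplus>i\<in>?F. (a i + a' i) \<odot> b i)"
    by (rule lin_comb_eq[OF F(1) _ bF]) auto
  also have "\<dots> = (\<Oplus>i\<in>?F. a i \<odot> b i \<oplus> a' i \<odot> b i)"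
    by (rule finsum_cong') (use bF in \<open>auto simp: smult_add_left\<close>)
  also have "\<dots> = (\<Oplus>i\<in>?F. a i \<odot> b i) \<oplus> (\<Oplus>i\<in>?F. a' i \<odot> b i)"
    by (rule finsum_addf) (use bF in auto)
  also have "(\<Oplus>i\<in>?F. a i \<odot> b i) = lin_comb b a" by (rule lin_comb_eq[OF F(1) _ bF, symmetric]) auto
  also have "(\<Oplus>i\<in>?F. a' i \<odot> b i) = lin_comb b a'" by (rule lin_comb_eq[OF F(1) _ bF, symmetric]) auto
  finally show ?thesis .
qed

lemma lin_comb_smult:
  assumes a: "a \<in> coords J"
  shows "lin_comb b (\<lambda>i. r * a i) = r \<odot> lin_comb b a"
proof -
  let ?F = "{i. a i \<noteq> 0}"
  have F: "finite ?F" "?F \<subseteq> J" using a by (auto simp: coords_def)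
  have bF: "b i \<in> carrier A" if "i \<in> ?F" for i using F b that by blast
  have "lin_comb b (\<lambda>i. r * a i) = (\<Oplus>i\<in>?F. (r * a i) \<odot> b i)"
    by (rule lin_comb_eq[OF F(1) _ bF]) auto
  also have "\<dots> = (\<Oplus>i\<in>?F. r \<odot> (a i \<odot> b i))"
    by (rule finsum_cong') (use bF in \<open>auto simp: smult_smult\<close>)
  also have "\<dots> = r \<odot> lin_comb b a"
    unfolding lin_comb_def by (rule smult_finsum[OF F(1), symmetric]) (use bF in blast)
  finally show ?thesis .
qed

lemma lin_comb_single:
  assumes "j \<in> J"
  shows "lin_comb b (\<lambda>i. if i = j then r else 0) = r \<odot> b j"
proof -
  have "lin_comb b (\<lambda>i. if i = j then r else 0) = (\<Oplus>i\<in>{j}. (if i = j then r else 0) \<odot> b i)"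
    by (rule lin_comb_eq) (use b assms in auto)
  then show ?thesis using b assms by simp
qed

lemma lspan_eq_lin_comb: "m \<in> lspan (b ` J) \<Longrightarrow> \<exists>a\<in>coords J. m = lin_comb b a"
proof (induction m rule: lspan.induct)
  case (base e)
  then obtain j where j: "j \<in> J" "e = b j" by blast
  have "e = lin_comb b (\<lambda>i. if i = j then u else 0)"
    using lin_comb_single[OF j(1), of u] j b smult_unit by simp
  moreover have "(\<lambda>i. if i = j then u else 0) \<in> coords J"
    using j by (auto simp: coords_def)
  ultimately show ?case by blast
next
  case zero
  have "\<zero> = lin_comb b (\<lambda>i. 0)" by (simp add: lin_comb_def)
  moreover have "(\<lambda>i. 0) \<in> coords J" by (simp add: coords_def)
  ultimately show ?case by blast
next
  case (add a a')
  then obtain f f' where f: "f \<in> coords J" "f' \<in> coords J" "a = lin_comb b f" "a' = lin_comb b f'"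
    by blast
  then have "a \<oplus> a' = lin_comb b (\<lambda>i. f i + f' i)" by (simp only: lin_comb_add)
  then show ?case using coords_add[OF f(1,2)] by blast
next
  case (smult a r)
  then obtain f where f: "f \<in> coords J" "a = lin_comb b f" by blast
  then have "r \<odot> a = lin_comb b (\<lambda>i. r * f i)" by (simp only: lin_comb_smult)
  then show ?case using coords_smult[OF f(1)] by blast
qed

lemma is_basisI:
  assumes span: "\<And>m. m \<in> carrier A \<Longrightarrow> m \<in> lspan (b ` J)"
    and indep: "\<And>F a. finite F \<Longrightarrow> F \<subseteq> J \<Longrightarrow> (\<Oplus>i\<in>F. a i \<odot> b i) = \<zero> \<Longrightarrow> \<forall>i\<in>F. a i = 0"
  shows "is_basis A J b"
  unfolding is_basis_def
proof (intro conjI ballI allI impI)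
  fix m assume "m \<in> carrier A"
  then obtain a where "a \<in> coords J" "m = lin_comb b a" using span lspan_eq_lin_comb by blast
  then show "\<exists>F a. finite F \<and> F \<subseteq> J \<and> m = (\<Oplus>i\<in>F. a i \<odot> b i)"
    unfolding lin_comb_def coords_def by blast
qed (use b indep in blast)+

end

text \<open>Two coordinate functions of the same element differ by a relation, to which independence
  applies on the support of the difference.\<close>

lemma is_basis_bij:
  assumes basis: "is_basis A J b"
  shows "bij_betw (lin_comb b) (coords J) (carrier A)"
proof -
  have b: "b j \<in> carrier A" if "j \<in> J" for j using basis that by (simp add: is_basis_def)
  have sp: "\<forall>m\<in>carrier A. \<exists>F a. finite F \<and> F \<subseteq> J \<and> m = (\<Oplus>i\<in>F. a i \<odot> b i)"
    and ind: "\<forall>F a. finite F \<and> F \<subseteq> J \<and> (\<Oplus>i\<in>F. a i \<odot> b i) = \<zero> \<longrightarrow> (\<forall>i\<in>F. a i = 0)"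
    by (rule conjunct1[OF conjunct2[OF basis[unfolded is_basis_def]]],
      rule conjunct2[OF conjunct2[OF basis[unfolded is_basis_def]]])
  show ?thesis
    unfolding bij_betw_def
  proof
    show "inj_on (lin_comb b) (coords J)"
    proof (rule inj_onI)
      fix a a' assume a: "a \<in> coords J" "a' \<in> coords J" and eq: "lin_comb b a = lin_comb b a'"
      let ?d = "\<lambda>i. a i + - a' i"
      have d: "?d \<in> coords J" by (rule coords_add[OF a(1) coords_uminus[OF a(2)]])
      have "lin_comb b (\<lambda>i. ?d i + a' i) = lin_comb b ?d \<oplus> lin_comb b a'"
        by (rule lin_comb_add[OF b d a(2)])
      then have "lin_comb b a' = lin_comb b ?d \<oplus> lin_comb b a'" using eq by simp
      then have "lin_comb b ?d = \<zero>"
        using lin_comb_closed[OF b d] lin_comb_closed[OF b a(2)] by (simp add: a_comm)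
      moreover have "finite {i. ?d i \<noteq> 0} \<and> {i. ?d i \<noteq> 0} \<subseteq> J" using d unfolding coords_def by blast
      ultimately have "\<forall>i\<in>{i. ?d i \<noteq> 0}. ?d i = 0"
        using ind[THEN spec[of _ "{i. ?d i \<noteq> 0}"], THEN spec[of _ ?d]] unfolding lin_comb_def by blast
      then show "a = a'" by (auto simp: fun_eq_iff)
    qed
    have *: "m \<in> lin_comb b ` coords J" if "m \<in> carrier A" for m
    proof -
      obtain F a where F: "finite F" "F \<subseteq> J" "m = (\<Oplus>i\<in>F. a i \<odot> b i)"
        using bspec[OF sp \<open>m \<in> carrier A\<close>] by blast
      let ?a = "\<lambda>i. if i \<in> F then a i else 0"
      have bF: "b i \<in> carrier A" if "i \<in> F" for i using F b that by blast
      have "lin_comb b ?a = (\<Oplus>i\<in>F. ?a i \<odot> b i)" by (rule lin_comb_eq[OF F(1) _ bF]) auto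
      also have "\<dots> = m" unfolding F(3) by (rule finsum_cong') (use bF in auto)
      finally have "m = lin_comb b ?a" ..
      moreover have "?a \<in> coords J" using F finite_subset[of "{i. ?a i \<noteq> 0}" F] by (auto simp: coords_def)
      ultimately show ?thesis by blast
    qed
    show "lin_comb b ` coords J = carrier A"
      by (intro equalityI image_subsetI subsetI lin_comb_closed[OF b] *)
  qed
qed

end

text \<open>Both modules are identified with the same \<open>coords J\<close>, and a linear map
  matching the bases becomes the identity there. Existence, uniqueness and bijectivity all come from
  this.\<close>

lemma linear_map_bases:
  assumes M: "unital_algebra M u" and N: "unital_algebra N u"
    and bM: "is_basis M J b" and bN: "is_basis N J b'"
  shows "\<exists>!f. linear_map M N f \<and> (\<forall>j\<in>J. f (b j) = b' j)"
    and "linear_map M N f \<Longrightarrow> \<forall>j\<in>J. f (b j) = b' j \<Longrightarrow> bij_betw f (carrier M) (carrier N)"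
proof -
  interpret M: unital_algebra M u by (rule M)
  interpret N: unital_algebra N u by (rule N)
  note LM = M.is_basis_bij[OF bM] and LN = N.is_basis_bij[OF bN]
  have b: "b j \<in> carrier M" and b': "b' j \<in> carrier N" if "j \<in> J" for j
    using bM bN that by (simp_all add: is_basis_def)
  let ?C = "coords J" and ?L = "M.lin_comb b" and ?L' = "N.lin_comb b'"
  have lin: "f (?L a) = ?L' a"
    if f: "linear_map M N f" and fb: "\<forall>j\<in>J. f (b j) = b' j" and a: "a \<in> ?C" for f a
  proof -
    have fz: "f \<zero>\<^bsub>M\<^esub> = \<zero>\<^bsub>N\<^esub>"
    proof -
      have "f (0 \<odot>\<^bsub>M\<^esub> \<zero>\<^bsub>M\<^esub>) = 0 \<odot>\<^bsub>N\<^esub> f \<zero>\<^bsub>M\<^esub>" "f \<zero>\<^bsub>M\<^esub> \<in> carrier N"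
        using f M.zero_closed unfolding linear_map_def by blast+
      then show ?thesis by simp
    qed
    have *: "f (\<Oplus>\<^bsub>M\<^esub>i\<in>F. a i \<odot>\<^bsub>M\<^esub> b i) = (\<Oplus>\<^bsub>N\<^esub>i\<in>F. a i \<odot>\<^bsub>N\<^esub> b' i)" if "finite F" "F \<subseteq> J" for F
      using that
    proof (induction F rule: finite_induct)
      case (insert i F)
      have "(\<lambda>i. a i \<odot>\<^bsub>M\<^esub> b i) \<in> F \<rightarrow> carrier M" "a i \<odot>\<^bsub>M\<^esub> b i \<in> carrier M"
          "(\<lambda>i. a i \<odot>\<^bsub>N\<^esub> b' i) \<in> F \<rightarrow> carrier N" "a i \<odot>\<^bsub>N\<^esub> b' i \<in> carrier N"
        using insert.prems b b' by auto
      moreover from this have "f (a i \<odot>\<^bsub>M\<^esub> b i \<oplus>\<^bsub>M\<^esub> (\<Oplus>\<^bsub>M\<^esub>i\<in>F. a i \<odot>\<^bsub>M\<^esub> b i)) =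
          f (a i \<odot>\<^bsub>M\<^esub> b i) \<oplus>\<^bsub>N\<^esub> f (\<Oplus>\<^bsub>M\<^esub>i\<in>F. a i \<odot>\<^bsub>M\<^esub> b i)"
        using f unfolding linear_map_def by (simp add: M.finsum_closed)
      moreover have "f (a i \<odot>\<^bsub>M\<^esub> b i) = a i \<odot>\<^bsub>N\<^esub> b' i"
        using f fb b insert.prems unfolding linear_map_def by simp
      ultimately show ?case using insert by simp
    qed (simp add: fz)
    show ?thesis
      unfolding M.lin_comb_def N.lin_comb_def by (rule *) (use a in \<open>auto simp: coords_def\<close>)
  qed
  show "bij_betw f (carrier M) (carrier N)"
    if f: "linear_map M N f" and fb: "\<forall>j\<in>J. f (b j) = b' j" for f
  proof -
    have "bij_betw (f \<circ> ?L) ?C (carrier N)"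
      using LN by (rule bij_betw_cong[THEN iffD1, rotated]) (simp add: lin[OF f fb])
    then show ?thesis using bij_betw_comp_iff[OF LM, of f "carrier N"] by simp
  qed
  define co where "co = inv_into ?C ?L"
  have co: "co m \<in> ?C" "?L (co m) = m" if "m \<in> carrier M" for m
  proof -
    have m: "m \<in> ?L ` ?C" using bij_betw_imp_surj_on[OF LM] that by blast
    show "co m \<in> ?C" unfolding co_def by (rule inv_into_into[OF m])
    show "?L (co m) = m" unfolding co_def by (rule f_inv_into_f[OF m])
  qed
  have co_L: "co (?L a) = a" if "a \<in> ?C" for a
    unfolding co_def by (rule inv_into_f_f[OF bij_betw_imp_inj_on[OF LM] that])
  define f where "f = (\<lambda>m\<in>carrier M. ?L' (co m))"
  have "linear_map M N f"
    unfolding linear_map_def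
  proof (intro conjI ballI allI)
    show "f \<in> carrier M \<rightarrow>\<^sub>E carrier N"
      unfolding f_def restrict_PiE_iff by (rule ballI) (rule N.lin_comb_closed[of J b', OF b' co(1)])
    fix m r assume m: "m \<in> carrier M"
    have "co (r \<odot>\<^bsub>M\<^esub> m) = (\<lambda>i. r * co m i)"
      using co_L[OF coords_smult[OF co(1)[OF m], of r]] M.lin_comb_smult[of J b, OF b co(1)[OF m], of r]
        co(2)[OF m] by simp
    then show "f (r \<odot>\<^bsub>M\<^esub> m) = r \<odot>\<^bsub>N\<^esub> f m"
      using m N.lin_comb_smult[of J b', OF b' co(1)[OF m], of r] by (simp add: f_def)
    fix m' assume m': "m' \<in> carrier M"
    have "co (m \<oplus>\<^bsub>M\<^esub> m') = (\<lambda>i. co m i + co m' i)"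
      using co_L[OF coords_add[OF co(1)[OF m] co(1)[OF m']]]
        M.lin_comb_add[of J b, OF b co(1)[OF m] co(1)[OF m']] co(2)[OF m] co(2)[OF m'] by simp
    then show "f (m \<oplus>\<^bsub>M\<^esub> m') = f m \<oplus>\<^bsub>N\<^esub> f m'"
      using m m' N.lin_comb_add[of J b', OF b' co(1)[OF m] co(1)[OF m']] by (simp add: f_def)
  qed
  moreover have "f (b j) = b' j" if j: "j \<in> J" for j
  proof -
    \<comment> \<open>The scalar \<open>u\<close> plays the part of 1, so this is the coordinate
      function of \<open>b j\<close>.\<close>
    let ?a = "\<lambda>i. if i = j then u else 0"
    have a: "?a \<in> ?C" using j by (auto simp: coords_def)
    have "b j = ?L ?a" using M.lin_comb_single[of J b, OF b j, of u] b[OF j] M.smult_unit by simp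
    moreover have "b' j = ?L' ?a" using N.lin_comb_single[of J b', OF b' j, of u] b'[OF j] N.smult_unit by simp
    ultimately show ?thesis using co_L[OF a] b[OF j] by (simp add: f_def)
  qed
  moreover have "f = h" if "linear_map M N h" "\<forall>j\<in>J. h (b j) = b' j"
    "linear_map M N f" "\<forall>j\<in>J. f (b j) = b' j" for f h
  proof -
    have "f m = h m" if "m \<in> carrier M" for m
      using lin[OF \<open>linear_map M N f\<close> \<open>\<forall>j\<in>J. f (b j) = b' j\<close> co(1)[OF that]]
        lin[OF \<open>linear_map M N h\<close> \<open>\<forall>j\<in>J. h (b j) = b' j\<close> co(1)[OF that]] co(2)[OF that] by simp
    \<comment> \<open>\<open>linear_map\<close> forces a fixed value off the carrier; agreement on
      the carrier is therefore equality of functions.\<close>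
    moreover have "f \<in> extensional (carrier M)" "h \<in> extensional (carrier M)"
      using that by (auto simp: linear_map_def PiE_def)
    ultimately show ?thesis by (intro extensionalityI) auto
  qed
  ultimately show "\<exists>!f. linear_map M N f \<and> (\<forall>j\<in>J. f (b j) = b' j)" by blast
qed

subsection \<open>Ordered monomials\<close>

context ring
begin

lemma pow_commute:
  assumes "a \<in> carrier R" "b \<in> carrier R" "a \<otimes> b = b \<otimes> a"
  shows "a \<otimes> (b [^] (k::nat)) = (b [^] k) \<otimes> a"
proof (induction k)
  case (Suc k)
  have "a \<otimes> (b [^] k \<otimes> b) = (b [^] k \<otimes> a) \<otimes> b" using assms Suc by (simp flip: m_assoc)
  also have "\<dots> = b [^] k \<otimes> b \<otimes> a" using assms by (simp add: m_assoc)
  finally show ?case by simp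
qed (use assms in simp)

lemma foldr_monomial_closed:
  "(\<And>i. i \<in> set l \<Longrightarrow> z i \<in> carrier R) \<Longrightarrow>
    foldr (\<lambda>i p. (z i [^] (a i :: nat)) \<otimes> p) l \<one> \<in> carrier R"
  by (induction l) auto

text \<open>\<open>z j\<close> moves past the powers in front of its own and is absorbed there; by
  distinctness this happens only once.\<close>

lemma foldr_monomial_mult:
  assumes "distinct l" "j \<in> set l" "\<And>i. i \<in> set l \<Longrightarrow> z i \<in> carrier R"
    "\<And>i. i \<in> set l \<Longrightarrow> z j \<otimes> z i = z i \<otimes> z j"
  shows "z j \<otimes> foldr (\<lambda>i p. (z i [^] (a i :: nat)) \<otimes> p) l \<one> =
    foldr (\<lambda>i p. (z i [^] ((a(j := Suc (a j))) i)) \<otimes> p) l \<one>"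
  using assms
proof (induction l)
  case (Cons i l)
  let ?p = "foldr (\<lambda>i p. (z i [^] (a i :: nat)) \<otimes> p) l \<one>"
  have p: "?p \<in> carrier R" by (rule foldr_monomial_closed) (use Cons in simp)
  have z: "z i \<in> carrier R" "z j \<in> carrier R" using Cons by auto
  show ?case
  proof (cases "i = j")
    case True
    then have "foldr (\<lambda>i p. (z i [^] ((a(j := Suc (a j))) i)) \<otimes> p) l \<one> = ?p"
      using Cons.prems(1) by (intro foldr_cong) auto
    moreover have "z j \<otimes> (z j [^] a j \<otimes> ?p) = z j [^] Suc (a j) \<otimes> ?p"
      using z p by (simp add: m_assoc[symmetric] pow_commute del: foldr_Cons)
    ultimately show ?thesis using True by simp
  next
    case False
    have "z j \<otimes> (z i [^] a i \<otimes> ?p) = z i [^] a i \<otimes> (z j \<otimes> ?p)"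
      using z p pow_commute[of "z j" "z i" "a i"] Cons.prems(4)[of i] by (simp add: m_assoc[symmetric])
    then show ?thesis using Cons False by simp
  qed
qed simp

lemma ordered_monomial_closed:
  "(\<And>i. i \<in> {1..n} \<Longrightarrow> z i \<in> carrier R) \<Longrightarrow> ordered_monomial R n z a \<in> carrier R"
  unfolding ordered_monomial_def by (rule foldr_monomial_closed) auto

lemma ordered_monomial_mult:
  assumes "j \<in> {1..n}" "\<And>i. i \<in> {1..n} \<Longrightarrow> z i \<in> carrier R"
    "\<And>i. i \<in> {1..n} \<Longrightarrow> z j \<otimes> z i = z i \<otimes> z j"
  shows "z j \<otimes> ordered_monomial R n z a = ordered_monomial R n z (a(j := Suc (a j)))"
  unfolding ordered_monomial_def
  by (rule foldr_monomial_mult) (use assms in auto)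

text \<open>Exponents in \<open>pbw_index\<close> are extensional, so the zero exponent appears as a
  restricted function.\<close>

lemma ordered_monomial_zero:
  assumes "\<And>i. i \<in> {1..n} \<Longrightarrow> z i \<in> carrier R"
  shows "ordered_monomial R n z (\<lambda>i\<in>{1..n}. 0) = \<one>"
proof -
  have *: "foldr (\<lambda>i p. (z i [^] (restrict (\<lambda>i. 0) {1..n} i :: nat)) \<otimes> p) l \<one> = \<one>" if "set l \<subseteq> {1..n}" for l
    using that by (induction l) auto
  show ?thesis unfolding ordered_monomial_def by (rule *) auto
qed

end

context unital_algebra
begin

text \<open>Meant for two uses: the \<open>y\<close>-monomials in front of group elements, then the
  \<open>x\<close>-monomials in front of the products \<open>y^b g\<close>.\<close>

definition monomial_span :: "nat \<Rightarrow> (nat \<Rightarrow> 'a) \<Rightarrow> 'a set \<Rightarrow> 'a set"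
  where "monomial_span n z Q =
    lspan {ordered_monomial A n z a \<otimes> q | a q. a \<in> {1..n} \<rightarrow>\<^sub>E UNIV \<and> q \<in> Q}"

lemma monomial_span_mult:
  assumes z: "\<And>i. i \<in> {1..n} \<Longrightarrow> z i \<in> carrier A"
    and comm: "\<And>i j. i \<in> {1..n} \<Longrightarrow> j \<in> {1..n} \<Longrightarrow> z i \<otimes> z j = z j \<otimes> z i"
    and Q: "Q \<subseteq> carrier A"
    and e: "e \<in> lspan (z ` {1..n})" and p: "p \<in> monomial_span n z Q"
  shows "e \<otimes> p \<in> monomial_span n z Q"
  unfolding monomial_span_def
proof (rule lspan_mult[OF _ _ _ _ e p[unfolded monomial_span_def]])
  show zc: "z ` {1..n} \<subseteq> carrier A" using z by blast
  let ?E = "{ordered_monomial A n z a \<otimes> q | a q. a \<in> {1..n} \<rightarrow>\<^sub>E UNIV \<and> q \<in> Q}"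
  show E: "?E \<subseteq> carrier A"
  proof
    fix e assume "e \<in> ?E"
    then obtain a q where q: "q \<in> Q" "e = ordered_monomial A n z a \<otimes> q" by blast
    show "e \<in> carrier A"
      unfolding q(2) by (rule m_closed[OF ordered_monomial_closed[OF z] subsetD[OF Q q(1)]])
  qed
  then show "?E \<subseteq> carrier A" .
  fix e e' assume "e \<in> z ` {1..n}" "e' \<in> ?E"
  then obtain j a q where j: "j \<in> {1..n}" "e = z j"
    and a: "a \<in> {1..n} \<rightarrow>\<^sub>E UNIV" "q \<in> Q" "e' = ordered_monomial A n z a \<otimes> q" by blast
  have "e \<otimes> e' = ordered_monomial A n z (a(j := Suc (a j))) \<otimes> q"
    using j a(2,3) ordered_monomial_closed[of n z a, OF z] ordered_monomial_mult[of j n z a, OF j(1) z comm[OF j(1)]] Q z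
    by (simp add: m_assoc[symmetric] subset_iff)
  moreover have "a(j := Suc (a j)) \<in> {1..n} \<rightarrow>\<^sub>E UNIV" using a(1) j(1) by (auto simp: PiE_def extensional_def)
  ultimately show "e \<otimes> e' \<in> lspan ?E" using a(2) by (intro lspan.base) blast
qed

end

subsection \<open>The monomials span\<close>

locale dual_bases = cherednik_datum scale G \<rho> \<phi> \<alpha> \<alpha>v t c
  for scale :: "'k::field \<Rightarrow> 'v::ab_group_add \<Rightarrow> 'v"
    and G :: "('g, 'm) monoid_scheme" (structure)
    and \<rho> :: "'g \<Rightarrow> 'v \<Rightarrow> 'v"
    and \<phi> :: "'k \<Rightarrow> 'r::comm_ring"
    and \<alpha> \<alpha>v t c +
  fixes n :: nat and yb :: "nat \<Rightarrow> 'v" and xb :: "nat \<Rightarrow> 'v \<Rightarrow> 'k"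
  assumes basis: "basis_family n yb" and dual_basis: "dual_family n yb xb"
begin

lemma xb_dual: "i \<in> {1..n} \<Longrightarrow> xb i \<in> dual_space"
  and xb_yb: "i \<in> {1..n} \<Longrightarrow> j \<in> {1..n} \<Longrightarrow> xb i (yb j) = (if i = j then 1 else 0)"
  using dual_basis by (auto simp: dual_family_def)

lemma dual_sum:
  assumes "x \<in> dual_space"
  shows "x (\<Sum>i\<in>F. scale (a i) (f i)) = (\<Sum>i\<in>F. a i * x (f i))"
proof -
  have "x 0 = 0" using assms dual_space_iff[of x] by (metis add_cancel_right_right)
  then show ?thesis
    by (induction F rule: infinite_finite_induct) (use assms in \<open>simp_all add: dual_space_iff\<close>)
qed

lemma V_expand: "v = (\<Sum>i\<in>{1..n}. scale (xb i v) (yb i))"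
proof -
  have "v \<in> span (yb ` {1..n})" "inj_on yb {1..n}" using basis by (auto simp: basis_family_def)
  then obtain f where "v = (\<Sum>w\<in>yb ` {1..n}. scale (f w) w)"
    using span_finite[of "yb ` {1..n}"] by auto
  then have v: "v = (\<Sum>i\<in>{1..n}. scale (f (yb i)) (yb i))"
    using \<open>inj_on yb {1..n}\<close> by (simp add: sum.reindex)
  have "xb j v = f (yb j)" if j: "j \<in> {1..n}" for j
  proof -
    have "xb j v = (\<Sum>i\<in>{1..n}. f (yb i) * xb j (yb i))"
      by (subst v) (rule dual_sum[OF xb_dual[OF j]])
    also have "\<dots> = (\<Sum>i\<in>{1..n}. if j = i then f (yb i) else 0)"
      by (rule sum.cong) (simp_all add: xb_yb[OF j])
    finally show ?thesis using j by simp
  qed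
  then have "(\<Sum>i\<in>{1..n}. scale (xb i v) (yb i)) = (\<Sum>i\<in>{1..n}. scale (f (yb i)) (yb i))"
    by (intro sum.cong) simp_all
  then show ?thesis using v by simp
qed

lemma dual_expand: "x \<in> dual_space \<Longrightarrow> x v = (\<Sum>i\<in>{1..n}. x (yb i) * xb i v)"
  using dual_sum[of x "\<lambda>i. xb i v" yb "{1..n}"] V_expand[of v] by (simp add: mult.commute)

end

section \<open>Normal ordering\<close>

locale pbw_relations =
  cherednik_relations scale G \<rho> \<phi> \<alpha> \<alpha>v t c A X Y \<Gamma> + dual_bases scale G \<rho> \<phi> \<alpha> \<alpha>v t c n yb xb
  for scale :: "'k::field \<Rightarrow> 'v::ab_group_add \<Rightarrow> 'v"
    and G :: "('g, 'm) monoid_scheme" (structure)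
    and \<rho> :: "'g \<Rightarrow> 'v \<Rightarrow> 'v"
    and \<phi> :: "'k \<Rightarrow> 'r::comm_ring"
    and \<alpha> \<alpha>v t c
    and A :: "('r, 'a) module" and X Y \<Gamma> n yb xb
begin

abbreviation "Xm \<equiv> ordered_monomial A n (\<lambda>i. X (xb i))"
abbreviation "Ym \<equiv> ordered_monomial A n (\<lambda>i. Y (yb i))"

definition pbw_element
  where "pbw_element = (\<lambda>(a, b, g). Xm a \<otimes>\<^bsub>A\<^esub> Ym b \<otimes>\<^bsub>A\<^esub> \<Gamma> g)"

lemma Xm_closed [simp]: "Xm a \<in> carrier A" and Ym_closed [simp]: "Ym a \<in> carrier A"
  by (rule A.ordered_monomial_closed; simp add: xb_dual)+

lemma X_lspan:
  assumes x: "x \<in> dual_space"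
  shows "X x \<in> A.lspan ((\<lambda>i. X (xb i)) ` {1..n})"
proof -
  \<comment> \<open>Membership in the dual space is carried through the induction because
    \<open>X_add\<close> demands it of the partial sums.\<close>
  have *: "(\<lambda>v. \<Sum>i\<in>F. x (yb i) * xb i v) \<in> dual_space \<and>
      X (\<lambda>v. \<Sum>i\<in>F. x (yb i) * xb i v) \<in> A.lspan ((\<lambda>i. X (xb i)) ` {1..n})"
    if "finite F" "F \<subseteq> {1..n}" for F
    using that
  proof (induction F rule: finite_induct)
    case empty
    have "X (\<lambda>v. 0) = \<zero>\<^bsub>A\<^esub>" using X_scale[OF dual_zero, of 0] by simp
    then show ?case by (simp add: A.lspan.zero)
  next
    case (insert i F)
    then have i: "i \<in> {1..n}" and IH: "(\<lambda>v. \<Sum>i\<in>F. x (yb i) * xb i v) \<in> dual_space"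
        "X (\<lambda>v. \<Sum>i\<in>F. x (yb i) * xb i v) \<in> A.lspan ((\<lambda>i. X (xb i)) ` {1..n})" by auto
    have "X (xb i) \<in> A.lspan ((\<lambda>i. X (xb i)) ` {1..n})" by (rule A.lspan.base) (use i in blast)
    then have "X (\<lambda>v. x (yb i) * xb i v + (\<Sum>i\<in>F. x (yb i) * xb i v)) \<in> A.lspan ((\<lambda>i. X (xb i)) ` {1..n})"
      unfolding X_add[OF dual_scale[OF xb_dual[OF i]] IH(1)] X_scale[OF xb_dual[OF i]]
      by (intro A.lspan.add A.lspan.smult IH(2))
    then show ?case using insert dual_add[OF dual_scale[OF xb_dual[OF i]] IH(1)] by simp
  qed
  have e: "(\<lambda>v. \<Sum>i\<in>{1..n}. x (yb i) * xb i v) = x"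
    by (rule ext) (rule dual_expand[OF x, symmetric])
  from *[OF finite_atLeastAtMost subset_refl, unfolded e] show ?thesis by (rule conjunct2)
qed

lemma Y_lspan: "Y y \<in> A.lspan ((\<lambda>i. Y (yb i)) ` {1..n})"
proof -
  have "Y (\<Sum>i\<in>F. scale (xb i y) (yb i)) \<in> A.lspan ((\<lambda>i. Y (yb i)) ` {1..n})"
    if "finite F" "F \<subseteq> {1..n}" for F
    using that
  proof (induction F rule: finite_induct)
    case empty
    have "Y 0 = \<zero>\<^bsub>A\<^esub>" using Y_scale[of 0 0] by simp
    then show ?case by (simp add: A.lspan.zero)
  next
    case (insert i F)
    have "Y (yb i) \<in> A.lspan ((\<lambda>i. Y (yb i)) ` {1..n})" by (rule A.lspan.base) (use insert in blast)
    then show ?case using insert by (simp add: Y_add Y_scale A.lspan.add A.lspan.smult)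
  qed
  from this[of "{1..n}"] show ?thesis using V_expand[of y] by simp
qed

text \<open>The group element stands last; another one multiplied from the left only changes the
  letters on its way there.\<close>

inductive_set Y_words where
  G: "g \<in> carrier G \<Longrightarrow> \<Gamma> g \<in> Y_words"
| Y: "p \<in> Y_words \<Longrightarrow> Y y \<otimes>\<^bsub>A\<^esub> p \<in> Y_words"

text \<open>Combinations of words in which every \<open>x\<close> stands left of every
  \<open>y\<close>. The set exhausts the algebra because it is stable under left multiplication by
  each kind of generator.\<close>

inductive_set XY_words where
  base: "p \<in> Y_words \<Longrightarrow> p \<in> XY_words"
| X: "p \<in> XY_words \<Longrightarrow> x \<in> dual_space \<Longrightarrow> X x \<otimes>\<^bsub>A\<^esub> p \<in> XY_words"
| add: "p \<in> XY_words \<Longrightarrow> q \<in> XY_words \<Longrightarrow> p \<oplus>\<^bsub>A\<^esub> q \<in> XY_words"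
| smult: "p \<in> XY_words \<Longrightarrow> r \<odot>\<^bsub>A\<^esub> p \<in> XY_words"

lemma Y_words_closed: "p \<in> Y_words \<Longrightarrow> p \<in> carrier A"
  by (induction rule: Y_words.induct) auto

lemma XY_words_closed: "p \<in> XY_words \<Longrightarrow> p \<in> carrier A"
  by (induction rule: XY_words.induct) (auto simp: Y_words_closed)

lemma Y_words_G: "p \<in> Y_words \<Longrightarrow> g \<in> carrier G \<Longrightarrow> \<Gamma> g \<otimes>\<^bsub>A\<^esub> p \<in> Y_words"
proof (induction rule: Y_words.induct)
  case (G h)
  then show ?case by (simp add: \<Gamma>_mult Y_words.G)
next
  case (Y p y)
  have "\<Gamma> g \<otimes>\<^bsub>A\<^esub> (Y y \<otimes>\<^bsub>A\<^esub> p) = Y (\<rho> g y) \<otimes>\<^bsub>A\<^esub> (\<Gamma> g \<otimes>\<^bsub>A\<^esub> p)"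
    using Y Y_words_closed[OF Y(1)] \<Gamma>_Y[of g y] by (simp add: A.m_assoc[symmetric])
  then show ?case using Y by (simp add: Y_words.Y)
qed

lemma XY_words_G: "p \<in> XY_words \<Longrightarrow> g \<in> carrier G \<Longrightarrow> \<Gamma> g \<otimes>\<^bsub>A\<^esub> p \<in> XY_words"
proof (induction rule: XY_words.induct)
  case (base p)
  then show ?case by (intro XY_words.base Y_words_G)
next
  case (X p x)
  have d: "(\<lambda>v. x (\<rho> (inv g) v)) \<in> dual_space" using X by (simp add: dual_action)
  have "\<Gamma> g \<otimes>\<^bsub>A\<^esub> (X x \<otimes>\<^bsub>A\<^esub> p) = X (\<lambda>v. x (\<rho> (inv g) v)) \<otimes>\<^bsub>A\<^esub> (\<Gamma> g \<otimes>\<^bsub>A\<^esub> p)"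
    using X d XY_words_closed[OF X(1)] \<Gamma>_X[of g x] by (simp add: A.m_assoc[symmetric])
  then show ?case using X d by (simp add: XY_words.X)
next
  case (add p q)
  then show ?case by (simp add: XY_words_closed A.r_distr XY_words.add)
next
  case (smult p r)
  then show ?case by (simp add: XY_words_closed A.smult_mult_right XY_words.smult)
qed

text \<open>The heart of the spanning argument: \<open>y x p\<close> equals \<open>x (y p)\<close>
  plus a multiple of \<open>p\<close> and multiples of the products \<open>s p\<close>. The
  induction follows the construction of the word, so \<open>y p\<close> is covered by the induction
  hypothesis and \<open>s p\<close> by \<open>XY_words_G\<close>.\<close>

lemma XY_words_Y: "p \<in> XY_words \<Longrightarrow> Y y \<otimes>\<^bsub>A\<^esub> p \<in> XY_words"
proof (induction rule: XY_words.induct)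
  case (base p)
  then show ?case by (intro XY_words.base Y_words.Y)
next
  case (X p x)
  have p: "p \<in> carrier A" by (rule XY_words_closed[OF X(1)])
  let ?c = "\<lambda>s. \<phi> (pairing s y x) * c (conj_class G s)"
  have z: "\<zero>\<^bsub>A\<^esub> \<in> XY_words" using XY_words.smult[OF X(1), of 0] p by simp
  have sum_in: "(\<Oplus>\<^bsub>A\<^esub>s\<in>F. ?c s \<odot>\<^bsub>A\<^esub> (\<Gamma> s \<otimes>\<^bsub>A\<^esub> p)) \<in> XY_words" if "finite F" "F \<subseteq> carrier G" for F
    using that
  proof (induction F rule: finite_induct)
    case (insert s F)
    have "(\<lambda>s. ?c s \<odot>\<^bsub>A\<^esub> (\<Gamma> s \<otimes>\<^bsub>A\<^esub> p)) \<in> F \<rightarrow> carrier A" "?c s \<odot>\<^bsub>A\<^esub> (\<Gamma> s \<otimes>\<^bsub>A\<^esub> p) \<in> carrier A"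
      using insert p by auto
    then show ?case using insert X(1) by (simp add: XY_words.add XY_words.smult XY_words_G)
  qed (simp add: z)
  have \<Gamma>c: "(\<lambda>s. ?c s \<odot>\<^bsub>A\<^esub> \<Gamma> s) \<in> reflections \<rightarrow> carrier A"
    using reflections_closed by auto
  have "Y y \<otimes>\<^bsub>A\<^esub> (X x \<otimes>\<^bsub>A\<^esub> p) = (Y y \<otimes>\<^bsub>A\<^esub> X x) \<otimes>\<^bsub>A\<^esub> p"
    using X p by (simp add: A.m_assoc)
  also have "\<dots> = X x \<otimes>\<^bsub>A\<^esub> (Y y \<otimes>\<^bsub>A\<^esub> p) \<oplus>\<^bsub>A\<^esub> ((t * \<phi> (x y)) \<odot>\<^bsub>A\<^esub> p \<oplus>\<^bsub>A\<^esub>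
      (\<Oplus>\<^bsub>A\<^esub>s\<in>reflections. ?c s \<odot>\<^bsub>A\<^esub> \<Gamma> s) \<otimes>\<^bsub>A\<^esub> p)"
    unfolding Y_X[OF X(2)] using X(2) p A.finsum_closed[OF \<Gamma>c]
    by (simp add: A.l_distr A.m_assoc A.smult_mult_left)
  also have "(\<Oplus>\<^bsub>A\<^esub>s\<in>reflections. ?c s \<odot>\<^bsub>A\<^esub> \<Gamma> s) \<otimes>\<^bsub>A\<^esub> p =
      (\<Oplus>\<^bsub>A\<^esub>s\<in>reflections. ?c s \<odot>\<^bsub>A\<^esub> \<Gamma> s \<otimes>\<^bsub>A\<^esub> p)"
    by (rule A.finsum_ldistr[OF finite_reflections p \<Gamma>c])
  also have "\<dots> = (\<Oplus>\<^bsub>A\<^esub>s\<in>reflections. ?c s \<odot>\<^bsub>A\<^esub> (\<Gamma> s \<otimes>\<^bsub>A\<^esub> p))"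
    by (rule A.finsum_cong') (use p reflections_closed in \<open>auto simp: A.smult_mult_left\<close>)
  finally show ?case
    using X sum_in[OF finite_reflections] reflections_closed
    by (simp add: XY_words.add XY_words.smult XY_words.X subset_iff)
next
  case (add p q)
  then show ?case by (simp add: XY_words_closed A.r_distr XY_words.add)
next
  case (smult p r)
  then show ?case by (simp add: XY_words_closed A.smult_mult_right XY_words.smult)
qed

lemma XY_words_all: "p \<in> carrier A \<Longrightarrow> p \<in> XY_words"
  using generated
proof (induction p rule: generates_induct)
  case one
  then show ?case using XY_words.base[OF Y_words.G[of \<one>]] \<Gamma>_one by simp
next
  case (mult s p)
  then consider y x where "x \<in> dual_space" "s = Y y \<oplus>\<^bsub>A\<^esub> X x" | g where "g \<in> carrier G" "s = \<Gamma> g"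
    by blast
  then show ?case
  proof cases
    case 1
    then show ?thesis using mult by (simp add: A.l_distr XY_words.add XY_words.X XY_words_Y)
  next
    case 2
    then show ?thesis using mult by (simp add: XY_words_G)
  qed
qed (auto intro: XY_words.intros A.unital_algebra_axioms)

lemma Y_words_span: "p \<in> Y_words \<Longrightarrow> p \<in> A.monomial_span n (\<lambda>i. Y (yb i)) (\<Gamma> ` carrier G)"
proof (induction rule: Y_words.induct)
  case (G g)
  have *: "\<Gamma> g = Ym (\<lambda>i\<in>{1..n}. 0) \<otimes>\<^bsub>A\<^esub> \<Gamma> g"
    using G by (subst A.ordered_monomial_zero) simp_all
  have "\<Gamma> g \<in> {Ym a \<otimes>\<^bsub>A\<^esub> q | a q. a \<in> {1..n} \<rightarrow>\<^sub>E UNIV \<and> q \<in> \<Gamma> ` carrier G}"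
    unfolding mem_Collect_eq by (intro exI conjI) (rule *, simp, rule imageI[OF G])
  then show ?case unfolding A.monomial_span_def by (rule A.lspan.base)
next
  case (Y p y)
  show ?case
    by (rule A.monomial_span_mult[OF _ _ _ Y_lspan Y(2)]) (auto intro: Y_commute)
qed

lemma XY_words_span:
  "p \<in> XY_words \<Longrightarrow> p \<in> A.monomial_span n (\<lambda>i. X (xb i))
    {Ym b \<otimes>\<^bsub>A\<^esub> \<Gamma> g | b g. b \<in> {1..n} \<rightarrow>\<^sub>E UNIV \<and> g \<in> carrier G}" (is "_ \<Longrightarrow> _ \<in> A.monomial_span n _ ?Q")
proof (induction rule: XY_words.induct)
  case (base p)
  from Y_words_span[OF this] show ?case
    unfolding A.monomial_span_def
  proof (induction rule: A.lspan.induct)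
    case (base e)
    then obtain b g where e: "e = Ym b \<otimes>\<^bsub>A\<^esub> \<Gamma> g" "b \<in> {1..n} \<rightarrow>\<^sub>E UNIV" "g \<in> carrier G" by blast
    \<comment> \<open>An element without \<open>x\<close>-part is read as a monomial with
      \<open>x\<close>-exponent zero.\<close>
    have *: "e = Xm (\<lambda>i\<in>{1..n}. 0) \<otimes>\<^bsub>A\<^esub> e"
      using e by (subst A.ordered_monomial_zero) (simp_all add: xb_dual)
    have "e \<in> {Xm a \<otimes>\<^bsub>A\<^esub> q | a q. a \<in> {1..n} \<rightarrow>\<^sub>E UNIV \<and> q \<in> ?Q}"
      unfolding mem_Collect_eq[of e]
      by (intro exI conjI) (rule *, simp, use e in blast)
    then show ?case by (rule A.lspan.base)
  next
    case zero
    show ?case by (rule A.lspan.zero)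
  next
    case (add a b)
    show ?case by (rule A.lspan.add[OF add(3,4)])
  next
    case (smult a r)
    show ?case by (rule A.lspan.smult[OF smult(2)])
  qed
next
  case (X p x)
  show ?case
    by (rule A.monomial_span_mult[OF _ _ _ X_lspan[OF X(2)] X(3)])
      (rule X_closed[OF xb_dual], assumption, rule X_commute[OF xb_dual xb_dual], assumption+, auto)
next
  case (add p q)
  then show ?case unfolding A.monomial_span_def by (intro A.lspan.add)
next
  case (smult p r)
  then show ?case unfolding A.monomial_span_def by (intro A.lspan.smult)
qed

lemma pbw_closed: "j \<in> pbw_index n G \<Longrightarrow> pbw_element j \<in> carrier A"
  by (auto simp: pbw_element_def pbw_index_def)

lemma pbw_span: "p \<in> carrier A \<Longrightarrow> p \<in> A.lspan (pbw_element ` pbw_index n G)"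
proof -
  have "{Xm a \<otimes>\<^bsub>A\<^esub> q | a q. a \<in> {1..n} \<rightarrow>\<^sub>E UNIV \<and>
      q \<in> {Ym b \<otimes>\<^bsub>A\<^esub> \<Gamma> g | b g. b \<in> {1..n} \<rightarrow>\<^sub>E UNIV \<and> g \<in> carrier G}} \<subseteq> pbw_element ` pbw_index n G"
  proof
    fix e assume "e \<in> {Xm a \<otimes>\<^bsub>A\<^esub> q | a q. a \<in> {1..n} \<rightarrow>\<^sub>E UNIV \<and>
      q \<in> {Ym b \<otimes>\<^bsub>A\<^esub> \<Gamma> g | b g. b \<in> {1..n} \<rightarrow>\<^sub>E UNIV \<and> g \<in> carrier G}}"
    then obtain a b g where j: "a \<in> {1..n} \<rightarrow>\<^sub>E UNIV" "b \<in> {1..n} \<rightarrow>\<^sub>E UNIV" "g \<in> carrier G"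
      and e: "e = Xm a \<otimes>\<^bsub>A\<^esub> (Ym b \<otimes>\<^bsub>A\<^esub> \<Gamma> g)" by blast
    have "e = pbw_element (a, b, g)" using e j by (simp add: pbw_element_def A.m_assoc)
    moreover have "(a, b, g) \<in> pbw_index n G" using j by (simp add: pbw_index_def)
    ultimately show "e \<in> pbw_element ` pbw_index n G" by blast
  qed
  moreover assume "p \<in> carrier A"
  note XY_words_span[OF XY_words_all[OF this], unfolded A.monomial_span_def]
  ultimately show ?thesis by (rule A.lspan_mono)
qed

end

section \<open>Representations of the presented algebras\<close>

text \<open>The relations of \<open>H_{t,c}\<close> on operators, with
  \<open>\<gamma> \<one>\<close> in the place of the unit, since the operators of the group are only
  required to multiply correctly.\<close>

locale cherednik_operators =
  cherednik_datum scale G \<rho> \<phi> \<alpha> \<alpha>v t c + scalar_action sc "\<phi> 1"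
  for scale :: "'k::field \<Rightarrow> 'v::ab_group_add \<Rightarrow> 'v"
    and G :: "('g, 'm) monoid_scheme" (structure)
    and \<rho> :: "'g \<Rightarrow> 'v \<Rightarrow> 'v"
    and \<phi> :: "'k \<Rightarrow> 'r::comm_ring"
    and \<alpha> \<alpha>v t c
    and sc :: "'r \<Rightarrow> 'n::ab_group_add \<Rightarrow> 'n" +
  fixes X :: "('v \<Rightarrow> 'k) \<Rightarrow> 'n \<Rightarrow> 'n" and D :: "'v \<Rightarrow> 'n \<Rightarrow> 'n" and \<gamma> :: "'g \<Rightarrow> 'n \<Rightarrow> 'n"
  assumes X_linear: "x \<in> dual_space \<Longrightarrow> linear_op (X x)"
    and D_linear: "linear_op (D y)"
    and \<gamma>_linear: "g \<in> carrier G \<Longrightarrow> linear_op (\<gamma> g)"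
    and X_add: "x \<in> dual_space \<Longrightarrow> x' \<in> dual_space \<Longrightarrow> X (\<lambda>v. x v + x' v) m = X x m + X x' m"
    and X_scale: "x \<in> dual_space \<Longrightarrow> X (\<lambda>v. a * x v) m = sc (\<phi> a) (X x m)"
    and D_add: "D (y + y') m = D y m + D y' m"
    and D_scale: "D (scale a y) m = sc (\<phi> a) (D y m)"
    and \<gamma>_mult: "g \<in> carrier G \<Longrightarrow> h \<in> carrier G \<Longrightarrow> \<gamma> (g \<otimes> h) m = \<gamma> g (\<gamma> h m)"
    and \<gamma>_X: "g \<in> carrier G \<Longrightarrow> x \<in> dual_space \<Longrightarrow> \<gamma> g (X x m) = X (\<lambda>v. x (\<rho> (inv g) v)) (\<gamma> g m)"
    and \<gamma>_D: "g \<in> carrier G \<Longrightarrow> \<gamma> g (D y m) = D (\<rho> g y) (\<gamma> g m)"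
    and X_commute: "x \<in> dual_space \<Longrightarrow> x' \<in> dual_space \<Longrightarrow> X x (X x' m) = X x' (X x m)"
    and D_commute: "D y (D y' m) = D y' (D y m)"
    and D_X: "x \<in> dual_space \<Longrightarrow> D y (X x m) = X x (D y m) + (sc (t * \<phi> (x y)) (\<gamma> \<one> m) +
      (\<Sum>s\<in>reflections. sc (\<phi> (pairing s y x) * c (conj_class G s)) (\<gamma> s m)))"
begin

definition op :: "'v \<times> ('v \<Rightarrow> 'k) \<Rightarrow> 'n \<Rightarrow> 'n" where "op w m = D (fst w) m + X (snd w) m"

lemma op_linear: "w \<in> W \<Longrightarrow> linear_op (op w)"
  using D_linear X_linear[of "snd w"] by (simp add: op_def in_W linear_op_def sc_add_right)

sublocale FR: free_representation sc \<phi> W op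
  by unfold_locales (rule op_linear)

sublocale AR: algebra_representation sc "\<phi> 1" "FA W" FR.free_rep
  by unfold_locales (rule FR.free_rep_representation)

lemma op_act: "g \<in> carrier G \<Longrightarrow> w \<in> W \<Longrightarrow> \<gamma> g (op w m) = op (VV_act g w) (\<gamma> g m)"
  using \<gamma>_linear[of g] by (simp add: op_def in_W linear_op_def \<gamma>_X \<gamma>_D VV_act_apply)

lemma free_rep_act:
  assumes "f \<in> carrier (FA W)" and g: "g \<in> carrier G"
  shows "\<gamma> g (FR.free_rep f m) = FR.free_rep (free_act g f) (\<gamma> g m)"
  using free_generates assms(1)
proof (induction f arbitrary: m rule: generates_induct)
  case one
  show ?case by (simp only: FV.act_one_right[OF g] FR.free_rep_one)
next
  case (add f f')
  have "\<gamma> g (a + b) = \<gamma> g a + \<gamma> g b" for a b using \<gamma>_linear[OF g] by (simp add: linear_op_def)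
  then show ?case
    by (simp only: FV.act_add[OF g add(1,2)] FR.free_rep_add add(1,2) FV.act_closed[OF g] add(3,4))
next
  case (smult r f)
  have "\<gamma> g (sc r a) = sc r (\<gamma> g a)" for a using \<gamma>_linear[OF g] by (simp add: linear_op_def)
  then show ?case
    by (simp only: FV.act_smult[OF g smult(1)] FR.free_rep_smult smult(1) FV.act_closed[OF g] smult(2))
next
  case (mult s f)
  then obtain w where w: "w \<in> W" "s = free_gen \<phi> w" by blast
  have "\<gamma> g (FR.free_rep (s \<otimes>\<^bsub>FA W\<^esub> f) m) = op (VV_act g w) (FR.free_rep (free_act g f) (\<gamma> g m))"
    by (simp only: w FR.free_rep_gen_mult[OF mult(2) w(1)] op_act[OF g w(1)] mult(3))
  also have "\<dots> = FR.free_rep (free_gen \<phi> (VV_act g w) \<otimes>\<^bsub>FA W\<^esub> free_act g f) (\<gamma> g m)"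
    by (simp only: FR.free_rep_gen_mult[OF FV.act_closed[OF g mult(2)] VV_act_closed[OF g w(1)]])
  also have "\<dots> = FR.free_rep (free_act g (s \<otimes>\<^bsub>FA W\<^esub> f)) (\<gamma> g m)"
    by (simp only: w(2) FV.act_prod[OF g free_gen_closed[OF w(1)] mult(2)] free_act_gen[OF g])
  finally show ?case .
qed (rule free_unital_algebra)

lemma op_VV: "w \<in> W \<Longrightarrow> w' \<in> W \<Longrightarrow> op (w \<oplus>\<^bsub>VV\<^esub> w') m = op w m + op w' m"
    "w \<in> W \<Longrightarrow> op (a \<odot>\<^bsub>VV\<^esub> w) m = sc (\<phi> a) (op w m)"
  by (simp_all add: op_def VV_add VV_smult in_W X_add D_add X_scale D_scale sc_add_right)

lemma tensor_ideal_kernel: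
  assumes "f \<in> tensor_ideal \<phi> VV"
  shows "FR.free_rep f m = 0"
proof (rule AR.genideal_kernel[OF tensor_rels_closed _ assms[unfolded tensor_ideal_eq]])
  fix f m assume "f \<in> tensor_rels"
  then consider w w' where "w \<in> W" "w' \<in> W"
      "f = free_gen \<phi> (w \<oplus>\<^bsub>VV\<^esub> w') \<ominus>\<^bsub>FA W\<^esub> (free_gen \<phi> w \<oplus>\<^bsub>FA W\<^esub> free_gen \<phi> w')"
    | b w where "w \<in> W" "f = free_gen \<phi> (b \<odot>\<^bsub>VV\<^esub> w) \<ominus>\<^bsub>FA W\<^esub> (\<phi> b \<odot>\<^bsub>FA W\<^esub> free_gen \<phi> w)"
    unfolding tensor_rels_def by blast
  then show "FR.free_rep f m = 0"
  proof cases
    case 1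
    then show ?thesis
      by (simp only: AR.rep_minus AR.rep_add free_gen_closed VV_closed free.a_closed FR.free_rep_gen
          op_VV diff_self)
  next
    case 2
    then show ?thesis
      by (simp only: AR.rep_minus AR.rep_smult free_gen_closed VV_closed free.smult_closed FR.free_rep_gen
          op_VV diff_self)
  qed
qed

lemma tensor_representation:
  obtains \<psi> where "semidirect_representation sc (\<phi> 1) T \<psi> G tensor_act \<gamma>"
    and "\<And>w m. w \<in> W \<Longrightarrow> \<psi> (tensor_gen \<phi> VV w) m = op w m"
    and "\<And>m. \<psi> \<one>\<^bsub>T\<^esub> m = m"
proof -
  obtain \<psi> where \<psi>: "is_representation T \<psi>"
      and \<psi>_eq: "\<And>f. f \<in> carrier (FA W) \<Longrightarrow> \<psi> (tensor_ideal \<phi> VV +>\<^bsub>FA W\<^esub> f) = FR.free_rep f"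
    using AR.quot_representation[OF tensor_ideal tensor_ideal_kernel] unfolding tensor_algebra_def
    by blast
  have "semidirect_representation sc (\<phi> 1) T \<psi> G tensor_act \<gamma>"
  proof (intro semidirect_representation.intro semidirect_representation_axioms.intro
      algebra_representation.intro algebra_representation_axioms.intro scalar_action_axioms
      TV.unital_algebra_axioms TV.finite_algebra_action_axioms \<psi> \<gamma>_linear \<gamma>_mult)
    fix g a m assume g: "g \<in> carrier G" and a: "a \<in> carrier T"
    obtain f where f: "f \<in> carrier (FA W)" "a = tensor_ideal \<phi> VV +>\<^bsub>FA W\<^esub> f"
      using free.quot_surj[OF tensor_ideal] a unfolding tensor_algebra_def by blast
    have "tensor_act g a = tensor_ideal \<phi> VV +>\<^bsub>FA W\<^esub> free_act g f"
      unfolding tensor_act_eq f(2) by (rule FV.act_coset[OF tensor_ideal tensor_ideal_act g f(1)])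
    then show "\<gamma> g (\<psi> a m) = \<psi> (tensor_act g a) (\<gamma> g m)"
      by (simp only: f(2) \<psi>_eq f(1) FV.act_closed[OF g] free_rep_act[OF f(1) g])
  qed
  moreover have "\<psi> (tensor_gen \<phi> VV w) m = op w m" if "w \<in> W" for w m
    unfolding tensor_gen_def by (simp only: \<psi>_eq free_gen_closed[OF that] FR.free_rep_gen[OF that])
  moreover have "\<psi> \<one>\<^bsub>T\<^esub> m = m" for m
    unfolding tensor_algebra_def quot_algebra_sel(3)
    by (simp only: \<psi>_eq free_algebra_closed(1) FR.free_rep_one)
  ultimately show ?thesis using that by blast
qed

lemma op_V: "op (y, \<lambda>v. 0) m = D y m"
  using X_scale[OF dual_zero, of 0 m] by (simp add: op_def)

lemma op_dual: "op (0, x) m = X x m"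
  using D_scale[of 0 0 m] by (simp add: op_def)

lemma \<gamma>_one:
  "x \<in> dual_space \<Longrightarrow> \<gamma> \<one> (X x m) = X x (\<gamma> \<one> m)" "\<gamma> \<one> (D y m) = D y (\<gamma> \<one> m)"
  "g \<in> carrier G \<Longrightarrow> \<gamma> \<one> (\<gamma> g m) = \<gamma> g m" "g \<in> carrier G \<Longrightarrow> \<gamma> g (\<gamma> \<one> m) = \<gamma> g m"
  using \<gamma>_X[of \<one> x m] \<gamma>_D[of \<one> y m] \<gamma>_mult[of \<one> g m] \<gamma>_mult[of g \<one> m] by (simp_all add: rep_one)

text \<open>The operators are extended along the construction of the algebra (free algebra, tensor
  algebra, semidirect product, quotient), and each stage checks only its own relations. Vectors and
  linear forms sit at the group element \<open>\<one>\<close>, whence the factors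
  \<open>\<gamma> \<one>\<close>.\<close>

lemma cherednik_representation:
  obtains \<psi> where "is_representation cherednik_algebra \<psi>"
    and "\<And>y m. \<psi> (cherednik_V y) m = D y (\<gamma> \<one> m)"
    and "\<And>x m. x \<in> dual_space \<Longrightarrow> \<psi> (cherednik_dual x) m = X x (\<gamma> \<one> m)"
    and "\<And>g m. g \<in> carrier G \<Longrightarrow> \<psi> (cherednik_G g) m = \<gamma> g m"
proof -
  obtain \<psi> where \<psi>: "semidirect_representation sc (\<phi> 1) T \<psi> G tensor_act \<gamma>"
    and \<psi>_gen: "\<And>w m. w \<in> W \<Longrightarrow> \<psi> (tensor_gen \<phi> VV w) m = op w m"
    and \<psi>_one: "\<And>m. \<psi> \<one>\<^bsub>T\<^esub> m = m"
    using tensor_representation by blast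
  interpret TR: semidirect_representation sc "\<phi> 1" T \<psi> G tensor_act \<gamma> by (rule \<psi>)
  interpret TG: algebra_representation sc "\<phi> 1" TV.AG TR.semidirect_rep
    by unfold_locales (rule TR.semidirect_rep_representation)
  have V: "TR.semidirect_rep (tensor_V y) m = D y (\<gamma> \<one> m)" for y m
    unfolding tensor_V_def
    by (simp only: TR.semidirect_rep_el[OF tensor_gen_closed[OF TS.inW(1)] one_closed] \<psi>_gen TS.inW(1) op_V)
  have dual: "TR.semidirect_rep (tensor_dual x) m = X x (\<gamma> \<one> m)" if "x \<in> dual_space" for x m
    unfolding tensor_dual_def
    by (simp only: TR.semidirect_rep_el[OF tensor_gen_closed[OF TS.inW(2)[OF that]] one_closed] \<psi>_gen
        TS.inW(2)[OF that] op_dual)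
  have G: "TR.semidirect_rep (tensor_G g) m = \<gamma> g m" if "g \<in> carrier G" for g m
    unfolding tensor_G_def by (simp only: TR.semidirect_rep_el[OF TV.one_closed that] \<psi>_one)
  have lin: "D y (a - b) = D y a - D y b" "x \<in> dual_space \<Longrightarrow> X x (a - b) = X x a - X x b" for a b x y
    using D_linear[of y] X_linear[of x] unfolding linear_op_def by (metis add_diff_cancel diff_add_cancel)+
  have rhs: "TR.semidirect_rep (cherednik_rhs y x) m = sc (t * \<phi> (x y)) (\<gamma> \<one> m) +
      (\<Sum>s\<in>reflections. sc (\<phi> (pairing s y x) * c (conj_class G s)) (\<gamma> s m))" for x y m
  proof -
    have "TR.semidirect_rep \<one>\<^bsub>TV.AG\<^esub> m = \<gamma> \<one> m"
      unfolding TV.one_eq_el by (simp only: TR.semidirect_rep_el[OF TV.one_closed one_closed] \<psi>_one)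
    moreover have "TR.semidirect_rep (\<Oplus>\<^bsub>TV.AG\<^esub>s\<in>reflections.
        (\<phi> (pairing s y x) * c (conj_class G s)) \<odot>\<^bsub>TV.AG\<^esub> tensor_G s) m =
      (\<Sum>s\<in>reflections. TR.semidirect_rep ((\<phi> (pairing s y x) * c (conj_class G s)) \<odot>\<^bsub>TV.AG\<^esub> tensor_G s) m)"
      by (rule TG.rep_finsum[OF finite_reflections]) (intro TV.AG.smult_closed tensor_el_closed)
    moreover have "\<dots> = (\<Sum>s\<in>reflections. sc (\<phi> (pairing s y x) * c (conj_class G s)) (\<gamma> s m))"
      by (rule sum.cong) (simp_all only: TG.rep_smult tensor_el_closed G reflections_closed)
    moreover have "(\<Oplus>\<^bsub>TV.AG\<^esub>s\<in>reflections.
        (\<phi> (pairing s y x) * c (conj_class G s)) \<odot>\<^bsub>TV.AG\<^esub> tensor_G s) \<in> carrier TV.AG"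
      by (intro TV.AG.finsum_closed Pi_I TV.AG.smult_closed tensor_el_closed)
    ultimately show ?thesis
      unfolding cherednik_rhs_eq
      by (simp only: TG.rep_add TG.rep_smult TV.AG.smult_closed TV.AG.one_closed)
  qed
  have ker: "TR.semidirect_rep a m = 0" if "a \<in> cherednik_ideal" for a m
  proof (rule TG.genideal_kernel[OF cherednik_rels_closed _ that[unfolded cherednik_ideal_eq]])
    fix a m assume "a \<in> cherednik_rels"
    then consider x x' where "x \<in> dual_space" "x' \<in> dual_space"
        "a = commutator TV.AG (tensor_dual x) (tensor_dual x')"
      | y y' where "a = commutator TV.AG (tensor_V y) (tensor_V y')"
      | y x where "x \<in> dual_space"
        "a = commutator TV.AG (tensor_V y) (tensor_dual x) \<ominus>\<^bsub>TV.AG\<^esub> cherednik_rhs y x"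
      unfolding cherednik_rels_def by blast
    then show "TR.semidirect_rep a m = 0"
    proof cases
      case 1
      then show ?thesis
        by (simp only: commutator_def TG.rep_minus TG.rep_mult TV.AG.m_closed tensor_el_closed dual
            \<gamma>_one one_closed X_commute[OF 1(1,2)] diff_self)
    next
      case 2
      then show ?thesis
        by (simp only: commutator_def TG.rep_minus TG.rep_mult TV.AG.m_closed tensor_el_closed V
            \<gamma>_one one_closed D_commute[of y y'] diff_self)
    next
      case 3
      \<comment> \<open>\<open>\<gamma> \<one>\<close> is idempotent and commutes with
        \<open>D\<close> and \<open>X\<close>, so all its copies are collected next to
        \<open>m\<close>.\<close>
      have "TR.semidirect_rep a m = D y (X x (\<gamma> \<one> m)) - X x (D y (\<gamma> \<one> m)) - (sc (t * \<phi> (x y)) (\<gamma> \<one> m) +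
        (\<Sum>s\<in>reflections. sc (\<phi> (pairing s y x) * c (conj_class G s)) (\<gamma> s m)))"
        using 3(1) by (simp only: 3(2) commutator_def TG.rep_minus TG.rep_mult TV.AG.m_closed
            TV.AG.minus_closed tensor_el_closed V dual rhs cherednik_rhs_closed \<gamma>_one one_closed)
      also have "\<dots> = 0"
        using D_X[OF 3(1), of y "\<gamma> \<one> m"] reflections_closed by (simp add: \<gamma>_one)
      finally show ?thesis .
    qed
  qed
  obtain \<psi>' where \<psi>': "is_representation cherednik_algebra \<psi>'"
      and \<psi>'_eq: "\<And>a. a \<in> carrier TV.AG \<Longrightarrow> \<psi>' (cherednik_ideal +>\<^bsub>TV.AG\<^esub> a) = TR.semidirect_rep a"
    using TG.quot_representation[OF cherednik_ideal ker] unfolding cherednik_algebra_eq by blast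
  show ?thesis
    by (rule that[OF \<psi>'])
      (simp_all only: cherednik_el_eq T_el_eq \<psi>'_eq tensor_el_closed V dual G)
qed

text \<open>For zero parameters all operators \<open>op w\<close> commute, so the representation of
  the tensor algebra factors through the symmetric algebra before \<open>G\<close> is
  adjoined.\<close>

lemma symmetric_representation:
  assumes tc: "t = 0" "c = (\<lambda>_. 0)"
  obtains \<psi> where "is_representation symmetric_semidirect \<psi>"
    and "\<And>y m. \<psi> (symmetric_V y) m = D y (\<gamma> \<one> m)"
    and "\<And>x m. x \<in> dual_space \<Longrightarrow> \<psi> (symmetric_dual x) m = X x (\<gamma> \<one> m)"
    and "\<And>g m. g \<in> carrier G \<Longrightarrow> \<psi> (symmetric_G g) m = \<gamma> g m"
proof -
  obtain \<psi> where \<psi>: "semidirect_representation sc (\<phi> 1) T \<psi> G tensor_act \<gamma>"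
    and \<psi>_gen: "\<And>w m. w \<in> W \<Longrightarrow> \<psi> (tensor_gen \<phi> VV w) m = op w m"
    and \<psi>_one: "\<And>m. \<psi> \<one>\<^bsub>T\<^esub> m = m"
    using tensor_representation by blast
  interpret TR: semidirect_representation sc "\<phi> 1" T \<psi> G tensor_act \<gamma> by (rule \<psi>)
  have D_X0: "D y (X x m) = X x (D y m)" if "x \<in> dual_space" for x y m
    using D_X[OF that, of y m] by (simp add: tc)
  have ker: "\<psi> a m = 0" if "a \<in> symmetric_ideal \<phi> VV" for a m
  proof (rule TR.genideal_kernel[OF symmetric_rels_closed _ that[unfolded symmetric_ideal_eq]])
    fix a m assume "a \<in> symmetric_rels"
    then obtain w w' where w: "w \<in> W" "w' \<in> W"
        "a = commutator T (tensor_gen \<phi> VV w) (tensor_gen \<phi> VV w')"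
      unfolding symmetric_rels_def by blast
    have "\<psi> a m = op w (op w' m) - op w' (op w m)"
      using w by (simp only: commutator_def TR.rep_minus TR.rep_mult TV.m_closed tensor_gen_closed \<psi>_gen)
    also have "\<dots> = 0"
      using w D_linear[of "fst w"] D_linear[of "fst w'"] X_linear[of "snd w"] X_linear[of "snd w'"]
      by (simp add: op_def in_W linear_op_def D_X0 X_commute[of "snd w" "snd w'"] D_commute[of "fst w" "fst w'"])
    finally show "\<psi> a m = 0" .
  qed
  obtain \<psi>' where \<psi>': "is_representation S \<psi>'"
      and \<psi>'_eq: "\<And>a. a \<in> carrier T \<Longrightarrow> \<psi>' (symmetric_ideal \<phi> VV +>\<^bsub>T\<^esub> a) = \<psi> a"
    using TR.quot_representation[OF symmetric_ideal ker] unfolding symmetric_algebra_def by blast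
  interpret SR: semidirect_representation sc "\<phi> 1" S \<psi>' G symmetric_act \<gamma>
  proof (intro semidirect_representation.intro semidirect_representation_axioms.intro
      algebra_representation.intro algebra_representation_axioms.intro scalar_action_axioms
      SV.unital_algebra_axioms SV.finite_algebra_action_axioms \<psi>' \<gamma>_linear \<gamma>_mult)
    fix g a m assume g: "g \<in> carrier G" and a: "a \<in> carrier S"
    obtain f where f: "f \<in> carrier T" "a = symmetric_ideal \<phi> VV +>\<^bsub>T\<^esub> f"
      using TV.quot_surj[OF symmetric_ideal] a unfolding symmetric_algebra_def by blast
    have "symmetric_act g a = symmetric_ideal \<phi> VV +>\<^bsub>T\<^esub> tensor_act g f"
      unfolding symmetric_act_eq f(2) by (rule TV.act_coset[OF symmetric_ideal symmetric_ideal_act g f(1)])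
    then show "\<gamma> g (\<psi>' a m) = \<psi>' (symmetric_act g a) (\<gamma> g m)"
      by (simp only: f(2) \<psi>'_eq f(1) TV.act_closed[OF g] TR.gamma_rep[OF g f(1)])
  qed
  have gen: "\<psi>' (symmetric_gen \<phi> VV w) m = op w m" if "w \<in> W" for w m
    unfolding symmetric_gen_def by (simp only: \<psi>'_eq tensor_gen_closed[OF that] \<psi>_gen[OF that])
  have one: "\<psi>' \<one>\<^bsub>S\<^esub> m = m" for m
    unfolding symmetric_algebra_def quot_algebra_sel(3) by (simp only: \<psi>'_eq TV.one_closed \<psi>_one)
  show ?thesis
  proof (rule that)
    show "is_representation symmetric_semidirect SR.semidirect_rep"
      unfolding symmetric_semidirect_def by (rule SR.semidirect_rep_representation)
    show "SR.semidirect_rep (symmetric_V y) m = D y (\<gamma> \<one> m)" for y m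
      unfolding symmetric_V_def
      by (simp only: SR.semidirect_rep_el[OF symmetric_gen_closed[OF TS.inW(1)] one_closed] gen TS.inW(1) op_V)
    show "SR.semidirect_rep (symmetric_dual x) m = X x (\<gamma> \<one> m)" if "x \<in> dual_space" for x m
      unfolding symmetric_dual_def
      by (simp only: SR.semidirect_rep_el[OF symmetric_gen_closed[OF TS.inW(2)[OF that]] one_closed] gen
          TS.inW(2)[OF that] op_dual)
    show "SR.semidirect_rep (symmetric_G g) m = \<gamma> g m" if "g \<in> carrier G" for g m
      unfolding symmetric_G_def by (simp only: SR.semidirect_rep_el[OF SV.one_closed that] one)
  qed
qed

end

section \<open>Polynomials and twisted derivations\<close>

type_synonym 'q upoly = "(nat \<Rightarrow>\<^sub>0 nat) \<Rightarrow>\<^sub>0 'q"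

text \<open>\<open>update_induct\<close> inserts a fresh key, and there updating coincides with
  adding. The rule serves exponents as well as polynomials, both being finitely supported
  functions.\<close>

lemma single_induct [case_names zero single]:
  assumes zero: "P 0" and step: "\<And>m k q. P m \<Longrightarrow> P (Poly_Mapping.single k q + m)"
  shows "P (m :: 'i \<Rightarrow>\<^sub>0 'q::comm_monoid_add)"
proof (induction m rule: update_induct)
  case const
  show ?case by (rule zero)
next
  case (update f a b)
  have "Poly_Mapping.update a b f = Poly_Mapping.single a b + f"
    using update(1) by (intro poly_mapping_eqI)
      (auto simp: lookup_update lookup_add lookup_single in_keys_iff when_def)
  then show ?case using step[OF update(3)] by simp
qed

text \<open>The unit \<open>e\<close> is explicit because the coefficient type is only a \<^class>\<open>comm_ring\<close>.\<close>

locale unital_poly =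
  fixes e :: "'q::comm_ring"
  assumes e_mult: "e * q = q"
begin

abbreviation const :: "'q \<Rightarrow> 'q upoly" where "const \<equiv> Poly_Mapping.single 0"

definition pvar :: "nat \<Rightarrow> 'q upoly"
  where "pvar i = Poly_Mapping.single (Poly_Mapping.single i 1) e"

lemma pvar_mult_single:
  "pvar i * Poly_Mapping.single m q = Poly_Mapping.single (Poly_Mapping.single i 1 + m) q"
  by (simp add: pvar_def mult_single e_mult)

lemma const_unit: "const e * p = p"
  by (induction p rule: single_induct) (simp_all add: distrib_left mult_single e_mult)

text \<open>Monomials are built up one variable at a time because twisted Leibniz rules prescribe
  the effect of a single variable.\<close>

lemma upoly_induct [case_names const pvar add]:
  assumes const: "\<And>q. P (const q)" and pvar: "\<And>i p. P p \<Longrightarrow> P (pvar i * p)"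
    and add: "\<And>p p'. P p \<Longrightarrow> P p' \<Longrightarrow> P (p + p')"
  shows "P p"
proof -
  have exp: "P (Poly_Mapping.single m q)" for m q
  proof (induction m rule: single_induct)
    case zero
    show ?case by (rule const)
  next
    case (single m i k)
    show ?case
    proof (induction k)
      case 0
      show ?case using single by simp
    next
      case (Suc k)
      have "Poly_Mapping.single i (Suc k) + m = Poly_Mapping.single i 1 + (Poly_Mapping.single i k + m)"
        by (simp add: add.assoc[symmetric] single_add[symmetric])
      then show ?case using pvar[OF Suc, of i] by (simp only: pvar_mult_single)
    qed
  qed
  show ?thesis
  proof (induction p rule: single_induct)
    case zero
    show ?case using const[of 0] by simp
  qed (use exp add in blast)
qed

text \<open>
  A twisted derivation is the off-diagonal entry of the homomorphism that sends the variables to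
  the commuting upper triangular matrices \<open>A i\<close>.
\<close>

lemma twisted_derivation:
  assumes comm: "\<And>i j. \<sigma> i * b j + b i * pvar j = \<sigma> j * b i + b j * pvar i"
  obtains \<Delta> where "\<And>p p'. \<Delta> (p + p') = \<Delta> p + \<Delta> p'" and "\<And>q. \<Delta> (const q) = 0"
    and "\<And>i p. \<Delta> (pvar i * p) = \<sigma> i * \<Delta> p + b i * p"
proof -
  \<comment> \<open>As a matrix acting on columns, \<open>A i\<close> has diagonal entries
    \<open>\<sigma> i\<close> and \<open>pvar i\<close> and corner \<open>b i\<close>. Two of them
    commute exactly when the corners of the two products agree, and this is
    \<open>comm\<close>.\<close>
  define A where "A i = (\<lambda>(v, w). (\<sigma> i * v + b i * w, pvar i * w))" for i
  \<comment> \<open>The monomial \<open>m\<close> evaluated at these matrices, restricted to the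
    variables in \<open>l\<close>.\<close>
  define mon where "mon l m = foldr (\<lambda>i f. (A i ^^ Poly_Mapping.lookup m i) \<circ> f) l id"
    for l and m :: "nat \<Rightarrow>\<^sub>0 nat"
  have A_comm: "A i \<circ> A j = A j \<circ> A i" for i j
  proof
    fix x
    have "\<sigma> i * (b j * w) + b i * (pvar j * w) = \<sigma> j * (b i * w) + b j * (pvar i * w)" for w
      using arg_cong[OF comm[of i j], of "\<lambda>z. z * w"] by (simp add: distrib_right mult.assoc)
    then show "(A i \<circ> A j) x = (A j \<circ> A i) x"
      by (cases x) (simp add: A_def distrib_left add.assoc mult.left_commute)
  qed
  have A_pow: "A i \<circ> (A j ^^ k) = (A j ^^ k) \<circ> A i" for i j k
  proof (induction k)
    case (Suc k)
    have "A i \<circ> (A j ^^ Suc k) = (A i \<circ> A j) \<circ> (A j ^^ k)" by (simp add: comp_assoc)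
    also have "\<dots> = A j \<circ> (A i \<circ> (A j ^^ k))" by (simp only: A_comm[of i j] comp_assoc)
    finally show ?case by (simp only: Suc funpow.simps comp_assoc)
  qed simp
  have A_add: "A i (x + y) = A i x + A i y" for i x y
    by (cases x; cases y) (simp add: A_def algebra_simps)
  have A_pow_add: "(A i ^^ k) (x + y) = (A i ^^ k) x + (A i ^^ k) y" for i k x y
    by (induction k) (simp_all add: A_add)
  have mon_add: "mon l m (x + y) = mon l m x + mon l m y" for l m x y
    unfolding mon_def by (induction l) (simp_all add: A_pow_add)
  have mon_skip: "mon l (Poly_Mapping.single i 1 + m) = mon l m" if "i \<notin> set l" for l i m
    using that unfolding mon_def by (induction l) (simp_all add: lookup_add lookup_single)
  have mon_step: "mon l (Poly_Mapping.single i 1 + m) = A i \<circ> mon l m" if "distinct l" "i \<in> set l" for l i m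
    using that
  proof (induction l)
    case (Cons j l)
    show ?case
    proof (cases "i = j")
      case True
      then have "mon l (Poly_Mapping.single i 1 + m) = mon l m" using Cons.prems mon_skip by simp
      then show ?thesis using True by (simp add: mon_def lookup_add lookup_single comp_assoc)
    next
      case False
      then have "mon l (Poly_Mapping.single i 1 + m) = A i \<circ> mon l m" using Cons by (simp add: comp_def)
      then have "mon (j # l) (Poly_Mapping.single i 1 + m) = ((A j ^^ Poly_Mapping.lookup m j) \<circ> A i) \<circ> mon l m"
        using False by (simp add: mon_def lookup_add lookup_single comp_assoc)
      also have "\<dots> = (A i \<circ> (A j ^^ Poly_Mapping.lookup m j)) \<circ> mon l m"
        by (simp only: A_pow)
      finally show ?thesis by (simp add: mon_def comp_assoc)
    qed
  qed simp
  \<comment> \<open>There are infinitely many variables; those of \<open>m\<close> lie below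
    \<open>N m\<close>, and a longer range only inserts zeroth powers. This allows two monomials to
    be compared over one range.\<close>
  define N where "N m = Suc (Max (insert 0 (Poly_Mapping.keys m)))" for m :: "nat \<Rightarrow>\<^sub>0 nat"
  have N_keys: "i < N m" if "i \<in> Poly_Mapping.keys m" for i m
    using that by (simp add: N_def less_Suc_eq_le)
  have mon_eq: "mon [0..<k] m = mon [0..<N m] m" if "N m \<le> k" for k m
    using that
  proof (induction k rule: dec_induct)
    case (step k)
    then have "Poly_Mapping.lookup m k = 0" using N_keys[of k m] by (auto simp: in_keys_iff)
    then show ?case using step by (simp add: mon_def)
  qed simp
  \<comment> \<open>The start vector \<open>(0, const q)\<close> selects the right column of the
    matrix of a polynomial, whose top entry is the value of the derivation and whose bottom entry is
    the polynomial itself (\<open>snd_L\<close>).\<close>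
  define f where "f m q = mon [0..<N m] m (0, const q)" for m q
  have f_add: "f m (q + q') = f m q + f m q'" for m q q'
    unfolding f_def by (simp add: single_add flip: mon_add)
  have f_zero: "f m 0 = 0" for m using f_add[of m 0 0] by simp
  define L where "L p = (\<Sum>m\<in>Poly_Mapping.keys p. f m (Poly_Mapping.lookup p m))" for p
  have L_add: "L (p + p') = L p + L p'" for p p'
    unfolding L_def by (rule setsum_keys_plus_distrib) (simp_all add: f_zero f_add)
  have L_single: "L (Poly_Mapping.single m q) = f m q" for m q
    by (cases "q = 0") (simp_all add: L_def f_zero)
  have f_step: "f (Poly_Mapping.single i 1 + m) q = A i (f m q)" for i m q
  proof -
    let ?m = "Poly_Mapping.single i 1 + m"
    define k where "k = max (N ?m) (max (N m) (Suc i))"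
    have "mon [0..<k] ?m = mon [0..<N ?m] ?m" by (rule mon_eq) (simp add: k_def)
    then have "f ?m q = mon [0..<k] ?m (0, const q)" by (simp add: f_def)
    also have "mon [0..<k] ?m = A i \<circ> mon [0..<k] m" by (rule mon_step) (auto simp: k_def)
    also have "(A i \<circ> mon [0..<k] m) (0, const q) = A i (mon [0..<k] m (0, const q))" by simp
    also have "mon [0..<k] m = mon [0..<N m] m" by (rule mon_eq) (simp add: k_def)
    finally show ?thesis by (simp add: f_def)
  qed
  have L_pvar: "L (pvar i * p) = A i (L p)" for i p
  proof (induction p rule: single_induct)
    case zero
    show ?case by (simp add: L_def A_def zero_prod_def)
  next
    case (single p m q)
    then show ?case by (simp only: distrib_left L_add pvar_mult_single L_single f_step A_add)
  qed
  have L_const: "L (const q) = (0, const q)" for q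
  proof -
    have "mon l 0 = id" for l by (induction l) (simp_all add: mon_def)
    then show ?thesis by (simp add: L_single f_def)
  qed
  have snd_L: "snd (L p) = p" for p
    by (induction p rule: upoly_induct) (simp_all add: L_const L_pvar L_add A_def split_beta)
  show ?thesis
  proof (rule that)
    show "fst (L (p + p')) = fst (L p) + fst (L p')" for p p' by (simp add: L_add)
    show "fst (L (const q)) = 0" for q by (simp add: L_const)
    show "fst (L (pvar i * p)) = \<sigma> i * fst (L p) + b i * p" for i p
      by (simp add: L_pvar A_def split_beta snd_L)
  qed
qed

text \<open>Constants commute with the variables, so linearity over them propagates along the
  Leibniz rule.\<close>

lemma twisted_derivation_const:
  assumes "\<And>p p'. \<Delta> (p + p') = \<Delta> p + \<Delta> p'" "\<And>q. \<Delta> (const q) = 0"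
    and "\<And>i p. \<Delta> (pvar i * p) = \<sigma> i * \<Delta> p + b i * p"
  shows "\<Delta> (const q * p) = const q * \<Delta> p"
proof (induction p rule: upoly_induct)
  case (const q')
  show ?case by (simp add: mult_single assms(2))
next
  case (pvar i p)
  have "\<Delta> (const q * (pvar i * p)) = \<Delta> (pvar i * (const q * p))"
    by (rule arg_cong[OF mult.left_commute])
  also have "\<dots> = \<sigma> i * \<Delta> (const q * p) + b i * (const q * p)" by (rule assms(3))
  also have "\<dots> = const q * \<Delta> (pvar i * p)"
    by (simp only: pvar assms(3) distrib_left mult.left_commute)
  finally show ?case .
qed (simp add: assms(1) distrib_left)

end

section \<open>Reflections\<close>

context cherednik_datum
begin

lemma dual_diff: "x \<in> dual_space \<Longrightarrow> x (v - w) = x v - x w"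
  using dual_space_iff[of x] by (metis add_diff_cancel_right' diff_add_cancel)

lemma rep_diff: "g \<in> carrier G \<Longrightarrow> \<rho> g (v - w) = \<rho> g v - \<rho> g w"
  using rep_add[of g "v - w" w] by simp

lemma fixed_iff:
  assumes "s \<in> reflections"
  shows "\<alpha> s v = 0 \<longleftrightarrow> \<rho> s v = v"
proof -
  have "\<alpha> s v = 0 \<longleftrightarrow> v \<in> fixed_space s" using root_kernel[OF assms] by blast
  also have "\<dots> \<longleftrightarrow> \<rho> s v = v"
    unfolding fixed_space_def mem_Collect_eq right_minus_eq by (rule eq_commute)
  finally show ?thesis .
qed

text \<open>Subtracting a multiple of \<open>\<alpha>v s\<close> brings \<open>v\<close> into the
  kernel of \<open>\<alpha> s\<close>, where \<open>s\<close> acts trivially. Hence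
  \<open>id - s\<close> has rank one and its image is the line of
  \<open>\<alpha>v s\<close>.\<close>

lemma reflection_formula:
  assumes s: "s \<in> reflections" and d: "\<alpha> s (\<alpha>v s) \<noteq> 0"
  obtains \<mu> where "\<And>v. v - \<rho> s v = scale (\<mu> * \<alpha> s v) (\<alpha>v s)"
proof -
  have sG: "s \<in> carrier G" by (rule reflections_closed[OF s])
  have \<alpha>: "\<alpha> s (v + w) = \<alpha> s v + \<alpha> s w" "\<alpha> s (scale a v) = a * \<alpha> s v" for v w a
    using root_dual[OF s] by (simp_all add: dual_space_iff)
  have *: "v - \<rho> s v = scale (\<alpha> s v / \<alpha> s (\<alpha>v s)) (\<alpha>v s - \<rho> s (\<alpha>v s))" for v
  proof -
    let ?w = "v - scale (\<alpha> s v / \<alpha> s (\<alpha>v s)) (\<alpha>v s)"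
    have "\<alpha> s ?w = 0" using d by (simp add: \<alpha> dual_diff[OF root_dual[OF s]])
    then have "\<rho> s ?w = ?w" by (simp only: fixed_iff[OF s])
    then show ?thesis by (simp add: rep_diff[OF sG] rep_scale[OF sG] scale_right_diff_distrib algebra_simps)
  qed
  \<comment> \<open>The constant is \<open>\<mu> = 1 / \<alpha> s w\<close> for any such
    \<open>w\<close>.\<close>
  obtain w where w: "\<alpha>v s = w - \<rho> s w" using coroot_image[OF s] by blast
  then have eq: "\<alpha>v s = scale (\<alpha> s w / \<alpha> s (\<alpha>v s)) (\<alpha>v s - \<rho> s (\<alpha>v s))" using *[of w] by simp
  then have "\<alpha> s w \<noteq> 0" using coroot_nonzero[OF s] by auto
  have "scale (\<alpha> s (\<alpha>v s) / \<alpha> s w) (\<alpha>v s) = \<alpha>v s - \<rho> s (\<alpha>v s)"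
    using \<open>\<alpha> s w \<noteq> 0\<close> d by (subst (2) eq) simp
  then have "v - \<rho> s v = scale (1 / \<alpha> s w * \<alpha> s v) (\<alpha>v s)" for v
    using *[of v] d by (metis (no_types, lifting) divide_inverse_commute mult.commute nonzero_eq_divide_eq
        scale_scale times_divide_eq_left mult_1 times_divide_eq_right)
  then show ?thesis by (rule that)
qed

text \<open>\<open>\<rho> g\<close> maps the fixed space of \<open>s\<close> bijectively onto that
  of the conjugate, so the two dimensions agree.\<close>

lemma reflections_conj:
  assumes g: "g \<in> carrier G" and s: "s \<in> reflections"
  shows "g \<otimes> s \<otimes> inv g \<in> reflections"
proof -
  have sG: "s \<in> carrier G" by (rule reflections_closed[OF s])
  have fixed: "fixed_space (g \<otimes> s \<otimes> inv g) = \<rho> g ` fixed_space s"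
  proof (intro equalityI subsetI)
    fix v assume "v \<in> fixed_space (g \<otimes> s \<otimes> inv g)"
    then have "v = \<rho> g (\<rho> s (\<rho> (inv g) v))" using g sG by (simp add: fixed_space_def rep_mult)
    then have "\<rho> (inv g) v = \<rho> s (\<rho> (inv g) v)" using g by (metis rep_inv(2))
    then show "v \<in> \<rho> g ` fixed_space s"
      using g by (intro image_eqI[of _ _ "\<rho> (inv g) v"]) (simp_all add: fixed_space_def)
  qed (use g sG in \<open>auto simp: fixed_space_def rep_mult\<close>)
  interpret g: Vector_Spaces.linear scale scale "\<rho> g" by (rule rep_linear[OF g])
  have inj: "inj_on (\<rho> g) S" for S using g by (metis rep_inv(2) inj_onI)
  obtain B where B: "B \<subseteq> fixed_space s" "independent B" "fixed_space s \<subseteq> span B" "card B = dim (fixed_space s)"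
    by (rule basis_exists)
  have "span (\<rho> g ` B) = span (\<rho> g ` fixed_space s)"
    using B(1,3) by (simp add: g.span_image) (metis span_mono span_span subset_antisym)
  then have "dim (\<rho> g ` fixed_space s) = card (\<rho> g ` B)"
    by (rule dim_eq_card) (rule g.independent_injective_image[OF B(2) inj])
  also have "\<dots> = dim (fixed_space s)" using B(4) card_image[OF inj] by simp
  finally show ?thesis using s sG g by (simp add: reflections_def fixed)
qed

lemma conj_class_conj:
  assumes g: "g \<in> carrier G" and s: "s \<in> carrier G"
  shows "conj_class G (g \<otimes> s \<otimes> inv g) = conj_class G s"
proof -
  have sub: "conj_class G (g \<otimes> s \<otimes> inv g) \<subseteq> conj_class G s" if "g \<in> carrier G" "s \<in> carrier G" for g s
  proof
    fix z assume "z \<in> conj_class G (g \<otimes> s \<otimes> inv g)"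
    then obtain h where h: "h \<in> carrier G" "z = h \<otimes> (g \<otimes> s \<otimes> inv g) \<otimes> inv h"
      by (auto simp: conj_class_def)
    then have "z = (h \<otimes> g) \<otimes> s \<otimes> inv (h \<otimes> g)" using that by (simp add: inv_mult_group m_assoc)
    then show "z \<in> conj_class G s" unfolding conj_class_def using h that by blast
  qed
  have "inv g \<otimes> (g \<otimes> s \<otimes> inv g) \<otimes> inv (inv g) = s"
    using g s by (simp add: m_assoc) (simp add: m_assoc[symmetric])
  then show ?thesis using sub[OF g s] sub[of "inv g" "g \<otimes> s \<otimes> inv g"] g s by auto
qed

text \<open>The root and coroot chosen for the conjugate need not be the transported ones of
  \<open>s\<close>. They are proportional to them, since kernel and image are transported by
  \<open>\<rho> g\<close>, and \<open>pairing\<close> is invariant under rescaling root and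
  coroot.\<close>

lemma pairing_conj:
  assumes g: "g \<in> carrier G" and s: "s \<in> reflections" and x: "x \<in> dual_space"
    and diag: "\<And>s. s \<in> reflections \<Longrightarrow> \<alpha> s (\<alpha>v s) \<noteq> 0"
  shows "pairing (g \<otimes> s \<otimes> inv g) y x = pairing s (\<rho> (inv g) y) (\<lambda>v. x (\<rho> g v))"
proof -
  let ?s = "g \<otimes> s \<otimes> inv g"
  have s': "?s \<in> reflections" by (rule reflections_conj[OF g s])
  have sG: "s \<in> carrier G" by (rule reflections_closed[OF s])
  note dual = dual_space_iff[THEN iffD1]
  have \<alpha>: "\<alpha> r (v + w) = \<alpha> r v + \<alpha> r w" "\<alpha> r (scale a v) = a * \<alpha> r v" if "r \<in> reflections" for r v w a
    using root_dual[OF that] by (simp_all add: dual_space_iff)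
  obtain \<mu> where \<mu>: "\<And>v. v - \<rho> s v = scale (\<mu> * \<alpha> s v) (\<alpha>v s)"
    using reflection_formula[OF s diag[OF s]] by blast
  have ker: "\<alpha> ?s (\<rho> g v) = 0" if "\<alpha> s v = 0" for v
  proof -
    have "\<rho> s v = v" using that by (simp only: fixed_iff[OF s])
    then show ?thesis using g sG by (simp add: fixed_iff[OF s'] rep_mult)
  qed
  \<comment> \<open>The form \<open>\<alpha> ?s \<circ> \<rho> g\<close> vanishes on the kernel of
    \<open>\<alpha> s\<close>; the factor of proportionality is found by evaluating at
    \<open>\<alpha>v s\<close>.\<close>
  have 1: "\<alpha> ?s (\<rho> g v) = \<alpha> s v / \<alpha> s (\<alpha>v s) * \<alpha> ?s (\<rho> g (\<alpha>v s))" for v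
  proof -
    let ?a = "\<alpha> s v / \<alpha> s (\<alpha>v s)"
    have "\<alpha> s (v - scale ?a (\<alpha>v s)) = 0"
      using diag[OF s] by (simp add: \<alpha>[OF s] dual_diff[OF root_dual[OF s]])
    from ker[OF this] show ?thesis
      by (simp add: rep_diff[OF g] rep_scale[OF g] \<alpha>[OF s'] dual_diff[OF root_dual[OF s']])
  qed
  obtain w where w: "\<alpha>v ?s = w - \<rho> ?s w" using coroot_image[OF s'] by blast
  have "\<alpha>v ?s = \<rho> g (\<rho> (inv g) w - \<rho> s (\<rho> (inv g) w))"
    using w g sG by (simp add: rep_mult rep_diff)
  then have "\<alpha>v ?s = scale (\<mu> * \<alpha> s (\<rho> (inv g) w)) (\<rho> g (\<alpha>v s))"
    by (simp only: \<mu> rep_scale[OF g])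
  then obtain b where b: "\<alpha>v ?s = scale b (\<rho> g (\<alpha>v s))" by blast
  then have b0: "b \<noteq> 0" using coroot_nonzero[OF s'] by auto
  have a0: "\<alpha> ?s (\<rho> g (\<alpha>v s)) \<noteq> 0" using diag[OF s'] unfolding b by (auto simp: \<alpha>[OF s'])
  have "\<alpha> ?s y = \<alpha> s (\<rho> (inv g) y) / \<alpha> s (\<alpha>v s) * \<alpha> ?s (\<rho> g (\<alpha>v s))"
    using 1[of "\<rho> (inv g) y"] g by simp
  moreover have "x (\<alpha>v ?s) = b * x (\<rho> g (\<alpha>v s))" using x unfolding b by (simp add: dual_space_iff)
  moreover have "\<alpha> ?s (\<alpha>v ?s) = b * \<alpha> ?s (\<rho> g (\<alpha>v s))" unfolding b by (simp add: \<alpha>[OF s'])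
  ultimately show ?thesis using a0 b0 by (simp add: pairing_def)
qed

end

section \<open>Dunkl operators\<close>

locale dunkl = dual_bases scale G \<rho> \<phi> \<alpha> \<alpha>v t c n yb xb
  for scale :: "'k::field \<Rightarrow> 'v::ab_group_add \<Rightarrow> 'v"
    and G :: "('g, 'm) monoid_scheme" (structure)
    and \<rho> :: "'g \<Rightarrow> 'v \<Rightarrow> 'v"
    and \<phi> :: "'k \<Rightarrow> 'r::comm_ring"
    and \<alpha> \<alpha>v t c n yb xb +
  assumes diag: "s \<in> reflections \<Longrightarrow> \<alpha> s (\<alpha>v s) \<noteq> 0"
begin

text \<open>
  The variables of the inner polynomial ring are the \<open>y\<^sub>i\<close>, those of the outer one the \<open>x\<^sub>i\<close>;
  variables with an index outside \<open>{1..n}\<close> are treated as constants.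
\<close>

sublocale R: unital_poly "\<phi> 1"
  by unfold_locales simp

sublocale P: unital_poly "Poly_Mapping.single (0 :: nat \<Rightarrow>\<^sub>0 nat) (\<phi> 1)"
  by unfold_locales (rule R.const_unit)

definition cst :: "'r \<Rightarrow> 'r upoly upoly" where "cst r = P.const (R.const r)"

lemma cst_add: "cst (r + r') = cst r + cst r'"
  and cst_mult: "cst (r * r') = cst r * cst r'"
  and cst_zero [simp]: "cst 0 = 0"
  and cst_unit: "cst (\<phi> 1) * p = p"
  by (simp_all add: cst_def single_add mult_single P.const_unit)

lemma cst_sum: "cst (sum f F) = (\<Sum>i\<in>F. cst (f i))"
  by (induction F rule: infinite_finite_induct) (simp_all add: cst_add)

definition Xp :: "('v \<Rightarrow> 'k) \<Rightarrow> 'r upoly upoly"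
  where "Xp x = (\<Sum>i\<in>{1..n}. cst (\<phi> (x (yb i))) * P.pvar i)"

definition yp :: "'v \<Rightarrow> 'r upoly"
  where "yp y = (\<Sum>i\<in>{1..n}. R.const (\<phi> (xb i y)) * R.pvar i)"

lemma Xp_add: "Xp (\<lambda>v. x v + x' v) = Xp x + Xp x'"
  and Xp_scale: "Xp (\<lambda>v. a * x v) = cst (\<phi> a) * Xp x"
  by (simp_all add: Xp_def algebra_add algebra_mult cst_add cst_mult distrib_right sum.distrib
      sum_distrib_left mult.assoc)

lemma xb_linear: "i \<in> {1..n} \<Longrightarrow> xb i (v + w) = xb i v + xb i w"
    "i \<in> {1..n} \<Longrightarrow> xb i (scale a v) = a * xb i v"
  using xb_dual[of i] by (simp_all add: dual_space_iff)

lemma yp_add: "yp (y + y') = yp y + yp y'"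
proof -
  have "yp (y + y') = (\<Sum>i\<in>{1..n}. R.const (\<phi> (xb i y)) * R.pvar i + R.const (\<phi> (xb i y')) * R.pvar i)"
    unfolding yp_def by (rule sum.cong) (simp_all only: xb_linear algebra_add single_add distrib_right)
  then show ?thesis by (simp only: yp_def sum.distrib)
qed

lemma yp_scale: "yp (scale a y) = R.const (\<phi> a) * yp y"
proof -
  have "R.const (\<phi> (xb i (scale a y))) * R.pvar i = R.const (\<phi> a) * (R.const (\<phi> (xb i y)) * R.pvar i)"
    if "i \<in> {1..n}" for i
    by (simp only: xb_linear[OF that] algebra_mult mult.assoc[symmetric]) (simp add: mult_single)
  then show ?thesis unfolding yp_def sum_distrib_left by (rule sum.cong[OF refl])
qed

lemma Xp_xb: "i \<in> {1..n} \<Longrightarrow> Xp (xb i) = P.pvar i"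
proof -
  assume i: "i \<in> {1..n}"
  have "Xp (xb i) = (\<Sum>j\<in>{1..n}. if i = j then P.pvar j else 0)"
    unfolding Xp_def by (rule sum.cong) (simp_all add: xb_yb[OF i] cst_unit)
  then show ?thesis using i by simp
qed

lemma yp_yb: "i \<in> {1..n} \<Longrightarrow> yp (yb i) = R.pvar i"
proof -
  assume i: "i \<in> {1..n}"
  have "yp (yb i) = (\<Sum>j\<in>{1..n}. if i = j then R.pvar j else 0)"
    unfolding yp_def
  proof (rule sum.cong[OF refl])
    fix j assume "j \<in> {1..n}"
    then show "R.const (\<phi> (xb j (yb i))) * R.pvar j = (if i = j then R.pvar j else 0)"
      using xb_yb[of j i] i by (simp add: R.const_unit)
  qed
  then show ?thesis using i by simp
qed

text \<open>A twisted Leibniz rule in direction \<open>w\<close>: \<open>f = id\<close> gives the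
  derivative along \<open>w\<close>, \<open>f = \<rho> s\<close> a divided difference. It is stated
  for all linear forms, so it refers to no basis; variables outside \<open>{1..n}\<close> count as
  constants.\<close>

definition is_twist :: "('v \<Rightarrow> 'v) \<Rightarrow> 'v \<Rightarrow> ('r upoly upoly \<Rightarrow> 'r upoly upoly) \<Rightarrow> bool"
  where "is_twist f w \<Delta> \<longleftrightarrow> (\<forall>p p'. \<Delta> (p + p') = \<Delta> p + \<Delta> p') \<and> (\<forall>q. \<Delta> (P.const q) = 0) \<and>
    (\<forall>q p. \<Delta> (P.const q * p) = P.const q * \<Delta> p) \<and>
    (\<forall>i p. i \<notin> {1..n} \<longrightarrow> \<Delta> (P.pvar i * p) = P.pvar i * \<Delta> p) \<and>
    (\<forall>x p. x \<in> dual_space \<longrightarrow> \<Delta> (Xp x * p) = Xp (\<lambda>v. x (f v)) * \<Delta> p + cst (\<phi> (x w)) * p)"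

text \<open>By \<open>fw\<close>, \<open>x - x \<circ> f = x w * a\<close> for every linear form
  \<open>x\<close>. Thus the operator is \<open>p \<mapsto> (p - p \<circ> f) / a\<close> with the
  division avoided, and for \<open>a = 0\<close> it is the derivative along
  \<open>w\<close>.\<close>

lemma is_twist_exists:
  assumes f: "\<And>x. x \<in> dual_space \<Longrightarrow> (\<lambda>v. x (f v)) \<in> dual_space"
    and a: "a \<in> dual_space" and fw: "\<And>v. v - f v = scale (a v) w"
  shows "\<exists>\<Delta>. is_twist f w \<Delta>"
proof -
  define \<sigma> where "\<sigma> i = (if i \<in> {1..n} then Xp (\<lambda>v. xb i (f v)) else P.pvar i)" for i
  define b where "b i = (if i \<in> {1..n} then cst (\<phi> (xb i w)) else 0)" for i
  have \<sigma>_eq: "\<sigma> i + b i * Xp a = P.pvar i" for i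
  proof (cases "i \<in> {1..n}")
    case True
    have x: "xb i \<in> dual_space" by (rule xb_dual[OF True])
    have "xb i (f v) + xb i w * a v = xb i v" for v
      using dual_diff[OF x, of v "f v"] fw[of v] x by (simp add: dual_space_iff algebra_simps)
    then have "Xp (\<lambda>v. xb i (f v)) + cst (\<phi> (xb i w)) * Xp a = Xp (xb i)"
      by (simp flip: Xp_scale Xp_add)
    then show ?thesis using True by (simp only: \<sigma>_def b_def Xp_xb if_True)
  next
    case False
    then show ?thesis by (simp only: \<sigma>_def b_def if_False mult_zero_left add_0_right)
  qed
  \<comment> \<open>With \<open>\<sigma> i = x_i - b i * a\<close> both sides equal
    \<open>x_i * b j + x_j * b i - a * b i * b j\<close>, which is symmetric in \<open>i\<close> and
    \<open>j\<close>.\<close>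
  have comm: "\<sigma> i * b j + b i * P.pvar j = \<sigma> j * b i + b j * P.pvar i" for i j
  proof -
    have \<sigma>: "\<sigma> i = P.pvar i - b i * Xp a" for i using \<sigma>_eq[of i] by (simp add: algebra_simps)
    show ?thesis unfolding \<sigma> by (simp add: algebra_simps)
  qed
  obtain \<Delta> where \<Delta>: "\<And>p p'. \<Delta> (p + p') = \<Delta> p + \<Delta> p'" "\<And>q. \<Delta> (P.const q) = 0"
      "\<And>i p. \<Delta> (P.pvar i * p) = \<sigma> i * \<Delta> p + b i * p"
    using P.twisted_derivation[OF comm] by blast
  have const: "\<Delta> (P.const q * p) = P.const q * \<Delta> p" for q p
    by (rule P.twisted_derivation_const[OF \<Delta>])
  have zero: "\<Delta> 0 = 0" using \<Delta>(2)[of 0] by simp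
  have sum: "\<Delta> (sum g F) = (\<Sum>i\<in>F. \<Delta> (g i))" for g and F :: "nat set"
    by (induction F rule: infinite_finite_induct) (simp_all add: zero \<Delta>(1))
  have "\<Delta> (Xp x * p) = Xp (\<lambda>v. x (f v)) * \<Delta> p + cst (\<phi> (x w)) * p" if x: "x \<in> dual_space" for x p
  proof -
    have "\<Delta> (Xp x * p) = (\<Sum>i\<in>{1..n}. \<Delta> (cst (\<phi> (x (yb i))) * (P.pvar i * p)))"
      unfolding Xp_def by (simp only: sum_distrib_right sum mult.assoc)
    also have "\<dots> = (\<Sum>i\<in>{1..n}. cst (\<phi> (x (yb i))) * Xp (\<lambda>v. xb i (f v)) * \<Delta> p
        + cst (\<phi> (x (yb i) * xb i w)) * p)"
    proof (rule sum.cong[OF refl])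
      fix i assume i: "i \<in> {1..n}"
      have "\<sigma> i = Xp (\<lambda>v. xb i (f v))" "b i = cst (\<phi> (xb i w))" using i by (simp_all add: \<sigma>_def b_def)
      moreover have "\<Delta> (cst r * p) = cst r * \<Delta> p" for r p unfolding cst_def by (rule const)
      ultimately show "\<Delta> (cst (\<phi> (x (yb i))) * (P.pvar i * p)) =
          cst (\<phi> (x (yb i))) * Xp (\<lambda>v. xb i (f v)) * \<Delta> p + cst (\<phi> (x (yb i) * xb i w)) * p"
        by (simp only: \<Delta>(3) algebra_mult cst_mult distrib_left mult.assoc)
    qed
    also have "\<dots> = (\<Sum>i\<in>{1..n}. cst (\<phi> (x (yb i))) * Xp (\<lambda>v. xb i (f v))) * \<Delta> p
        + cst (\<phi> (\<Sum>i\<in>{1..n}. x (yb i) * xb i w)) * p"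
      by (simp only: sum.distrib sum_distrib_right cst_sum algebra_sum)
    also have "(\<Sum>i\<in>{1..n}. x (yb i) * xb i w) = x w" by (rule dual_expand[OF x, symmetric])
    also have "(\<Sum>i\<in>{1..n}. cst (\<phi> (x (yb i))) * Xp (\<lambda>v. xb i (f v))) = Xp (\<lambda>v. x (f v))"
    proof -
      have "Xp (\<lambda>v. \<Sum>i\<in>F. x (yb i) * xb i (f v)) = (\<Sum>i\<in>F. cst (\<phi> (x (yb i))) * Xp (\<lambda>v. xb i (f v)))"
        if "finite F" for F
        using that
      proof (induction F rule: finite_induct)
        case empty
        show ?case by (simp add: Xp_def)
      qed (simp add: Xp_add Xp_scale)
      from this[OF finite_atLeastAtMost, of 1 n] show ?thesis by (simp only: dual_expand[OF x, symmetric])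
    qed
    finally show ?thesis .
  qed
  then have "is_twist f w \<Delta>"
    unfolding is_twist_def using \<Delta> const by (simp add: \<sigma>_def b_def)
  then show ?thesis by blast
qed

text \<open>The rules of \<open>is_twist\<close> determine an operator completely, so the choice
  yields the partial derivative with respect to \<open>x_i\<close>.\<close>

definition pd :: "nat \<Rightarrow> 'r upoly upoly \<Rightarrow> 'r upoly upoly"
  where "pd i = (SOME \<Delta>. is_twist (\<lambda>v. v) (yb i) \<Delta>)"

text \<open>The coroot is normalized so that \<open>\<alpha> s y\<close> times the correction term
  of the Leibniz rule for \<open>x\<close> is \<open>pairing s y x\<close>.\<close>

definition Ds :: "'g \<Rightarrow> 'r upoly upoly \<Rightarrow> 'r upoly upoly"
  where "Ds s = (SOME \<Delta>. is_twist (\<rho> s) (scale (1 / \<alpha> s (\<alpha>v s)) (\<alpha>v s)) \<Delta>)"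

lemma pd_twist: "is_twist (\<lambda>v. v) (yb i) (pd i)"
proof -
  have "\<exists>\<Delta>. is_twist (\<lambda>v. v) (yb i) \<Delta>" by (rule is_twist_exists[of _ "\<lambda>v. 0"]; simp)
  then show ?thesis unfolding pd_def by (rule someI_ex)
qed

lemma Ds_twist:
  assumes s: "s \<in> reflections"
  shows "is_twist (\<rho> s) (scale (1 / \<alpha> s (\<alpha>v s)) (\<alpha>v s)) (Ds s)"
proof -
  obtain \<mu> where \<mu>: "\<And>v. v - \<rho> s v = scale (\<mu> * \<alpha> s v) (\<alpha>v s)"
    using reflection_formula[OF s diag[OF s]] by blast
  have "\<exists>\<Delta>. is_twist (\<rho> s) (scale (1 / \<alpha> s (\<alpha>v s)) (\<alpha>v s)) \<Delta>"
  \<comment> \<open>The form comes from \<open>reflection_formula\<close>; the factor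
    \<open>\<alpha> s (\<alpha>v s)\<close> compensates for the normalization of the coroot.\<close>
  proof (rule is_twist_exists[of _ "\<lambda>v. \<alpha> s (\<alpha>v s) * \<mu> * \<alpha> s v"])
    show "(\<lambda>v. x (\<rho> s v)) \<in> dual_space" if "x \<in> dual_space" for x
      by (rule dual_action[OF that reflections_closed[OF s]])
    show "(\<lambda>v. \<alpha> s (\<alpha>v s) * \<mu> * \<alpha> s v) \<in> dual_space"
      by (rule dual_scale[OF root_dual[OF s]])
    show "v - \<rho> s v = scale (\<alpha> s (\<alpha>v s) * \<mu> * \<alpha> s v) (scale (1 / \<alpha> s (\<alpha>v s)) (\<alpha>v s))" for v
      using diag[OF s] by (simp add: \<mu>)
  qed
  then show ?thesis unfolding Ds_def by (rule someI_ex)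
qed

definition dv :: "'v \<Rightarrow> 'r upoly upoly \<Rightarrow> 'r upoly upoly"
  where "dv y p = (\<Sum>i\<in>{1..n}. cst (\<phi> (xb i y)) * pd i p)"

lemma twist_add: "is_twist f w \<Delta> \<Longrightarrow> \<Delta> (p + p') = \<Delta> p + \<Delta> p'"
  and twist_const: "is_twist f w \<Delta> \<Longrightarrow> \<Delta> (P.const q) = 0"
  and twist_const_mult: "is_twist f w \<Delta> \<Longrightarrow> \<Delta> (P.const q * p) = P.const q * \<Delta> p"
  and twist_pvar: "is_twist f w \<Delta> \<Longrightarrow> i \<notin> {1..n} \<Longrightarrow> \<Delta> (P.pvar i * p) = P.pvar i * \<Delta> p"
  and twist_Xp: "is_twist f w \<Delta> \<Longrightarrow> x \<in> dual_space \<Longrightarrow>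
    \<Delta> (Xp x * p) = Xp (\<lambda>v. x (f v)) * \<Delta> p + cst (\<phi> (x w)) * p"
  unfolding is_twist_def by blast+

lemma twist_zero: "is_twist f w \<Delta> \<Longrightarrow> \<Delta> 0 = 0"
  using twist_const[of f w \<Delta> 0] by simp

lemma dv_add: "dv y (p + p') = dv y p + dv y p'"
  and dv_const: "dv y (P.const q) = 0"
  and dv_const_mult: "dv y (P.const q * p) = P.const q * dv y p"
  unfolding dv_def
  by (simp_all only: twist_add[OF pd_twist] twist_const[OF pd_twist] twist_const_mult[OF pd_twist]
      distrib_left sum.distrib mult_zero_right sum.neutral_const sum_distrib_left mult.left_commute)

lemma dv_pvar:
  assumes "i \<notin> {1..n}"
  shows "dv y (P.pvar i * p) = P.pvar i * dv y p"
  unfolding dv_def sum_distrib_left twist_pvar[OF pd_twist assms]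
  by (rule sum.cong[OF refl]) (rule mult.left_commute)

lemma dv_Xp:
  assumes x: "x \<in> dual_space"
  shows "dv y (Xp x * p) = Xp x * dv y p + cst (\<phi> (x y)) * p"
proof -
  have "dv y (Xp x * p) = (\<Sum>i\<in>{1..n}. Xp x * (cst (\<phi> (xb i y)) * pd i p) + cst (\<phi> (x (yb i) * xb i y)) * p)"
    unfolding dv_def
    by (rule sum.cong) (simp_all add: twist_Xp[OF pd_twist x] distrib_left algebra_mult cst_mult
        mult.left_commute mult.assoc)
  also have "\<dots> = Xp x * dv y p + cst (\<phi> (\<Sum>i\<in>{1..n}. x (yb i) * xb i y)) * p"
    unfolding dv_def by (simp only: sum.distrib sum_distrib_left sum_distrib_right cst_sum algebra_sum)
  finally show ?thesis by (simp only: dual_expand[OF x, symmetric])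
qed

lemma dv_linear: "dv (y + y') p = dv y p + dv y' p" "dv (scale a y) p = cst (\<phi> a) * dv y p"
proof -
  have "dv (y + y') p = (\<Sum>i\<in>{1..n}. cst (\<phi> (xb i y)) * pd i p + cst (\<phi> (xb i y')) * pd i p)"
    unfolding dv_def by (rule sum.cong) (simp_all only: xb_linear algebra_add cst_add distrib_right)
  then show "dv (y + y') p = dv y p + dv y' p" by (simp only: dv_def sum.distrib)
  show "dv (scale a y) p = cst (\<phi> a) * dv y p"
    unfolding dv_def sum_distrib_left
    by (rule sum.cong) (simp_all only: xb_linear algebra_mult cst_mult mult.assoc)
qed

end

lemma sum_apply: "(\<Sum>i\<in>S. f i) x = (\<Sum>i\<in>S. f i x)"
  by (induction S rule: infinite_finite_induct) simp_all

section \<open>The induced module and its operators\<close>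

context dunkl
begin

text \<open>
  The underlying module is induced from the polynomials: \<open>F\<close> stands for the sum of the
  \<open>h (F h)\<close>, so that \<open>G\<close> acts by translations only.
\<close>

definition sc :: "'r \<Rightarrow> ('g \<Rightarrow> 'r upoly upoly) \<Rightarrow> 'g \<Rightarrow> 'r upoly upoly"
  where "sc r F = (\<lambda>h. cst r * F h)"

text \<open>Moving \<open>x\<close> to the right past \<open>h\<close> turns it into
  \<open>h^-1 x = x \<circ> \<rho> h\<close>.\<close>

definition X_op :: "('v \<Rightarrow> 'k) \<Rightarrow> ('g \<Rightarrow> 'r upoly upoly) \<Rightarrow> 'g \<Rightarrow> 'r upoly upoly"
  where "X_op x F = (\<lambda>h. if h \<in> carrier G then Xp (\<lambda>v. x (\<rho> h v)) * F h else 0)"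

definition G_op :: "'g \<Rightarrow> ('g \<Rightarrow> 'r upoly upoly) \<Rightarrow> 'g \<Rightarrow> 'r upoly upoly"
  where "G_op g F = (\<lambda>h. if h \<in> carrier G then F (inv g \<otimes> h) else 0)"

text \<open>The part of the Dunkl operator that preserves the component of \<open>h\<close>;
  \<open>y\<close> has first been moved past \<open>h\<close> and become
  \<open>h^-1 y\<close>.\<close>

definition DB :: "'v \<Rightarrow> ('g \<Rightarrow> 'r upoly upoly) \<Rightarrow> 'g \<Rightarrow> 'r upoly upoly"
  where "DB y F h = P.const (yp (\<rho> (inv h) y)) * F h + cst t * dv (\<rho> (inv h) y) (F h)"

text \<open>The reflection \<open>s\<close> sends the component of \<open>k = h s^-1\<close> to that
  of \<open>h\<close>: moving \<open>k^-1 y\<close> past a polynomial \<open>p\<close> leaves a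
  multiple of \<open>s (Ds s p)\<close>. As \<open>s\<close> is written in front of the polynomial,
  \<open>Ds s\<close> is the divided difference for \<open>s^-1\<close>, that is,
  \<open>(p - p \<circ> s)\<close> over a multiple of \<open>\<alpha> s\<close>.\<close>

definition DE :: "'g \<Rightarrow> 'v \<Rightarrow> ('g \<Rightarrow> 'r upoly upoly) \<Rightarrow> 'g \<Rightarrow> 'r upoly upoly"
  where "DE s y F h = cst (c (conj_class G s) * \<phi> (\<alpha> s (\<rho> (inv (h \<otimes> inv s)) y))) * Ds s (F (h \<otimes> inv s))"

definition D_op :: "'v \<Rightarrow> ('g \<Rightarrow> 'r upoly upoly) \<Rightarrow> 'g \<Rightarrow> 'r upoly upoly"
  where "D_op y F = (\<lambda>h. if h \<in> carrier G then DB y F h + (\<Sum>s\<in>reflections. DE s y F h) else 0)"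

sublocale scalar_action sc "\<phi> 1"
  by unfold_locales
    (simp_all add: sc_def fun_eq_iff cst_add cst_mult cst_unit distrib_left distrib_right mult.assoc)

lemma X_op_linear: "linear_op (X_op x)"
  by (simp add: linear_op_def X_op_def sc_def fun_eq_iff distrib_left mult.left_commute)

lemma G_op_linear: "linear_op (G_op g)"
  by (simp add: linear_op_def G_op_def sc_def fun_eq_iff)

lemma DB_add: "DB y (F + F') h = DB y F h + DB y F' h"
  by (simp add: DB_def dv_add distrib_left add.assoc add.left_commute)

lemma DB_sc: "DB y (sc r F) h = cst r * DB y F h"
  by (simp add: DB_def sc_def cst_def dv_const_mult distrib_left mult.left_commute)

lemma DE_add: "s \<in> reflections \<Longrightarrow> DE s y (F + F') h = DE s y F h + DE s y F' h"
  by (simp add: DE_def twist_add[OF Ds_twist] distrib_left)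

lemma DE_sc: "s \<in> reflections \<Longrightarrow> DE s y (sc r F) h = cst r * DE s y F h"
  by (simp add: DE_def sc_def cst_def twist_const_mult[OF Ds_twist] mult.left_commute)

lemma D_op_linear: "linear_op (D_op y)"
  unfolding linear_op_def
proof (intro conjI allI ext)
  fix F F' r h
  have "(\<Sum>s\<in>reflections. DE s y (F + F') h) = (\<Sum>s\<in>reflections. DE s y F h) + (\<Sum>s\<in>reflections. DE s y F' h)"
    by (simp add: DE_add sum.distrib)
  then show "D_op y (F + F') h = (D_op y F + D_op y F') h"
    by (simp add: D_op_def DB_add add.assoc add.left_commute)
  have "(\<Sum>s\<in>reflections. DE s y (sc r F) h) = cst r * (\<Sum>s\<in>reflections. DE s y F h)"
    by (simp add: DE_sc sum_distrib_left)
  then show "D_op y (sc r F) h = sc r (D_op y F) h"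
    by (simp add: D_op_def DB_sc distrib_left) (simp add: sc_def D_op_def distrib_left)
qed

lemma DE_y:
  assumes "s \<in> reflections" "h \<in> carrier G"
  shows "DE s (y + y') F h = DE s y F h + DE s y' F h" "DE s (scale a y) F h = cst (\<phi> a) * DE s y F h"
proof -
  have "inv (h \<otimes> inv s) \<in> carrier G" using assms reflections_closed by simp
  note r = rep_add[OF this] rep_scale[OF this]
  have \<alpha>: "\<alpha> s (v + w) = \<alpha> s v + \<alpha> s w" "\<alpha> s (scale a v) = a * \<alpha> s v" for v w
    using root_dual[OF assms(1)] by (simp_all add: dual_space_iff)
  show "DE s (y + y') F h = DE s y F h + DE s y' F h"
    by (simp only: DE_def r \<alpha> algebra_add distrib_left cst_add distrib_right)
  show "DE s (scale a y) F h = cst (\<phi> a) * DE s y F h"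
    by (simp only: DE_def r \<alpha> algebra_mult cst_mult ac_simps)
qed

lemma DB_y:
  assumes "h \<in> carrier G"
  shows "DB (y + y') F h = DB y F h + DB y' F h" "DB (scale a y) F h = cst (\<phi> a) * DB y F h"
proof -
  have "inv h \<in> carrier G" using assms by simp
  note r = rep_add[OF this] rep_scale[OF this]
  show "DB (y + y') F h = DB y F h + DB y' F h"
    by (simp add: DB_def r yp_add dv_linear single_add algebra_simps)
  have const: "P.const (R.const (\<phi> a) * q) = cst (\<phi> a) * P.const q" for q
    by (simp add: cst_def mult_single)
  show "DB (scale a y) F h = cst (\<phi> a) * DB y F h"
    by (simp only: DB_def r yp_scale dv_linear const distrib_left mult.assoc mult.left_commute)
qed

lemma D_op_y: "D_op (y + y') F = D_op y F + D_op y' F" "D_op (scale a y) F = sc (\<phi> a) (D_op y F)"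
proof -
  show "D_op (y + y') F = D_op y F + D_op y' F"
  proof
    fix h show "D_op (y + y') F h = (D_op y F + D_op y' F) h"
    proof (cases "h \<in> carrier G")
      case True
      have "(\<Sum>s\<in>reflections. DE s (y + y') F h) = (\<Sum>s\<in>reflections. DE s y F h) + (\<Sum>s\<in>reflections. DE s y' F h)"
        using True by (simp add: DE_y sum.distrib)
      then show ?thesis using True by (simp add: D_op_def DB_y add.assoc add.left_commute)
    qed (simp add: D_op_def)
  qed
  show "D_op (scale a y) F = sc (\<phi> a) (D_op y F)"
  proof
    fix h show "D_op (scale a y) F h = sc (\<phi> a) (D_op y F) h"
    proof (cases "h \<in> carrier G")
      case True
      have "(\<Sum>s\<in>reflections. DE s (scale a y) F h) = cst (\<phi> a) * (\<Sum>s\<in>reflections. DE s y F h)"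
        using True by (simp add: DE_y sum_distrib_left)
      then show ?thesis using True by (simp add: D_op_def DB_y sc_def distrib_left)
    qed (simp add: D_op_def sc_def)
  qed
qed

lemma G_op_mult: "g \<in> carrier G \<Longrightarrow> h \<in> carrier G \<Longrightarrow> G_op (g \<otimes> h) F = G_op g (G_op h F)"
  by (simp add: G_op_def fun_eq_iff inv_mult_group m_assoc)

lemma G_op_X:
  assumes g: "g \<in> carrier G"
  shows "G_op g (X_op x F) = X_op (\<lambda>v. x (\<rho> (inv g) v)) (G_op g F)"
  using g by (simp add: G_op_def X_op_def fun_eq_iff rep_mult)

text \<open>\<open>D_op\<close> depends on \<open>h\<close> and \<open>y\<close> only through
  vectors such as \<open>\<rho> (inv h) y\<close>, which do not change when \<open>h\<close> and
  \<open>y\<close> are both moved by \<open>g\<close>.\<close>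

lemma G_op_D:
  assumes g: "g \<in> carrier G"
  shows "G_op g (D_op y F) = D_op (\<rho> g y) (G_op g F)"
proof
  fix h
  show "G_op g (D_op y F) h = D_op (\<rho> g y) (G_op g F) h"
  proof (cases "h \<in> carrier G")
    case h: True
    have "\<rho> (inv (inv g \<otimes> h)) y = \<rho> (inv h) (\<rho> g y)" using g h by (simp add: inv_mult_group rep_mult)
    then have B: "DB y F (inv g \<otimes> h) = DB (\<rho> g y) (G_op g F) h" using h by (simp add: DB_def G_op_def)
    have "DE s y F (inv g \<otimes> h) = DE s (\<rho> g y) (G_op g F) h" if s: "s \<in> reflections" for s
    proof -
      have sG: "s \<in> carrier G" by (rule reflections_closed[OF s])
      have "\<rho> (inv (inv g \<otimes> h \<otimes> inv s)) y = \<rho> (inv (h \<otimes> inv s)) (\<rho> g y)"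
        using g h sG by (simp add: inv_mult_group rep_mult)
      then show ?thesis using g h sG by (simp add: DE_def G_op_def m_assoc)
    qed
    then show ?thesis using g h B by (simp add: D_op_def G_op_def)
  qed (simp add: G_op_def D_op_def)
qed

lemma DB_X:
  assumes h: "h \<in> carrier G" and x: "x \<in> dual_space"
  shows "DB y (X_op x F) h = Xp (\<lambda>v. x (\<rho> h v)) * DB y F h + cst (t * \<phi> (x y)) * F h"
  using h dv_Xp[OF dual_action[OF x h], of "\<rho> (inv h) y" "F h"]
  by (simp add: DB_def X_op_def cst_mult algebra_simps)

text \<open>The Leibniz rule at \<open>k = h s^-1\<close> yields the pairing of \<open>s\<close>
  with the data moved by \<open>k\<close>. This is the pairing of \<open>k s k^-1 = h s h^-1\<close>
  with the original data, and \<open>c\<close> has the same value on both reflections.\<close>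

lemma DE_X:
  assumes h: "h \<in> carrier G" and x: "x \<in> dual_space" and s: "s \<in> reflections"
  shows "DE s y (X_op x F) h = Xp (\<lambda>v. x (\<rho> h v)) * DE s y F h +
    cst (\<phi> (pairing (h \<otimes> s \<otimes> inv h) y x) * c (conj_class G (h \<otimes> s \<otimes> inv h))) * F (h \<otimes> inv s)"
proof -
  have sG: "s \<in> carrier G" by (rule reflections_closed[OF s])
  let ?k = "h \<otimes> inv s"
  have k: "?k \<in> carrier G" using h sG by simp
  have "?k \<otimes> s \<otimes> inv ?k = h \<otimes> s \<otimes> inv h"
  proof -
    have "?k \<otimes> s = h" using h sG by (simp add: m_assoc)
    then show ?thesis using h sG by (simp add: inv_mult_group m_assoc)
  qed
  then have pair: "pairing (h \<otimes> s \<otimes> inv h) y x = pairing s (\<rho> (inv ?k) y) (\<lambda>v. x (\<rho> ?k v))"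
    using pairing_conj[OF k s x diag] by simp
  have "\<rho> ?k (\<rho> s v) = \<rho> h v" for v
    using h sG by (simp add: rep_mult)
  then have tw: "Ds s (Xp (\<lambda>v. x (\<rho> ?k v)) * F ?k) = Xp (\<lambda>v. x (\<rho> h v)) * Ds s (F ?k) +
      cst (\<phi> (x (\<rho> ?k (scale (1 / \<alpha> s (\<alpha>v s)) (\<alpha>v s))))) * F ?k"
    using twist_Xp[OF Ds_twist[OF s] dual_action[OF x k], of "F ?k"] by simp
  have "\<alpha> s (\<rho> (inv ?k) y) * x (\<rho> ?k (scale (1 / \<alpha> s (\<alpha>v s)) (\<alpha>v s))) = pairing s (\<rho> (inv ?k) y) (\<lambda>v. x (\<rho> ?k v))"
    using x by (simp add: rep_scale[OF k] pairing_def dual_space_iff)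
  then have "c (conj_class G s) * \<phi> (\<alpha> s (\<rho> (inv ?k) y)) * \<phi> (x (\<rho> ?k (scale (1 / \<alpha> s (\<alpha>v s)) (\<alpha>v s)))) =
      \<phi> (pairing (h \<otimes> s \<otimes> inv h) y x) * c (conj_class G (h \<otimes> s \<otimes> inv h))"
    by (simp only: pair conj_class_conj[OF h sG] algebra_mult[symmetric] mult.assoc mult.commute)
  then have coeff: "cst (\<phi> (pairing (h \<otimes> s \<otimes> inv h) y x) * c (conj_class G (h \<otimes> s \<otimes> inv h))) =
      cst (c (conj_class G s) * \<phi> (\<alpha> s (\<rho> (inv ?k) y))) *
      cst (\<phi> (x (\<rho> ?k (scale (1 / \<alpha> s (\<alpha>v s)) (\<alpha>v s)))))"
    by (simp only: cst_mult[symmetric])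
  have "X_op x F ?k = Xp (\<lambda>v. x (\<rho> ?k v)) * F ?k" using k by (simp add: X_op_def)
  then show ?thesis
    unfolding DE_def coeff
    by (simp only: tw distrib_left mult.assoc mult.left_commute)
qed

text \<open>Under the substitution of \<open>h s h^-1\<close> for \<open>s\<close>, the argument
  \<open>h s^-1\<close> of \<open>DE\<close> becomes \<open>s^-1 h\<close>, the place where
  \<open>G_op s\<close> evaluates.\<close>

lemma reflections_reindex:
  assumes h: "h \<in> carrier G"
  shows "(\<Sum>s\<in>reflections. f (h \<otimes> s \<otimes> inv h) (h \<otimes> inv s)) = (\<Sum>s\<in>reflections. f s (inv s \<otimes> h))"
proof -
  have inj: "inj_on (\<lambda>s. h \<otimes> s \<otimes> inv h) reflections"
    using h reflections_closed by (intro inj_onI) (simp add: m_assoc)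
  have "s \<in> (\<lambda>s. h \<otimes> s \<otimes> inv h) ` reflections" if s: "s \<in> reflections" for s
  proof
    show "inv h \<otimes> s \<otimes> inv (inv h) \<in> reflections" by (rule reflections_conj) (use h s in simp_all)
    show "s = h \<otimes> (inv h \<otimes> s \<otimes> inv (inv h)) \<otimes> inv h"
      using h reflections_closed[OF s] by (simp add: m_assoc) (simp add: m_assoc[symmetric])
  qed
  then have "(\<lambda>s. h \<otimes> s \<otimes> inv h) ` reflections = reflections" using reflections_conj[OF h] by blast
  then have "(\<Sum>s\<in>reflections. f s (inv s \<otimes> h)) = (\<Sum>s\<in>reflections. f (h \<otimes> s \<otimes> inv h) (inv (h \<otimes> s \<otimes> inv h) \<otimes> h))"
    using sum.reindex[OF inj, of "\<lambda>s. f s (inv s \<otimes> h)"] by simp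
  also have "\<dots> = (\<Sum>s\<in>reflections. f (h \<otimes> s \<otimes> inv h) (h \<otimes> inv s))"
    using h reflections_closed by (intro sum.cong) (simp_all add: inv_mult_group m_assoc)
  finally show ?thesis by simp
qed

lemma D_X_op:
  assumes x: "x \<in> dual_space"
  shows "D_op y (X_op x F) = X_op x (D_op y F) + (sc (t * \<phi> (x y)) (G_op \<one> F) +
      (\<Sum>s\<in>reflections. sc (\<phi> (pairing s y x) * c (conj_class G s)) (G_op s F)))"
proof
  fix h
  show "D_op y (X_op x F) h = (X_op x (D_op y F) + (sc (t * \<phi> (x y)) (G_op \<one> F) +
      (\<Sum>s\<in>reflections. sc (\<phi> (pairing s y x) * c (conj_class G s)) (G_op s F)))) h"
  proof (cases "h \<in> carrier G")
    case h: True
    have "(\<Sum>s\<in>reflections. DE s y (X_op x F) h) = Xp (\<lambda>v. x (\<rho> h v)) * (\<Sum>s\<in>reflections. DE s y F h) +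
        (\<Sum>s\<in>reflections. cst (\<phi> (pairing (h \<otimes> s \<otimes> inv h) y x) * c (conj_class G (h \<otimes> s \<otimes> inv h))) * F (h \<otimes> inv s))"
      unfolding sum_distrib_left sum.distrib[symmetric] by (rule sum.cong[OF refl]) (rule DE_X[OF h x])
    also have "(\<Sum>s\<in>reflections. cst (\<phi> (pairing (h \<otimes> s \<otimes> inv h) y x) * c (conj_class G (h \<otimes> s \<otimes> inv h))) * F (h \<otimes> inv s))
        = (\<Sum>s\<in>reflections. cst (\<phi> (pairing s y x) * c (conj_class G s)) * F (inv s \<otimes> h))"
      by (rule reflections_reindex[OF h, of "\<lambda>s k. cst (\<phi> (pairing s y x) * c (conj_class G s)) * F k"])
    finally show ?thesis
      using h by (simp add: D_op_def DB_X[OF h x] sum_apply)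
        (simp add: X_op_def G_op_def sc_def D_op_def distrib_left add.assoc add.left_commute)
  qed (simp add: D_op_def X_op_def sc_def G_op_def sum_apply)
qed

lemma X_op_commute: "X_op x (X_op x' F) = X_op x' (X_op x F)"
  by (simp add: X_op_def fun_eq_iff mult.left_commute)

lemma X_op_add: "X_op (\<lambda>v. x v + x' v) F = X_op x F + X_op x' F"
  and X_op_scale: "X_op (\<lambda>v. a * x v) F = sc (\<phi> a) (X_op x F)"
  by (simp_all add: X_op_def sc_def fun_eq_iff Xp_add Xp_scale distrib_right mult.assoc)

subsection \<open>Commutativity of the Dunkl operators\<close>

definition comm_D :: "'v \<Rightarrow> 'v \<Rightarrow> ('g \<Rightarrow> 'r upoly upoly) \<Rightarrow> 'g \<Rightarrow> 'r upoly upoly"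
  where "comm_D y y' F = D_op y (D_op y' F) - D_op y' (D_op y F)"

lemma D_op_add: "D_op y (F + F') = D_op y F + D_op y F'"
  and D_op_sc: "D_op y (sc r F) = sc r (D_op y F)"
  and X_op_plus: "X_op x (F + F') = X_op x F + X_op x F'"
  using D_op_linear[of y] X_op_linear[of x] by (simp_all add: linear_op_def)

lemma D_op_sum: "D_op y (sum f J) = (\<Sum>i\<in>J. D_op y (f i))"
  by (rule linear_op_sum[OF D_op_linear])

lemma X_op_minus: "X_op x (F - F') = X_op x F - X_op x F'"
  using X_op_plus[of x "F - F'" F'] by (simp add: algebra_simps)

lemma comm_D_add: "comm_D y y' (F + F') = comm_D y y' F + comm_D y y' F'"
  by (simp add: comm_D_def D_op_add)

text \<open>\<open>y' - s y'\<close> is the multiple \<open>\<mu> * \<alpha> s y'\<close> of the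
  coroot, and \<open>pairing s y x\<close> is proportional to \<open>\<alpha> s y\<close>. So
  \<open>pairing s y x\<close> times the operator of \<open>y' - s y'\<close> is symmetric in
  \<open>y\<close> and \<open>y'\<close>; the lemma states this without subtraction.\<close>

lemma D_op_reflection:
  assumes s: "s \<in> reflections"
  shows "sc (\<phi> (pairing s y x) * r) (D_op (\<rho> s y') F) + sc (\<phi> (pairing s y' x) * r) (D_op y F) =
    sc (\<phi> (pairing s y' x) * r) (D_op (\<rho> s y) F) + sc (\<phi> (pairing s y x) * r) (D_op y' F)"
proof -
  obtain \<mu> where \<mu>: "\<And>v. v - \<rho> s v = scale (\<mu> * \<alpha> s v) (\<alpha>v s)"
    using reflection_formula[OF s diag[OF s]] by blast
  have D: "D_op v F = D_op (\<rho> s v) F + sc (\<phi> (\<mu> * \<alpha> s v)) (D_op (\<alpha>v s) F)" for v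
  proof -
    have "v = \<rho> s v + scale (\<mu> * \<alpha> s v) (\<alpha>v s)" by (simp flip: \<mu>)
    then have "D_op v F = D_op (\<rho> s v + scale (\<mu> * \<alpha> s v) (\<alpha>v s)) F" by simp
    then show ?thesis by (simp only: D_op_y)
  qed
  have "pairing s y' x * (\<mu> * \<alpha> s y) = pairing s y x * (\<mu> * \<alpha> s y')"
    by (simp add: pairing_def)
  then have "\<phi> (pairing s y' x) * \<phi> (\<mu> * \<alpha> s y) = \<phi> (pairing s y x) * \<phi> (\<mu> * \<alpha> s y')"
    by (simp only: algebra_mult[symmetric])
  then have "(\<phi> (pairing s y' x) * r) * \<phi> (\<mu> * \<alpha> s y) = (\<phi> (pairing s y x) * r) * \<phi> (\<mu> * \<alpha> s y')"
    by (metis mult.assoc mult.commute)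
  then have "sc (\<phi> (pairing s y' x) * r) (sc (\<phi> (\<mu> * \<alpha> s y)) H) = sc (\<phi> (pairing s y x) * r) (sc (\<phi> (\<mu> * \<alpha> s y')) H)" for H
    by (simp only: sc_sc[symmetric])
  then show ?thesis
    by (simp only: D[of y] D[of y'] sc_add_right add.assoc add.left_commute add.commute)
qed

text \<open>Moving \<open>x\<close> out of a product of two Dunkl operators leaves terms in
  \<open>t\<close>, symmetric in \<open>y\<close> and \<open>y'\<close>, and reflection terms,
  symmetric by \<open>D_op_reflection\<close>. Both cancel in the commutator.\<close>

lemma comm_D_X:
  assumes x: "x \<in> dual_space"
  shows "comm_D y y' (X_op x F) = X_op x (comm_D y y' F)"
proof -
  let ?a = "\<lambda>y s. \<phi> (pairing s y x) * c (conj_class G s)"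
  have DD: "D_op y (D_op y' (X_op x F)) = X_op x (D_op y (D_op y' F)) +
     (sc (t * \<phi> (x y)) (D_op y' (G_op \<one> F)) + sc (t * \<phi> (x y')) (D_op y (G_op \<one> F)) +
      (\<Sum>s\<in>reflections. sc (?a y s) (D_op (\<rho> s y') (G_op s F)) + sc (?a y' s) (D_op y (G_op s F))))" for y y'
  proof -
    have "(\<Sum>s\<in>reflections. sc (?a y s) (G_op s (D_op y' F))) = (\<Sum>s\<in>reflections. sc (?a y s) (D_op (\<rho> s y') (G_op s F)))"
      by (rule sum.cong) (simp_all add: G_op_D reflections_closed)
    moreover have "G_op \<one> (D_op y' F) = D_op y' (G_op \<one> F)" by (simp add: G_op_D rep_one)
    ultimately show ?thesis
      by (simp add: D_X_op[OF x] D_op_add D_op_sc D_op_sum sum.distrib add_ac)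
  qed
  have "(\<Sum>s\<in>reflections. sc (?a y s) (D_op (\<rho> s y') (G_op s F)) + sc (?a y' s) (D_op y (G_op s F))) =
      (\<Sum>s\<in>reflections. sc (?a y' s) (D_op (\<rho> s y) (G_op s F)) + sc (?a y s) (D_op y' (G_op s F)))"
    by (rule sum.cong[OF refl]) (rule D_op_reflection)
  then show ?thesis
    unfolding comm_D_def DD X_op_minus by (simp add: add.commute)
qed

text \<open>The element \<open>g p\<close> of the induced module.\<close>

definition delta :: "'g \<Rightarrow> 'r upoly upoly \<Rightarrow> 'g \<Rightarrow> 'r upoly upoly"
  where "delta g p = (\<lambda>h. if h = g then p else 0)"

lemma dv_zero: "dv y 0 = 0"
  using dv_const[of y 0] by simp

text \<open>Derivatives and divided differences kill polynomials free of the \<open>x_i\<close>, and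
  only multiplication by a linear form in the \<open>y_i\<close> remains. On this generating part
  the Dunkl operators visibly commute.\<close>

lemma D_delta_const:
  assumes g: "g \<in> carrier G"
  shows "D_op y (delta g (P.const q)) = delta g (P.const (yp (\<rho> (inv g) y) * q))"
proof
  fix h
  have "DE s y (delta g (P.const q)) h = 0" if s: "s \<in> reflections" for s
    by (simp add: DE_def delta_def twist_zero[OF Ds_twist[OF s]] twist_const[OF Ds_twist[OF s]])
  then show "D_op y (delta g (P.const q)) h = delta g (P.const (yp (\<rho> (inv g) y) * q)) h"
    using g by (simp add: D_op_def DB_def) (auto simp: delta_def dv_const dv_zero mult_single)
qed

lemma X_delta: "g \<in> carrier G \<Longrightarrow> X_op x (delta g p) = delta g (Xp (\<lambda>v. x (\<rho> g v)) * p)"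
  by (auto simp: X_op_def delta_def)

lemma G_delta: "g \<in> carrier G \<Longrightarrow> k \<in> carrier G \<Longrightarrow> G_op g (delta k p) = delta (g \<otimes> k) p"
  by (auto simp: G_op_def delta_def fun_eq_iff inv_solve_left')

lemma D_pvar:
  assumes i: "i \<notin> {1..n}"
  shows "D_op y (\<lambda>h. P.pvar i * F h) = (\<lambda>h. P.pvar i * D_op y F h)"
proof
  fix h
  have "(\<Sum>s\<in>reflections. DE s y (\<lambda>h. P.pvar i * F h) h) = P.pvar i * (\<Sum>s\<in>reflections. DE s y F h)"
    unfolding sum_distrib_left
    by (rule sum.cong[OF refl]) (simp only: DE_def twist_pvar[OF Ds_twist i] mult.left_commute)
  then show "D_op y (\<lambda>h. P.pvar i * F h) h = P.pvar i * D_op y F h"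
    unfolding D_op_def DB_def dv_pvar[OF i] by (simp only: distrib_left mult.left_commute split: if_split) simp
qed

lemma delta_add: "delta g (p + p') = delta g p + delta g p'"
  by (auto simp: delta_def)

text \<open>In the component of \<open>\<one>\<close>, multiplication by \<open>x_i\<close> is
  \<open>X_op (xb i)\<close>, which commutes with the commutator. A variable outside
  \<open>{1..n}\<close> commutes with each Dunkl operator.\<close>

lemma comm_D_delta_one: "comm_D y y' (delta \<one> p) = 0"
proof (induction p rule: P.upoly_induct)
  case (const q)
  show ?case by (simp add: comm_D_def D_delta_const mult.left_commute)
next
  case (pvar i p)
  show ?case
  proof (cases "i \<in> {1..n}")
    case True
    have "delta \<one> (P.pvar i * p) = X_op (xb i) (delta \<one> p)"
      using Xp_xb[OF True] by (simp add: X_delta rep_one)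
    then have "comm_D y y' (delta \<one> (P.pvar i * p)) = X_op (xb i) 0"
      by (simp only: comm_D_X[OF xb_dual[OF True]] pvar)
    then show ?thesis using linear_op_zero[OF X_op_linear] by simp
  next
    case False
    have *: "delta \<one> (P.pvar i * p) = (\<lambda>h. P.pvar i * delta \<one> p h)" by (auto simp: delta_def)
    have "comm_D y y' (delta \<one> (P.pvar i * p)) = (\<lambda>h. P.pvar i * comm_D y y' (delta \<one> p) h)"
      by (rule ext) (simp add: comm_D_def * D_pvar[OF False] right_diff_distrib)
    then show ?thesis using pvar by (simp add: fun_eq_iff)
  qed
next
  case (add p p')
  show ?case by (simp only: delta_add comm_D_add add add_0_left)
qed

lemma D_op_G_one: "D_op y F = D_op y (G_op \<one> F)"
proof
  fix h
  have "DE s y F h = DE s y (G_op \<one> F) h" if "s \<in> reflections" "h \<in> carrier G" for s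
    using that reflections_closed by (simp add: DE_def G_op_def)
  then show "D_op y F h = D_op y (G_op \<one> F) h"
    by (simp add: D_op_def DB_def) (simp add: G_op_def)
qed

text \<open>Translation by \<open>g\<close> carries the result from the component of
  \<open>\<one>\<close> to that of \<open>g\<close>. Values of \<open>F\<close> off the group are
  removed by \<open>D_op_G_one\<close>, after which \<open>F\<close> is a finite sum of such
  components.\<close>

lemma comm_D_zero: "comm_D y y' F = 0"
proof -
  have delta: "comm_D y y' (delta g p) = 0" if g: "g \<in> carrier G" for g p
  proof -
    have G0: "G_op g 0 = 0" by (rule linear_op_zero[OF G_op_linear])
    have Gd: "G_op g (H - H') = G_op g H - G_op g H'" for H H' by (auto simp: G_op_def)
    have "comm_D y y' (delta g p) = comm_D y y' (G_op g (delta \<one> p))" using g by (simp add: G_delta)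
    also have "\<dots> = G_op g (comm_D (\<rho> (inv g) y) (\<rho> (inv g) y') (delta \<one> p))"
      using g by (simp add: comm_D_def Gd G_op_D)
    finally show ?thesis by (simp add: comm_D_delta_one G0)
  qed
  have zero: "comm_D y y' 0 = 0" using comm_D_add[of y y' 0 0] by simp
  have "comm_D y y' (\<Sum>g\<in>J. delta g (F g)) = 0" if "J \<subseteq> carrier G" "finite J" for J
    using that(2,1)
  proof (induction J rule: finite_induct)
    case empty
    show ?case by (simp only: sum.empty zero)
  next
    case (insert g J)
    then have "g \<in> carrier G" "comm_D y y' (\<Sum>g\<in>J. delta g (F g)) = 0" by auto
    then show ?case by (simp only: sum.insert[OF insert(1,2)] comm_D_add delta add_0_left)
  qed
  moreover have "G_op \<one> F = (\<Sum>g\<in>carrier G. delta g (F g))"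
    by (auto simp: fun_eq_iff sum_apply G_op_def delta_def finite_group)
  ultimately have "comm_D y y' (G_op \<one> F) = 0" using finite_group by simp
  then show ?thesis by (simp add: comm_D_def flip: D_op_G_one)
qed

sublocale ops: cherednik_operators scale G \<rho> \<phi> \<alpha> \<alpha>v t c sc X_op D_op G_op
proof
  show "D_op y (D_op y' F) = D_op y' (D_op y F)" for y y' F
    using comm_D_zero[of y y' F] by (simp add: comm_D_def)
qed (rule X_op_linear D_op_linear G_op_linear X_op_add X_op_scale D_op_y G_op_mult G_op_X G_op_D
    X_op_commute D_X_op; assumption)+

end

section \<open>Linear independence of the monomials\<close>

text \<open>Summing along a list matches the \<open>foldr\<close> in
  \<open>ordered_monomial\<close>.\<close>

definition exponent :: "nat list \<Rightarrow> (nat \<Rightarrow> nat) \<Rightarrow> nat \<Rightarrow>\<^sub>0 nat"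
  where "exponent l a = (\<Sum>i\<leftarrow>l. Poly_Mapping.single i (a i))"

lemma lookup_exponent: "distinct l \<Longrightarrow> i \<in> set l \<Longrightarrow> Poly_Mapping.lookup (exponent l a) i = a i"
proof (induction l)
  case (Cons j l)
  have "Poly_Mapping.lookup (exponent l a) j = 0" if "j \<notin> set l" for j l
    using that unfolding exponent_def by (induction l) (simp_all add: lookup_add lookup_single)
  then show ?case using Cons by (auto simp: exponent_def lookup_add lookup_single when_def)
qed simp

lemma (in unital_poly) foldr_pvar:
  "foldr (\<lambda>i p. (((*) (pvar i)) ^^ a i) p) l (Poly_Mapping.single m q) =
    Poly_Mapping.single (exponent l a + m) q"
proof (induction l)
  case (Cons i l)
  have "(((*) (pvar i)) ^^ k) (Poly_Mapping.single m q) =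
      Poly_Mapping.single (Poly_Mapping.single i k + m) q" for k m
  proof (induction k)
    case (Suc k)
    have "Poly_Mapping.single i 1 + (Poly_Mapping.single i k + m) = Poly_Mapping.single i (Suc k) + m"
      by (simp add: add.assoc[symmetric] single_add[symmetric])
    then show ?case by (simp add: Suc pvar_mult_single)
  qed simp
  then show ?case by (simp add: Cons exponent_def add.assoc)
qed (simp add: exponent_def)

section \<open>Reading off coefficients in the representation\<close>

locale pbw_dunkl =
  dunkl scale G \<rho> \<phi> \<alpha> \<alpha>v t c n yb xb + pbw_relations scale G \<rho> \<phi> \<alpha> \<alpha>v t c A X Y \<Gamma> n yb xb
  for scale :: "'k::field \<Rightarrow> 'v::ab_group_add \<Rightarrow> 'v"
    and G :: "('g, 'm) monoid_scheme" (structure)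
    and \<rho> :: "'g \<Rightarrow> 'v \<Rightarrow> 'v"
    and \<phi> :: "'k \<Rightarrow> 'r::comm_ring"
    and \<alpha> \<alpha>v t c n yb xb
    and A :: "('r, 'a) module" and X Y \<Gamma> +
  fixes \<psi> :: "'a \<Rightarrow> ('g \<Rightarrow> 'r upoly upoly) \<Rightarrow> 'g \<Rightarrow> 'r upoly upoly"
  assumes \<psi>: "is_representation A \<psi>"
    and \<psi>_Y: "\<psi> (Y y) F = D_op y (G_op \<one> F)"
    and \<psi>_X: "x \<in> dual_space \<Longrightarrow> \<psi> (X x) F = X_op x (G_op \<one> F)"
    and \<psi>_\<Gamma>: "g \<in> carrier G \<Longrightarrow> \<psi> (\<Gamma> g) F = G_op g F"
begin

sublocale AR: algebra_representation sc "\<phi> 1" A \<psi>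
  by unfold_locales (rule \<psi>)

text \<open>The trailing factor \<open>p\<close> absorbs the empty product at the end of the
  \<open>foldr\<close>, whose operator need not be the identity.\<close>

lemma rep_foldr:
  assumes "\<And>i. i \<in> set l \<Longrightarrow> z i \<in> carrier A" "p \<in> carrier A"
  shows "\<psi> (foldr (\<lambda>i p. (z i [^]\<^bsub>A\<^esub> (a i :: nat)) \<otimes>\<^bsub>A\<^esub> p) l \<one>\<^bsub>A\<^esub> \<otimes>\<^bsub>A\<^esub> p) F =
    foldr (\<lambda>i F. (\<psi> (z i) ^^ a i) F) l (\<psi> p F)"
  using assms(1)
proof (induction l)
  case (Cons i l)
  let ?q = "foldr (\<lambda>i p. (z i [^]\<^bsub>A\<^esub> a i) \<otimes>\<^bsub>A\<^esub> p) l \<one>\<^bsub>A\<^esub>"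
  have zi: "z i \<in> carrier A" using Cons.prems by simp
  have q: "?q \<in> carrier A" by (rule A.foldr_monomial_closed) (use Cons.prems in simp)
  have pow: "\<psi> ((z i [^]\<^bsub>A\<^esub> k) \<otimes>\<^bsub>A\<^esub> w) F = (\<psi> (z i) ^^ k) (\<psi> w F)" if "w \<in> carrier A" for w and k :: nat
    using that
  proof (induction k arbitrary: w)
    case (Suc k)
    have "(z i [^]\<^bsub>A\<^esub> Suc k) \<otimes>\<^bsub>A\<^esub> w = (z i [^]\<^bsub>A\<^esub> k) \<otimes>\<^bsub>A\<^esub> (z i \<otimes>\<^bsub>A\<^esub> w)"
      using zi Suc.prems by (simp add: A.m_assoc)
    then have "\<psi> ((z i [^]\<^bsub>A\<^esub> Suc k) \<otimes>\<^bsub>A\<^esub> w) F = (\<psi> (z i) ^^ k) (\<psi> (z i \<otimes>\<^bsub>A\<^esub> w) F)"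
      using Suc.IH[OF A.m_closed[OF zi Suc.prems]] by (simp only:)
    then show ?case by (simp only: AR.rep_mult[OF zi Suc.prems] funpow.simps comp_apply funpow_swap1)
  qed simp
  have "(z i [^]\<^bsub>A\<^esub> a i) \<otimes>\<^bsub>A\<^esub> ?q \<otimes>\<^bsub>A\<^esub> p = (z i [^]\<^bsub>A\<^esub> a i) \<otimes>\<^bsub>A\<^esub> (?q \<otimes>\<^bsub>A\<^esub> p)"
    using zi q assms(2) by (simp add: A.m_assoc)
  then show ?case using pow[of "?q \<otimes>\<^bsub>A\<^esub> p" "a i"] q assms(2) Cons by simp
qed (use assms(2) in simp)

lemma G_one_delta: "k \<in> carrier G \<Longrightarrow> G_op \<one> (delta k p) = delta k p"
  using G_delta[of \<one> k p] by simp

lemma Y_pow_delta: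
  assumes k: "k \<in> carrier G"
  shows "(\<psi> (Y y) ^^ j) (delta k (P.const q)) = delta k (P.const (((*) (yp (\<rho> (inv k) y)) ^^ j) q))"
  by (induction j) (use k in \<open>simp_all add: \<psi>_Y G_one_delta D_delta_const\<close>)

lemma X_pow_delta:
  assumes k: "k \<in> carrier G" and x: "x \<in> dual_space"
  shows "(\<psi> (X x) ^^ j) (delta k p) = delta k (((*) (Xp (\<lambda>v. x (\<rho> k v))) ^^ j) p)"
  by (induction j) (use k x in \<open>simp_all add: \<psi>_X G_one_delta X_delta\<close>)

abbreviation "ix \<equiv> [1..<Suc n]"

text \<open>The constant polynomial 1, so that \<open>delta k vac\<close> is the group element
  \<open>k\<close> in the module.\<close>

definition vac :: "'r upoly upoly" where "vac = P.const (R.const (\<phi> 1))"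

text \<open>The monomial sends \<open>k\<close> to \<open>x^a y^b g k\<close>. Written with
  \<open>h = g k\<close> in front, its variables are twisted by \<open>h\<close>; but only the
  component of \<open>\<one>\<close> is inspected, and there the twist is trivial.\<close>

lemma pbw_vacuum:
  assumes j: "(a, b, g) \<in> pbw_index n G" and k: "k \<in> carrier G"
  shows "\<psi> (pbw_element (a, b, g)) (delta k vac) \<one> = (if g \<otimes> k = \<one> then
    Poly_Mapping.single (exponent ix a) (Poly_Mapping.single (exponent ix b) (\<phi> 1)) else 0)"
proof -
  have g: "g \<in> carrier G" using j by (simp add: pbw_index_def)
  define h where "h = g \<otimes> k"
  have h: "h \<in> carrier G" using g k by (simp add: h_def)
  have ix: "set ix = {1..n}" by auto
  have "pbw_element (a, b, g) = Xm a \<otimes>\<^bsub>A\<^esub> (Ym b \<otimes>\<^bsub>A\<^esub> \<Gamma> g)"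
    using g by (simp add: pbw_element_def A.m_assoc)
  then have "\<psi> (pbw_element (a, b, g)) (delta k vac) = foldr (\<lambda>i F. (\<psi> (X (xb i)) ^^ a i) F) ix
      (\<psi> (Ym b \<otimes>\<^bsub>A\<^esub> \<Gamma> g) (delta k vac))"
    unfolding ordered_monomial_def[of A n "\<lambda>i. X (xb i)"]
    using rep_foldr[of ix "\<lambda>i. X (xb i)" "Ym b \<otimes>\<^bsub>A\<^esub> \<Gamma> g" a "delta k vac"] g ix xb_dual
    by (simp del: upt_Suc)
  also have "\<psi> (Ym b \<otimes>\<^bsub>A\<^esub> \<Gamma> g) (delta k vac) = foldr (\<lambda>i F. (\<psi> (Y (yb i)) ^^ b i) F) ix (delta h vac)"
    unfolding ordered_monomial_def[of A n "\<lambda>i. Y (yb i)"]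
    using rep_foldr[of ix "\<lambda>i. Y (yb i)" "\<Gamma> g" b "delta k vac"] g k
    by (simp add: \<psi>_\<Gamma> G_delta h_def del: upt_Suc)
  also have "foldr (\<lambda>i F. (\<psi> (Y (yb i)) ^^ b i) F) l (delta h vac) =
      delta h (P.const (foldr (\<lambda>i q. (((*) (yp (\<rho> (inv h) (yb i)))) ^^ b i) q) l (R.const (\<phi> 1))))" for l
    unfolding vac_def by (induction l) (simp_all add: Y_pow_delta[OF h])
  also have "foldr (\<lambda>i F. (\<psi> (X (xb i)) ^^ a i) F) l (delta h p) =
      delta h (foldr (\<lambda>i p. (((*) (Xp (\<lambda>v. xb i (\<rho> h v)))) ^^ a i) p) l p)" if "set l \<subseteq> {1..n}" for l p
    using that by (induction l) (simp_all add: X_pow_delta[OF h] xb_dual)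
  finally have eq: "\<psi> (pbw_element (a, b, g)) (delta k vac) =
      delta h (foldr (\<lambda>i p. (((*) (Xp (\<lambda>v. xb i (\<rho> h v)))) ^^ a i) p) ix
        (P.const (foldr (\<lambda>i q. (((*) (yp (\<rho> (inv h) (yb i)))) ^^ b i) q) ix (R.const (\<phi> 1)))))"
    using ix by simp
  show ?thesis
  proof (cases "h = \<one>")
    case True
    have "foldr (\<lambda>i q. (((*) (yp (\<rho> (inv h) (yb i)))) ^^ b i) q) ix (R.const (\<phi> 1)) =
        foldr (\<lambda>i q. (((*) (R.pvar i)) ^^ b i) q) ix (R.const (\<phi> 1))"
      by (rule foldr_cong) (use ix True in \<open>simp_all add: rep_one yp_yb del: upt_Suc\<close>)
    moreover have "foldr (\<lambda>i p. (((*) (Xp (\<lambda>v. xb i (\<rho> h v)))) ^^ a i) p) ix q =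
        foldr (\<lambda>i p. (((*) (P.pvar i)) ^^ a i) p) ix q" for q
      by (rule foldr_cong) (use ix True in \<open>simp_all add: rep_one Xp_xb del: upt_Suc\<close>)
    ultimately show ?thesis
      unfolding eq h_def[symmetric] using True
      by (simp add: delta_def R.foldr_pvar P.foldr_pvar del: upt_Suc)
  next
    case False
    then show ?thesis unfolding eq h_def[symmetric] by (simp add: delta_def)
  qed
qed

text \<open>Applying the relation to \<open>g0^-1\<close> and looking at the component of
  \<open>\<one>\<close> keeps just the terms with \<open>g = g0\<close>; the coefficient at the
  exponents \<open>a0\<close>, \<open>b0\<close> then isolates \<open>r j0\<close>.\<close>

lemma pbw_independent:
  assumes F: "finite F" "F \<subseteq> pbw_index n G"
    and zero: "(\<Oplus>\<^bsub>A\<^esub>j\<in>F. r j \<odot>\<^bsub>A\<^esub> pbw_element j) = \<zero>\<^bsub>A\<^esub>" and j0: "j0 \<in> F"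
  shows "r j0 = 0"
proof -
  obtain a0 b0 g0 where j0_eq: "j0 = (a0, b0, g0)" by (cases j0)
  have idx: "a0 \<in> {1..n} \<rightarrow>\<^sub>E UNIV" "b0 \<in> {1..n} \<rightarrow>\<^sub>E UNIV" "g0 \<in> carrier G"
    using F j0 j0_eq by (auto simp: pbw_index_def)
  let ?m = "delta (inv g0) vac"
  have c: "pbw_element j \<in> carrier A" if "j \<in> F" for j using that F pbw_closed by blast
  have "\<psi> (\<Oplus>\<^bsub>A\<^esub>j\<in>F. r j \<odot>\<^bsub>A\<^esub> pbw_element j) ?m = (\<Sum>j\<in>F. sc (r j) (\<psi> (pbw_element j) ?m))"
    by (simp add: AR.rep_finsum[OF F(1)] c AR.rep_smult)
  then have "(\<Sum>j\<in>F. sc (r j) (\<psi> (pbw_element j) ?m)) \<one> = 0"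
    unfolding zero AR.rep_zero by simp
  then have sum0: "(\<Sum>j\<in>F. cst (r j) * \<psi> (pbw_element j) ?m \<one>) = 0"
    by (simp add: sum_apply sc_def)
  let ?look = "\<lambda>p. Poly_Mapping.lookup (Poly_Mapping.lookup p (exponent ix a0)) (exponent ix b0)"
  have "?look (cst (r j) * \<psi> (pbw_element j) ?m \<one>) = (if j = j0 then r j else 0)" if j: "j \<in> F" for j
  proof -
    obtain a b g where j_eq: "j = (a, b, g)" by (cases j)
    have ji: "(a, b, g) \<in> pbw_index n G" using j F j_eq by blast
    have g: "g \<otimes> inv g0 = \<one> \<longleftrightarrow> g = g0"
      using ji idx inv_solve_right'[of \<one> g "g0"] by (auto simp: pbw_index_def)
    \<comment> \<open>Extensional exponent functions are determined by their values on
      \<open>{1..n}\<close>, which \<open>exponent\<close> records.\<close>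
    have inj: "exponent ix a = exponent ix a' \<longleftrightarrow> a = a'"
      if "a \<in> {1..n} \<rightarrow>\<^sub>E UNIV" "a' \<in> {1..n} \<rightarrow>\<^sub>E UNIV" for a a' :: "nat \<Rightarrow> nat"
    proof
      assume eq: "exponent ix a = exponent ix a'"
      have "a i = a' i" if "i \<in> {1..n}" for i
      proof -
        have i: "distinct ix" "i \<in> set ix" using that by (simp_all add: less_Suc_eq_le del: upt_Suc)
        show ?thesis using lookup_exponent[OF i, of a] lookup_exponent[OF i, of a'] by (simp only: eq)
      qed
      then show "a = a'" using that by (intro PiE_ext) auto
    qed simp
    have ab: "a \<in> {1..n} \<rightarrow>\<^sub>E UNIV" "b \<in> {1..n} \<rightarrow>\<^sub>E UNIV" using ji by (auto simp: pbw_index_def)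
    show ?thesis
      unfolding j_eq j0_eq pbw_vacuum[OF ji inv_closed[OF idx(3)]] g
      using inj[OF ab(1) idx(1)] inj[OF ab(2) idx(2)]
      by (auto simp: cst_def mult_single lookup_single when_def simp del: upt_Suc)
  qed
  then have "?look (\<Sum>j\<in>F. cst (r j) * \<psi> (pbw_element j) ?m \<one>) = (\<Sum>j\<in>F. if j = j0 then r j else 0)"
    by (simp add: lookup_sum)
  then show ?thesis using sum0 F(1) j0 by simp
qed

lemma pbw_is_basis: "is_basis A (pbw_index n G) pbw_element"
  by (rule A.is_basisI) (use pbw_closed pbw_span pbw_independent in blast)+

end

theorem mainTheorem5:
  fixes scale :: "'k::field \<Rightarrow> 'v::ab_group_add \<Rightarrow> 'v"
    and G :: "('g, 'm) monoid_scheme"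
    and \<rho> :: "'g \<Rightarrow> 'v \<Rightarrow> 'v"
    and \<phi> :: "'k \<Rightarrow> 'r::comm_ring"
    and \<alpha> :: "'g \<Rightarrow> 'v \<Rightarrow> 'k"
    and \<alpha>v :: "'g \<Rightarrow> 'v"
    and t :: 'r
    and c :: "'g set \<Rightarrow> 'r"
    and n :: nat
    and y :: "nat \<Rightarrow> 'v"
    and x :: "nat \<Rightarrow> 'v \<Rightarrow> 'k"
  assumes datum: "cherednik_datum scale G \<rho> \<phi> \<alpha> \<alpha>v"
    and diag: "\<forall>s \<in> group_representation.reflections scale G \<rho>.
                 cherednik_datum.diagonalizable \<alpha> \<alpha>v s"
    and basis: "vector_space.basis_family scale n y"
    and dual_basis: "vector_space.dual_family scale n y x"
  shows "is_basis (cherednik_datum.cherednik_algebra scale G \<rho> \<phi> \<alpha> \<alpha>v t c)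
           (pbw_index n G)
           (cherednik_datum.cherednik_pbw scale G \<rho> \<phi> \<alpha> \<alpha>v t c n x y) \<and>
         (\<exists>!f. cherednik_datum.is_pbw_morphism scale G \<rho> \<phi> \<alpha> \<alpha>v t c n x y f) \<and>
         (\<forall>f. cherednik_datum.is_pbw_morphism scale G \<rho> \<phi> \<alpha> \<alpha>v t c n x y f \<longrightarrow>
           bij_betw f
             (carrier (cherednik_datum.symmetric_semidirect scale G \<rho> \<phi>))
             (carrier (cherednik_datum.cherednik_algebra scale G \<rho> \<phi> \<alpha> \<alpha>v t c)))"
proof -
  interpret D: cherednik_datum scale G \<rho> \<phi> \<alpha> \<alpha>v t c by (rule datum)
  \<comment> \<open>\<open>t\<close> and \<open>c\<close> are free parameters of the locale, so this
    one fact yields both the instance for \<open>H_{t,c}\<close> and the one with zero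
    parameters.\<close>
  have dunkl: "dunkl scale G \<rho> \<phi> \<alpha> \<alpha>v n y x"
    using datum basis dual_basis diag
    by (simp add: dunkl_def dual_bases_def dual_bases_axioms_def dunkl_axioms_def D.diagonalizable_def)
  interpret D1: dunkl scale G \<rho> \<phi> \<alpha> \<alpha>v t c n y x by (rule dunkl)
  interpret D0: dunkl scale G \<rho> \<phi> \<alpha> \<alpha>v 0 "\<lambda>_. 0" n y x by (rule dunkl)
  have H: "is_basis D.cherednik_algebra (pbw_index n G) (D.cherednik_pbw n x y)"
  proof -
    obtain \<psi> where \<psi>: "D1.is_representation D.cherednik_algebra \<psi>"
      "\<And>y m. \<psi> (D.cherednik_V y) m = D1.D_op y (D1.G_op \<one>\<^bsub>G\<^esub> m)"
      "\<And>x m. x \<in> D.dual_space \<Longrightarrow> \<psi> (D.cherednik_dual x) m = D1.X_op x (D1.G_op \<one>\<^bsub>G\<^esub> m)"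
      "\<And>g m. g \<in> carrier G \<Longrightarrow> \<psi> (D.cherednik_G g) m = D1.G_op g m"
      using D1.ops.cherednik_representation by blast
    interpret B: pbw_dunkl scale G \<rho> \<phi> \<alpha> \<alpha>v t c n y x D.cherednik_algebra D.cherednik_dual
        D.cherednik_V D.cherednik_G \<psi>
      by (intro pbw_dunkl.intro pbw_relations.intro pbw_dunkl_axioms.intro dunkl
          D.cherednik_algebra_relations D1.dual_bases_axioms \<psi>)
    show ?thesis using B.pbw_is_basis by (simp add: B.pbw_element_def D.cherednik_pbw_def)
  qed
  have S: "is_basis D.symmetric_semidirect (pbw_index n G) (D.symmetric_pbw n x y)"
  proof -
    \<comment> \<open>The module and its scalar action are shared by \<open>D0\<close> and
      \<open>D1\<close>; only the Dunkl operators differ between the two.\<close>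
    obtain \<psi> where \<psi>: "D1.is_representation D.symmetric_semidirect \<psi>"
      "\<And>y m. \<psi> (D.symmetric_V y) m = D0.D_op y (D0.G_op \<one>\<^bsub>G\<^esub> m)"
      "\<And>x m. x \<in> D.dual_space \<Longrightarrow> \<psi> (D.symmetric_dual x) m = D0.X_op x (D0.G_op \<one>\<^bsub>G\<^esub> m)"
      "\<And>g m. g \<in> carrier G \<Longrightarrow> \<psi> (D.symmetric_G g) m = D0.G_op g m"
      using D0.ops.symmetric_representation[OF refl refl] by blast
    interpret B: pbw_dunkl scale G \<rho> \<phi> \<alpha> \<alpha>v 0 "\<lambda>_. 0" n y x D.symmetric_semidirect D.symmetric_dual
        D.symmetric_V D.symmetric_G \<psi>
      by (intro pbw_dunkl.intro pbw_relations.intro pbw_dunkl_axioms.intro dunkl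
          D.symmetric_relations D0.dual_bases_axioms \<psi>)
    show ?thesis using B.pbw_is_basis by (simp add: B.pbw_element_def D.symmetric_pbw_def)
  qed
  have alg: "unital_algebra D.symmetric_semidirect (\<phi> 1)" "unital_algebra D.cherednik_algebra (\<phi> 1)"
    using D.symmetric_relations D.cherednik_algebra_relations by (auto simp: cherednik_relations_def)
  show ?thesis
    using H linear_map_bases[OF alg S H] unfolding D.is_pbw_morphism_def by blast
qed

end
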